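(* Let $\mathcal X$ be a Noetherian $\mathbb F_1$-scheme, let $\underline X$ be its restriction to $\mathfrak{Mo}$, let $X$ be the geometric realization of $\underline X$, and let $X_{\mathbb Z}$ be the restriction of $\mathcal X$ to commutative rings. Assume that $X$ is torsion free, i.e. for every $x\in X$ the abelian group $\mathcal O_x^\times$ of invertible elements of the monoid $\mathcal O_x$ is torsion free. Then: (1) There exists a polynomial $N(x+1)$ with nonnegative integer coefficients (as a polynomial in $x$) such that $\#\,\underline X(\mathbb F_{1^n})=N(n+1)$ for all $n\in\mathbb N$, $n\ge1$. (2) For each finite field $\mathbb F_q$, the cardinality of the set of $\mathbb F_q$-rational points of the $\mathbb Z$-scheme $X_{\mathbb Z}$ is equal to $N(q)$. (3) The zeta function of $\mathcal X$ is $$\zeta_{\mathcal X}(s)=\prod_{x\in X}\frac{1}{\left(1-\frac1s\right)^{\otimes^{n(x)}}},$$ where $\otimes$ denotes Kurokawa's tensor product and $n(x)$ is the local dimension of $X$ at $x$, with the convention that $\left(1-\frac1s\right)^{\otimes^{0}}=s$.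
   Context: Monoids. $\mathfrak{Mo}$ is the category of commutative (multiplicative) monoids $M$ with unit $1$ and absorbing element $0$; morphisms are multiplicative and preserve $1$ and $0$. $M^\times$ is the group of invertible elements. For an abelian group $H$ put $\mathbb F_1[H]=H\cup\{0\}$; $\mathbb F_{1^n}=\mathbb F_1[\mathbb Z/n\mathbb Z]$. An ideal is a subset $I\ni0$ of $M$ with $IM\subset I$; it is prime if $1\notin I$ and $M\setminus I$ is multiplicatively closed. A monoid is Noetherian if every strictly increasing sequence of congruences (equivalence relations compatible with the product) is finite; equivalently, it is finitely generated. $\mathfrak{Mo}$-schemes. An $\mathfrak{Mo}$-functor is a covariant functor $\mathfrak{Mo}\to\mathfrak{Sets}$; $\mathfrak{spec}\,M$ is the functor $N\mapsto\mathrm{Hom}_{\mathfrak{Mo}}(M,N)$. A subfunctor $\mathcal G\subset\mathcal F$ is open if for every $M$ and every $\varphi:\mathfrak{spec}\,M\to\mathcal F$ there is an ideal $I\subset M$ such that for all $N$ and $\rho\in\mathrm{Hom}(M,N)$: $\varphi(\rho)\in\mathcal G(N)\Leftrightarrow\rho(I)N=N$. Open subfunctors $\mathcal F_\alpha$ cover $\mathcal F$ if $\mathcal F(\mathbb F_1[H])=\bigcup_\alpha\mathcal F_\alpha(\mathbb F_1[H])$ for all abelian groups $H$. An $\mathfrak{Mo}$-scheme is an $\mathfrak{Mo}$-functor with an open cover by representable subfunctors; it is Noetherian if it admits a finite open cover by functors $\mathfrak{spec}(M)$ with $M$ Noetherian. Geometric realization. A geometric space is a topological space with a sheaf of monoids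 (objects of $\mathfrak{Mo}$); morphisms are pairs $(\varphi,\varphi^\sharp)$ with $\varphi$ continuous and $\varphi^\sharp$ local on stalks ($\rho:M_1\to M_2$ is local if $\rho^{-1}(M_2^\times)=M_1^\times$). $\mathrm{Spec}(M)$ is the set of prime ideals of $M$ with open sets $D(I)=\{\mathfrak p: I\not\subset\mathfrak p\}$ and the usual structure sheaf with stalks $M_{\mathfrak p}=(M\setminus\mathfrak p)^{-1}M$. A geometric $\mathfrak{Mo}$-scheme is a geometric space locally isomorphic to spaces $\mathrm{Spec}(M)$. The geometric realization of an $\mathfrak{Mo}$-scheme $\underline X$ is the geometric $\mathfrak{Mo}$-scheme $X$, unique up to isomorphism, with $\underline X(N)=\mathrm{Hom}(\mathrm{Spec}(N),X)$ naturally in $N$. The local dimension $n(x)$ of $x\in X$ is the rank of the abelian group $\mathcal O_x^\times$, $\mathcal O_x$ being the stalk of the structure sheaf. $\mathbb F_1$-schemes. Let $\mathfrak{Ring}$ be the category of commutative unital rings, $\beta:\mathfrak{Mo}\to\mathfrak{Ring}$, $\beta(M)=\mathbb Z[M]$ (with $0\in M$ sent to $0$), and $\beta^*:\mathfrak{Ring}\to\mathfrak{Mo}$ the adjoint functor sending a ring to its multiplicative monoid. $\mathfrak{MR}=\mathfrak{Ring}\cup_{\beta,\beta^*}\mathfrak{Mo}$ is the category whose objects are the disjoint union of those of $\mathfrak{Ring}$ and $\mathfrak{Mo}$, containing both as full subcategories, with $\mathrm{Hom}(M,R)=\mathrm{Hom}_{\mathfrak{Ring}}(\beta(M),R)\cong\mathrm{Hom}_{\mathfrak{Mo}}(M,\beta^*(R))$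 and $\mathrm{Hom}(R,M)=\emptyset$ for $M$ a monoid and $R$ a ring. A covariant functor $\mathcal X:\mathfrak{MR}\to\mathfrak{Sets}$ amounts to its restrictions $X_{\mathbb Z}$ to $\mathfrak{Ring}$ and $\underline X$ to $\mathfrak{Mo}$ together with a natural transformation $e:\underline X\circ\beta^*\to X_{\mathbb Z}$. It is an $\mathbb F_1$-scheme if $X_{\mathbb Z}$ is a $\mathbb Z$-scheme (functor of points), $\underline X$ is an $\mathfrak{Mo}$-scheme, and $e$ evaluated at any field is a bijection. It is Noetherian if both $\underline X$ and $X_{\mathbb Z}$ are Noetherian. Zeta function. With counting polynomial $N$, put $Z(\mathcal X,q,T)=\exp\left(\sum_{r\ge1}N(q^r)\frac{T^r}{r}\right)$ and $\zeta_{\mathcal X}(s)=\lim_{q\to1}Z(\mathcal X,q,q^{-s})(q-1)^{N(1)}$ (for $s$ real and large, then extended as a rational function). Kurokawa tensor product. For rational functions $\prod_i(s-a_i)^{m_i}$ and $\prod_j(s-b_j)^{n_j}$ (finite products, integer exponents), the tensor product is $\prod_{i,j}(s-a_i-b_j)^{m_in_j}$; $f^{\otimes^n}$ is the $n$-fold tensor power. In particular $1-\frac1s=(s-1)s^{-1}$. *)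

theory Defs
  imports
    "HOL-Algebra.Elementary_Groups"
    "HOL-Algebra.Ring_Divisibility"
    "HOL-Analysis.Abstract_Topology"
    "HOL-Computational_Algebra.Computational_Algebra"
    "HOL-Computational_Algebra.Field_as_Ring"
begin

text \<open>
  Universe convention. The objects of the categories of monoids and of rings are the monoids and
  rings whose carrier is a set of elements of one type \<open>'a\<close>. The type variable plays the role of
  the universe of ``small'' elements; the only closure property required of it is that it is
  infinite, and this is a hypothesis of the theorem. Sets of values of functors, points of geometric
  spaces and sections of their sheaves live in further, arbitrary types. Objects built from
  \<open>'a\<close> in another type (localizations, stalks, the monoids \<open>\<F>\<^sub>1[H]\<close>) are compared with objects over
  \<open>'a\<close> by isomorphism.
\<close>

section \<open>Categories and set-valued functors\<close>

text \<open>\<open>Comp C x y z g f\<close> is the composite \<open>g \<circ> f\<close> of \<open>f : x \<rightarrow> y\<close> and \<open>g : y \<rightarrow> z\<close>.\<close>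

record ('o, 'm) cat =
  Ob :: "'o set"
  Hom :: "'o \<Rightarrow> 'o \<Rightarrow> 'm set"
  Ident :: "'o \<Rightarrow> 'm"
  Comp :: "'o \<Rightarrow> 'o \<Rightarrow> 'o \<Rightarrow> 'm \<Rightarrow> 'm \<Rightarrow> 'm"

record ('o, 'm, 'b) set_functor =
  Fob :: "'o \<Rightarrow> 'b set"
  Fmor :: "'o \<Rightarrow> 'o \<Rightarrow> 'm \<Rightarrow> 'b \<Rightarrow> 'b"

definition is_functor :: "('o, 'm) cat \<Rightarrow> ('o, 'm, 'b) set_functor \<Rightarrow> bool" where
  "is_functor C F \<longleftrightarrow>
     (\<forall>x\<in>Ob C. \<forall>y\<in>Ob C. \<forall>f\<in>Hom C x y. Fmor F x y f \<in> Fob F x \<rightarrow> Fob F y) \<and>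
     (\<forall>x\<in>Ob C. \<forall>a\<in>Fob F x. Fmor F x x (Ident C x) a = a) \<and>
     (\<forall>x\<in>Ob C. \<forall>y\<in>Ob C. \<forall>z\<in>Ob C. \<forall>f\<in>Hom C x y. \<forall>g\<in>Hom C y z. \<forall>a\<in>Fob F x.
        Fmor F x z (Comp C x y z g f) a = Fmor F y z g (Fmor F x y f a))"

definition nat_trans ::
  "('o, 'm) cat \<Rightarrow> ('o, 'm, 'b) set_functor \<Rightarrow> ('o, 'm, 'c) set_functor \<Rightarrow> ('o \<Rightarrow> 'b \<Rightarrow> 'c) \<Rightarrow> bool"
where
  "nat_trans C F G \<eta> \<longleftrightarrow>
     (\<forall>x\<in>Ob C. \<eta> x \<in> Fob F x \<rightarrow> Fob G x) \<and>
     (\<forall>x\<in>Ob C. \<forall>y\<in>Ob C. \<forall>f\<in>Hom C x y. \<forall>a\<in>Fob F x.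
        \<eta> y (Fmor F x y f a) = Fmor G x y f (\<eta> x a))"

definition nat_iso ::
  "('o, 'm) cat \<Rightarrow> ('o, 'm, 'b) set_functor \<Rightarrow> ('o, 'm, 'c) set_functor \<Rightarrow> bool" where
  "nat_iso C F G \<longleftrightarrow> (\<exists>\<eta>. nat_trans C F G \<eta> \<and> (\<forall>x\<in>Ob C. bij_betw (\<eta> x) (Fob F x) (Fob G x)))"

definition hom_functor :: "('o, 'm) cat \<Rightarrow> 'o \<Rightarrow> ('o, 'm, 'm) set_functor" where
  "hom_functor C x = \<lparr>Fob = Hom C x, Fmor = (\<lambda>y z g f. Comp C x y z g f)\<rparr>"

text \<open>
  A subfunctor of \<open>F\<close> is given by its values, the subsets \<open>G x\<close> of \<open>Fob F x\<close>; the functor itself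
  is then \<open>F\<lparr>Fob := G\<rparr>\<close>.
\<close>

definition is_subfunctor ::
  "('o, 'm) cat \<Rightarrow> ('o, 'm, 'b) set_functor \<Rightarrow> ('o \<Rightarrow> 'b set) \<Rightarrow> bool" where
  "is_subfunctor C F G \<longleftrightarrow>
     (\<forall>x\<in>Ob C. G x \<subseteq> Fob F x) \<and>
     (\<forall>x\<in>Ob C. \<forall>y\<in>Ob C. \<forall>f\<in>Hom C x y. Fmor F x y f ` G x \<subseteq> G y)"

section \<open>Commutative monoids with zero\<close>

record 'a mo = "'a monoid" +
  azero :: 'a  ("\<zero>\<^sub>a\<index>")

definition is_mo :: "'a mo \<Rightarrow> bool" where
  "is_mo M \<longleftrightarrow> comm_monoid M \<and> azero M \<in> carrier M \<and>
     (\<forall>x\<in>carrier M. azero M \<otimes>\<^bsub>M\<^esub> x = azero M)"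

text \<open>Morphisms are extensional functions, so that equality of morphisms is equality.\<close>

definition mo_hom :: "'a mo \<Rightarrow> 'b mo \<Rightarrow> ('a \<Rightarrow> 'b) set" where
  "mo_hom M N = {f \<in> hom M N. f \<in> extensional (carrier M) \<and>
     f \<one>\<^bsub>M\<^esub> = \<one>\<^bsub>N\<^esub> \<and> f (azero M) = azero N}"

definition mo_isomorphic :: "'a mo \<Rightarrow> 'b mo \<Rightarrow> bool" where
  "mo_isomorphic M N \<longleftrightarrow> (\<exists>f\<in>mo_hom M N. bij_betw f (carrier M) (carrier N))"

definition local_hom :: "'a mo \<Rightarrow> 'b mo \<Rightarrow> ('a \<Rightarrow> 'b) \<Rightarrow> bool" where
  "local_hom M N f \<longleftrightarrow> f \<in> mo_hom M N \<and> {a \<in> carrier M. f a \<in> Units N} = Units M"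

definition Mo :: "('a mo, 'a \<Rightarrow> 'a) cat" where
  "Mo = \<lparr>Ob = {M. is_mo M}, Hom = mo_hom, Ident = (\<lambda>M. restrict (\<lambda>x. x) (carrier M)),
         Comp = (\<lambda>L M N g f. compose (carrier L) g f)\<rparr>"

text \<open>\<open>\<F>\<^sub>1[H] = H \<union> {0}\<close>, with \<open>None\<close> as the added zero.\<close>

definition F1 :: "'h monoid \<Rightarrow> 'h option mo" where
  "F1 H = \<lparr>carrier = insert None (Some ` carrier H),
           mult = (\<lambda>x y. case (x, y) of (Some a, Some b) \<Rightarrow> Some (a \<otimes>\<^bsub>H\<^esub> b) | _ \<Rightarrow> None),
           one = Some \<one>\<^bsub>H\<^esub>, azero = None\<rparr>"

definition F1n :: "nat \<Rightarrow> int option mo" where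
  "F1n n = F1 (integer_mod_group n)"

definition mo_ideal :: "'a mo \<Rightarrow> 'a set \<Rightarrow> bool" where
  "mo_ideal M I \<longleftrightarrow> I \<subseteq> carrier M \<and> azero M \<in> I \<and>
     (\<forall>a\<in>I. \<forall>x\<in>carrier M. a \<otimes>\<^bsub>M\<^esub> x \<in> I)"

definition mo_prime :: "'a mo \<Rightarrow> 'a set \<Rightarrow> bool" where
  "mo_prime M P \<longleftrightarrow> mo_ideal M P \<and> \<one>\<^bsub>M\<^esub> \<notin> P \<and>
     (\<forall>a\<in>carrier M - P. \<forall>b\<in>carrier M - P. a \<otimes>\<^bsub>M\<^esub> b \<in> carrier M - P)"

definition mo_congruence :: "'a mo \<Rightarrow> ('a \<times> 'a) set \<Rightarrow> bool" where
  "mo_congruence M R \<longleftrightarrow> equiv (carrier M) R \<and>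
     (\<forall>(a, b)\<in>R. \<forall>(c, d)\<in>R. (a \<otimes>\<^bsub>M\<^esub> c, b \<otimes>\<^bsub>M\<^esub> d) \<in> R)"

definition noetherian_mo :: "'a mo \<Rightarrow> bool" where
  "noetherian_mo M \<longleftrightarrow> is_mo M \<and>
     \<not> (\<exists>R :: nat \<Rightarrow> ('a \<times> 'a) set. (\<forall>i. mo_congruence M (R i)) \<and> (\<forall>i. R i \<subset> R (Suc i)))"

text \<open>
  Every monoid whose cardinality does not exceed that of \<open>'a\<close> has an isomorphic copy over \<open>'a\<close>; in
  particular so does every \<open>\<F>\<^sub>1\<^sub>n\<close> with \<open>n \<ge> 1\<close> if \<open>'a\<close> is infinite.
\<close>

lemma is_mo_copy:
  fixes N :: "'b mo" and h :: "'b \<Rightarrow> 'a"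
  assumes N: "is_mo N" and h: "inj_on h (carrier N)"
  shows "\<exists>M::'a mo. is_mo M \<and> mo_isomorphic M N"
proof -
  interpret N: comm_monoid N using N by (simp add: is_mo_def)
  define g where "g = the_inv_into (carrier N) h"
  have gh: "g (h x) = x" if "x \<in> carrier N" for x
    using the_inv_into_f_f[OF h that] by (simp add: g_def)
  define M :: "'a mo" where "M = \<lparr>carrier = h ` carrier N, mult = (\<lambda>x y. h (g x \<otimes>\<^bsub>N\<^esub> g y)),
    one = h \<one>\<^bsub>N\<^esub>, azero = h (azero N)\<rparr>"
  have Z: "azero N \<in> carrier N" "\<And>x. x \<in> carrier N \<Longrightarrow> azero N \<otimes>\<^bsub>N\<^esub> x = azero N"
    using N by (auto simp: is_mo_def)
  have "comm_monoid M"
    by (rule comm_monoidI) (auto simp: M_def gh N.m_ac)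
  then have M: "is_mo M"
    using Z by (auto simp: is_mo_def M_def gh)
  have "restrict g (carrier M) \<in> mo_hom M N"
    using Z by (auto simp: mo_hom_def hom_def M_def gh)
  moreover have "bij_betw (restrict g (carrier M)) (carrier M) (carrier N)"
    unfolding M_def bij_betw_def inj_on_def by (auto simp: gh image_iff)
  ultimately show ?thesis using M unfolding mo_isomorphic_def by blast
qed

lemma is_mo_F1:
  assumes "comm_group H"
  shows "is_mo (F1 H)"
proof -
  interpret comm_group H by fact
  have "comm_monoid (F1 H)"
    by (rule comm_monoidI) (auto simp: F1_def m_ac split: option.splits)
  then show ?thesis by (auto simp: is_mo_def F1_def)
qed

lemma F1n_copy:
  assumes "infinite (UNIV :: 'a set)" and "n \<ge> 1"
  shows "\<exists>M::'a mo. is_mo M \<and> mo_isomorphic M (F1n n)"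
proof -
  have "finite (carrier (F1n n))"
    using assms(2) by (simp add: F1n_def F1_def carrier_integer_mod_group)
  moreover obtain B :: "'a set" where "finite B" "card B = card (carrier (F1n n))"
    using infinite_arbitrarily_large[OF assms(1)] by blast
  ultimately obtain h :: "int option \<Rightarrow> 'a" where "bij_betw h (carrier (F1n n)) B"
    by (metis finite_same_card_bij)
  then have "inj_on h (carrier (F1n n))" by (rule bij_betw_imp_inj_on)
  moreover have "is_mo (F1n n)"
    unfolding F1n_def by (rule is_mo_F1) (simp add: abelian_integer_mod_group)
  ultimately show ?thesis by (rule is_mo_copy[rotated])
qed

section \<open>Schemes over the category of monoids\<close>

type_synonym ('a, 'b) mo_functor = "('a mo, 'a \<Rightarrow> 'a, 'b) set_functor"

definition mo_open_subfunctor :: "('a, 'b) mo_functor \<Rightarrow> ('a mo \<Rightarrow> 'b set) \<Rightarrow> bool" where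
  "mo_open_subfunctor F G \<longleftrightarrow> is_subfunctor Mo F G \<and>
     (\<forall>M \<phi>. is_mo M \<and> nat_trans Mo (hom_functor Mo M) F \<phi> \<longrightarrow>
        (\<exists>I. mo_ideal M I \<and>
           (\<forall>N. is_mo N \<longrightarrow> (\<forall>\<rho>\<in>mo_hom M N.
              \<phi> N \<rho> \<in> G N \<longleftrightarrow> {\<rho> i \<otimes>\<^bsub>N\<^esub> y |i y. i \<in> I \<and> y \<in> carrier N} = carrier N))))"

text \<open>The test objects are all objects isomorphic to some \<open>\<F>\<^sub>1[H]\<close>, \<open>H\<close> an abelian group.\<close>

definition mo_open_cover :: "('a, 'b) mo_functor \<Rightarrow> ('a mo \<Rightarrow> 'b set) set \<Rightarrow> bool" where
  "mo_open_cover F \<G> \<longleftrightarrow> (\<forall>G\<in>\<G>. mo_open_subfunctor F G) \<and>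
     (\<forall>(H :: 'a monoid) K. comm_group H \<and> is_mo K \<and> mo_isomorphic K (F1 H) \<longrightarrow>
        Fob F K = (\<Union>G\<in>\<G>. G K))"

definition mo_scheme :: "('a, 'b) mo_functor \<Rightarrow> bool" where
  "mo_scheme F \<longleftrightarrow> is_functor Mo F \<and>
     (\<exists>\<G>. mo_open_cover F \<G> \<and>
        (\<forall>G\<in>\<G>. \<exists>M. is_mo M \<and> nat_iso Mo (hom_functor Mo M) (F\<lparr>Fob := G\<rparr>)))"

definition noetherian_mo_scheme :: "('a, 'b) mo_functor \<Rightarrow> bool" where
  "noetherian_mo_scheme F \<longleftrightarrow> mo_scheme F \<and>
     (\<exists>\<G>. finite \<G> \<and> mo_open_cover F \<G> \<and>
        (\<forall>G\<in>\<G>. \<exists>M. noetherian_mo M \<and> nat_iso Mo (hom_functor Mo M) (F\<lparr>Fob := G\<rparr>)))"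

section \<open>Geometric spaces\<close>

record ('p, 's) gspace =
  gtop :: "'p topology"
  sect :: "'p set \<Rightarrow> 's mo"
  resm :: "'p set \<Rightarrow> 'p set \<Rightarrow> 's \<Rightarrow> 's"  \<comment> \<open>\<open>resm X U V\<close> restricts sections from \<open>U\<close> to \<open>V\<close>\<close>

abbreviation points :: "('p, 's) gspace \<Rightarrow> 'p set" where
  "points X \<equiv> topspace (gtop X)"

definition geometric_space :: "('p, 's) gspace \<Rightarrow> bool" where
  "geometric_space X \<longleftrightarrow>
     (\<forall>U. openin (gtop X) U \<longrightarrow> is_mo (sect X U)) \<and>
     (\<forall>U V. openin (gtop X) U \<and> openin (gtop X) V \<and> V \<subseteq> U \<longrightarrow>
        restrict (resm X U V) (carrier (sect X U)) \<in> mo_hom (sect X U) (sect X V)) \<and>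
     (\<forall>U. openin (gtop X) U \<longrightarrow> (\<forall>s\<in>carrier (sect X U). resm X U U s = s)) \<and>
     (\<forall>U V W. openin (gtop X) U \<and> openin (gtop X) V \<and> openin (gtop X) W \<and> W \<subseteq> V \<and> V \<subseteq> U \<longrightarrow>
        (\<forall>s\<in>carrier (sect X U). resm X V W (resm X U V s) = resm X U W s)) \<and>
     (\<forall>\<U> s. (\<forall>U\<in>\<U>. openin (gtop X) U \<and> s U \<in> carrier (sect X U)) \<and>
        (\<forall>U\<in>\<U>. \<forall>V\<in>\<U>. resm X U (U \<inter> V) (s U) = resm X V (U \<inter> V) (s V)) \<longrightarrow>
        (\<exists>!t. t \<in> carrier (sect X (\<Union>\<U>)) \<and> (\<forall>U\<in>\<U>. resm X (\<Union>\<U>) U t = s U)))"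

text \<open>
  A germ at \<open>x\<close> is the set of all pairs (open neighbourhood of \<open>x\<close>, section over it) that agree near
  \<open>x\<close>. In \<open>stalk\<close> the unions run over representatives; all members of such a union are equal.
\<close>

definition germ :: "('p, 's) gspace \<Rightarrow> 'p \<Rightarrow> 'p set \<Rightarrow> 's \<Rightarrow> ('p set \<times> 's) set" where
  "germ X x U s = {(V, t). openin (gtop X) V \<and> x \<in> V \<and> t \<in> carrier (sect X V) \<and>
     (\<exists>W. openin (gtop X) W \<and> x \<in> W \<and> W \<subseteq> U \<inter> V \<and> resm X U W s = resm X V W t)}"

definition stalk :: "('p, 's) gspace \<Rightarrow> 'p \<Rightarrow> ('p set \<times> 's) set mo" where
  "stalk X x =
     \<lparr>carrier = {germ X x U s |U s. openin (gtop X) U \<and> x \<in> U \<and> s \<in> carrier (sect X U)},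
      mult = (\<lambda>A B. \<Union>(U, s)\<in>A. \<Union>(V, t)\<in>B.
        germ X x (U \<inter> V) (resm X U (U \<inter> V) s \<otimes>\<^bsub>sect X (U \<inter> V)\<^esub> resm X V (U \<inter> V) t)),
      one = germ X x (points X) \<one>\<^bsub>sect X (points X)\<^esub>,
      azero = germ X x (points X) (azero (sect X (points X)))\<rparr>"

text \<open>
  A morphism \<open>X \<rightarrow> Y\<close> is a pair \<open>(\<phi>, \<phi>')\<close>, where \<open>\<phi>' V\<close> maps sections over the open set \<open>V\<close> of \<open>Y\<close>
  to sections over its preimage. Both components are extensional.
\<close>

type_synonym ('p, 's, 'q, 't) gmor = "('p \<Rightarrow> 'q) \<times> ('q set \<Rightarrow> 't \<Rightarrow> 's)"

definition preim :: "('p, 's) gspace \<Rightarrow> ('p \<Rightarrow> 'q) \<Rightarrow> 'q set \<Rightarrow> 'p set" where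
  "preim X \<phi> V = {x \<in> points X. \<phi> x \<in> V}"

definition stalk_map ::
  "('p, 's) gspace \<Rightarrow> ('q, 't) gspace \<Rightarrow> ('p, 's, 'q, 't) gmor \<Rightarrow> 'p \<Rightarrow>
     ('q set \<times> 't) set \<Rightarrow> ('p set \<times> 's) set" where
  "stalk_map X Y f x = restrict (\<lambda>A. \<Union>(V, t)\<in>A. germ X x (preim X (fst f) V) (snd f V t))
     (carrier (stalk Y (fst f x)))"

definition gmor ::
  "('p, 's) gspace \<Rightarrow> ('q, 't) gspace \<Rightarrow> ('p, 's, 'q, 't) gmor set" where
  "gmor X Y = {f.
     continuous_map (gtop X) (gtop Y) (fst f) \<and> fst f \<in> extensional (points X) \<and>
     snd f \<in> extensional {V. openin (gtop Y) V} \<and>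
     (\<forall>V. openin (gtop Y) V \<longrightarrow> snd f V \<in> mo_hom (sect Y V) (sect X (preim X (fst f) V))) \<and>
     (\<forall>V V'. openin (gtop Y) V \<and> openin (gtop Y) V' \<and> V' \<subseteq> V \<longrightarrow> (\<forall>t\<in>carrier (sect Y V).
        snd f V' (resm Y V V' t)
          = resm X (preim X (fst f) V) (preim X (fst f) V') (snd f V t))) \<and>
     (\<forall>x\<in>points X. local_hom (stalk Y (fst f x)) (stalk X x) (stalk_map X Y f x))}"

definition gid :: "('p, 's) gspace \<Rightarrow> ('p, 's, 'p, 's) gmor" where
  "gid X = (restrict (\<lambda>x. x) (points X),
     restrict (\<lambda>U. restrict (\<lambda>s. s) (carrier (sect X U))) {U. openin (gtop X) U})"

text \<open>\<open>gcomp X Y Z g f\<close> is the composite of \<open>f : X \<rightarrow> Y\<close> and \<open>g : Y \<rightarrow> Z\<close>.\<close>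

definition gcomp ::
  "('p, 's) gspace \<Rightarrow> ('q, 't) gspace \<Rightarrow> ('r, 'u) gspace \<Rightarrow>
     ('q, 't, 'r, 'u) gmor \<Rightarrow> ('p, 's, 'q, 't) gmor \<Rightarrow> ('p, 's, 'r, 'u) gmor" where
  "gcomp X Y Z g f = (compose (points X) (fst g) (fst f),
     restrict (\<lambda>W. compose (carrier (sect Z W)) (snd f (preim Y (fst g) W)) (snd g W))
       {W. openin (gtop Z) W})"

definition gspace_isomorphic :: "('p, 's) gspace \<Rightarrow> ('q, 't) gspace \<Rightarrow> bool" where
  "gspace_isomorphic X Y \<longleftrightarrow>
     (\<exists>f\<in>gmor X Y. \<exists>g\<in>gmor Y X. gcomp X Y X g f = gid X \<and> gcomp Y X Y f g = gid Y)"

definition open_subspace :: "('p, 's) gspace \<Rightarrow> 'p set \<Rightarrow> ('p, 's) gspace" where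
  "open_subspace X U = X\<lparr>gtop := subtopology (gtop X) U\<rparr>"

section \<open>The spectrum of a monoid\<close>

text \<open>
  The localization of \<open>M\<close> at a prime ideal \<open>P\<close>; \<open>frac M P a s\<close> is the fraction \<open>a/s\<close>, the class of
  the pair \<open>(a, s)\<close> in \<open>M \<times> (M - P)\<close>.
\<close>

definition frac :: "'a mo \<Rightarrow> 'a set \<Rightarrow> 'a \<Rightarrow> 'a \<Rightarrow> ('a \<times> 'a) set" where
  "frac M P a s = {(b, t). b \<in> carrier M \<and> t \<in> carrier M - P \<and>
     (\<exists>u\<in>carrier M - P. u \<otimes>\<^bsub>M\<^esub> (t \<otimes>\<^bsub>M\<^esub> a) = u \<otimes>\<^bsub>M\<^esub> (s \<otimes>\<^bsub>M\<^esub> b))}"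

definition mo_loc :: "'a mo \<Rightarrow> 'a set \<Rightarrow> ('a \<times> 'a) set mo" where
  "mo_loc M P =
     \<lparr>carrier = {frac M P a s |a s. a \<in> carrier M \<and> s \<in> carrier M - P},
      mult = (\<lambda>A B. \<Union>(a, s)\<in>A. \<Union>(b, t)\<in>B. frac M P (a \<otimes>\<^bsub>M\<^esub> b) (s \<otimes>\<^bsub>M\<^esub> t)),
      one = frac M P \<one>\<^bsub>M\<^esub> \<one>\<^bsub>M\<^esub>,
      azero = frac M P (azero M) \<one>\<^bsub>M\<^esub>\<rparr>"

definition Spec_top :: "'a mo \<Rightarrow> 'a set topology" where
  "Spec_top M = topology (\<lambda>U. \<exists>I. mo_ideal M I \<and> U = {P. mo_prime M P \<and> \<not> I \<subseteq> P})"

lemma istopology_Spec: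
  assumes "is_mo M"
  shows "istopology (\<lambda>U. \<exists>I. mo_ideal M I \<and> U = {P. mo_prime M P \<and> \<not> I \<subseteq> P})"
proof -
  interpret comm_monoid M using assms by (simp add: is_mo_def)
  let ?D = "\<lambda>I. {P. mo_prime M P \<and> \<not> I \<subseteq> P}"
  have int: "\<exists>L. mo_ideal M L \<and> ?D I \<inter> ?D J = ?D L" if I: "mo_ideal M I" and J: "mo_ideal M J" for I J
  proof (intro exI conjI)
    show "mo_ideal M (I \<inter> J)"
      using I J by (auto simp: mo_ideal_def)
    show "?D I \<inter> ?D J = ?D (I \<inter> J)"
    proof (intro equalityI subsetI)
      fix P assume P: "P \<in> ?D I \<inter> ?D J"
      then obtain a b where ab: "a \<in> I" "a \<notin> P" "b \<in> J" "b \<notin> P" by auto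
      with I J have c: "a \<in> carrier M" "b \<in> carrier M" by (auto simp: mo_ideal_def)
      have "a \<otimes>\<^bsub>M\<^esub> b \<in> I" "b \<otimes>\<^bsub>M\<^esub> a \<in> J"
        using I J ab c by (simp_all add: mo_ideal_def)
      then have "a \<otimes>\<^bsub>M\<^esub> b \<in> I \<inter> J"
        using m_comm[OF c] by simp
      moreover have "a \<otimes>\<^bsub>M\<^esub> b \<notin> P"
        using P ab c by (simp add: mo_prime_def)
      ultimately show "P \<in> ?D (I \<inter> J)"
        using P by blast
    qed auto
  qed
  have un: "\<exists>L. mo_ideal M L \<and> \<Union>\<K> = ?D L" if "\<forall>U\<in>\<K>. \<exists>I. mo_ideal M I \<and> U = ?D I" for \<K>
  proof -
    from bchoice[OF that] obtain I where I: "\<forall>U\<in>\<K>. mo_ideal M (I U) \<and> U = ?D (I U)" ..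
    have idI: "mo_ideal M (I U)" if "U \<in> \<K>" for U
      using I that by (elim ballE[of _ _ U]) simp_all
    have eqI: "P \<in> U \<longleftrightarrow> P \<in> ?D (I U)" if "U \<in> \<K>" for U P
      using bspec[OF I that, THEN conjunct2] by (rule arg_cong)
    define L where "L = insert (azero M) (\<Union>U\<in>\<K>. I U)"
    have "mo_ideal M L"
      unfolding mo_ideal_def
    proof (intro conjI ballI)
      show "L \<subseteq> carrier M" "azero M \<in> L"
        using idI assms by (auto simp: mo_ideal_def L_def is_mo_def)
      fix a x assume ax: "a \<in> L" "x \<in> carrier M"
      show "a \<otimes>\<^bsub>M\<^esub> x \<in> L"
      proof (cases "a = azero M")
        case True
        then show ?thesis using assms ax by (simp add: L_def is_mo_def)
      next
        case False
        then obtain U where "U \<in> \<K>" "a \<in> I U" using ax by (auto simp: L_def)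
        moreover from this have "a \<otimes>\<^bsub>M\<^esub> x \<in> I U" using idI ax by (simp add: mo_ideal_def)
        ultimately show ?thesis by (auto simp: L_def)
      qed
    qed
    moreover have "\<Union>\<K> = ?D L"
    proof (intro equalityI subsetI)
      fix P assume "P \<in> \<Union>\<K>"
      then obtain U where "U \<in> \<K>" "P \<in> U" by blast
      then have "P \<in> ?D (I U)" using eqI by (simp only:)
      with \<open>U \<in> \<K>\<close> show "P \<in> ?D L" by (auto simp: L_def)
    next
      fix P assume P: "P \<in> ?D L"
      then have "azero M \<in> P" by (auto simp: mo_prime_def mo_ideal_def)
      with P obtain U where U: "U \<in> \<K>" "\<not> I U \<subseteq> P" by (auto simp: L_def)
      with P have "P \<in> ?D (I U)" by blast
      then have "P \<in> U" using eqI[OF U(1)] by (simp only:)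
      with U(1) show "P \<in> \<Union>\<K>" by blast
    qed
    ultimately show ?thesis by blast
  qed
  show ?thesis
    unfolding istopology_def
  proof (intro conjI allI impI)
    fix S T assume "\<exists>I. mo_ideal M I \<and> S = ?D I" "\<exists>I. mo_ideal M I \<and> T = ?D I"
    then show "\<exists>I. mo_ideal M I \<and> S \<inter> T = ?D I" by (elim exE conjE) (simp only: int)
  next
    fix \<K> assume "\<forall>K\<in>\<K>. \<exists>I. mo_ideal M I \<and> K = ?D I"
    then show "\<exists>I. mo_ideal M I \<and> \<Union>\<K> = ?D I" by (rule un)
  qed
qed

text \<open>
  Sections over \<open>U\<close> are the families of elements of the localizations \<open>M\<^sub>P\<close>, \<open>P \<in> U\<close>, that are locally
  given by one fraction.
\<close>

definition Spec_sections :: "'a mo \<Rightarrow> 'a set set \<Rightarrow> ('a set \<Rightarrow> ('a \<times> 'a) set) set" where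
  "Spec_sections M U = {\<sigma> \<in> (\<Pi>\<^sub>E P\<in>U. carrier (mo_loc M P)).
     \<forall>P\<in>U. \<exists>V. openin (Spec_top M) V \<and> P \<in> V \<and> V \<subseteq> U \<and>
       (\<exists>a\<in>carrier M. \<exists>s\<in>carrier M. \<forall>Q\<in>V. s \<notin> Q \<and> \<sigma> Q = frac M Q a s)}"

definition Spec :: "'a mo \<Rightarrow> ('a set, 'a set \<Rightarrow> ('a \<times> 'a) set) gspace" where
  "Spec M =
     \<lparr>gtop = Spec_top M,
      sect = (\<lambda>U. \<lparr>carrier = Spec_sections M U,
                   mult = (\<lambda>\<sigma> \<tau>. restrict (\<lambda>P. \<sigma> P \<otimes>\<^bsub>mo_loc M P\<^esub> \<tau> P) U),
                   one = restrict (\<lambda>P. \<one>\<^bsub>mo_loc M P\<^esub>) U,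
                   azero = restrict (\<lambda>P. azero (mo_loc M P)) U\<rparr>),
      resm = (\<lambda>U V \<sigma>. restrict \<sigma> V)\<rparr>"

text \<open>
  The morphism \<open>Spec N \<rightarrow> Spec M\<close> induced by \<open>\<rho> : M \<rightarrow> N\<close>: on points it is \<open>Q \<mapsto> \<rho>\<^sup>-\<^sup>1(Q)\<close>, and on
  sections it is induced by the maps \<open>a/s \<mapsto> \<rho>(a)/\<rho>(s)\<close> between the localizations.
\<close>

definition Spec_map ::
  "'a mo \<Rightarrow> 'a mo \<Rightarrow> ('a \<Rightarrow> 'a) \<Rightarrow>
     ('a set, 'a set \<Rightarrow> ('a \<times> 'a) set, 'a set, 'a set \<Rightarrow> ('a \<times> 'a) set) gmor" where
  "Spec_map M N \<rho> =
     (let \<phi> = restrict (\<lambda>Q. {a \<in> carrier M. \<rho> a \<in> Q}) (points (Spec N)) in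
      (\<phi>,
       restrict (\<lambda>U. restrict
           (\<lambda>\<sigma>. restrict (\<lambda>Q. \<Union>(a, s)\<in>\<sigma> (\<phi> Q). frac N Q (\<rho> a) (\<rho> s)) (preim (Spec N) \<phi> U))
           (carrier (sect (Spec M) U)))
         {U. openin (gtop (Spec M)) U}))"

definition geometric_mo_scheme :: "'a itself \<Rightarrow> ('p, 's) gspace \<Rightarrow> bool" where
  "geometric_mo_scheme _ X \<longleftrightarrow> geometric_space X \<and>
     (\<forall>x\<in>points X. \<exists>U. openin (gtop X) U \<and> x \<in> U \<and>
        (\<exists>M :: 'a mo. is_mo M \<and> gspace_isomorphic (open_subspace X U) (Spec M)))"

definition points_functor ::
  "('p, 's) gspace \<Rightarrow>
     ('a, ('a set, 'a set \<Rightarrow> ('a \<times> 'a) set, 'p, 's) gmor) mo_functor" where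
  "points_functor X =
     \<lparr>Fob = (\<lambda>N. gmor (Spec N) X),
      Fmor = (\<lambda>N N' \<rho> f. gcomp (Spec N') (Spec N) X f (Spec_map N N' \<rho>))\<rparr>"

definition geometric_realization :: "('a, 'b) mo_functor \<Rightarrow> ('p, 's) gspace \<Rightarrow> bool" where
  "geometric_realization F X \<longleftrightarrow>
     geometric_mo_scheme TYPE('a) X \<and> nat_iso Mo F (points_functor X)"

definition torsion_free :: "'g monoid \<Rightarrow> bool" where
  "torsion_free G \<longleftrightarrow> (\<forall>u\<in>carrier G. \<forall>n>0. u [^]\<^bsub>G\<^esub> (n::nat) = \<one>\<^bsub>G\<^esub> \<longrightarrow> u = \<one>\<^bsub>G\<^esub>)"

definition torsion_free_space :: "('p, 's) gspace \<Rightarrow> bool" where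
  "torsion_free_space X \<longleftrightarrow> (\<forall>x\<in>points X. torsion_free (units_of (stalk X x)))"

text \<open>
  The rank of an abelian group: the maximal number of \<open>\<int>\<close>-linearly independent elements. The value is
  unspecified for groups of infinite rank.
\<close>

definition ab_independent :: "'g monoid \<Rightarrow> 'g set \<Rightarrow> bool" where
  "ab_independent G B \<longleftrightarrow> B \<subseteq> carrier G \<and> finite B \<and>
     (\<forall>c :: 'g \<Rightarrow> int. finprod G (\<lambda>b. b [^]\<^bsub>G\<^esub> c b) B = \<one>\<^bsub>G\<^esub> \<longrightarrow> (\<forall>b\<in>B. c b = 0))"

definition ab_rank :: "'g monoid \<Rightarrow> nat" where
  "ab_rank G = Sup {card B |B. ab_independent G B}"

definition local_dim :: "('p, 's) gspace \<Rightarrow> 'p \<Rightarrow> nat" where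
  "local_dim X x = ab_rank (units_of (stalk X x))"

section \<open>Schemes over the integers as functors of points\<close>

definition Ring :: "('a ring, 'a \<Rightarrow> 'a) cat" where
  "Ring = \<lparr>Ob = {R. cring R},
           Hom = (\<lambda>R S. ring_hom R S \<inter> extensional (carrier R)),
           Ident = (\<lambda>R. restrict (\<lambda>x. x) (carrier R)),
           Comp = (\<lambda>R S T g f. compose (carrier R) g f)\<rparr>"

type_synonym ('a, 'b) ring_functor = "('a ring, 'a \<Rightarrow> 'a, 'b) set_functor"

text \<open>\<open>\<rho> : R \<rightarrow> S\<close> is a localization \<open>R \<rightarrow> R[1/f]\<close>.\<close>

definition is_localization :: "'a ring \<Rightarrow> 'a \<Rightarrow> 'a ring \<Rightarrow> ('a \<Rightarrow> 'a) \<Rightarrow> bool" where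
  "is_localization R f S \<rho> \<longleftrightarrow> cring S \<and> \<rho> \<in> Hom Ring R S \<and> \<rho> f \<in> Units S \<and>
     (\<forall>T. cring T \<longrightarrow> (\<forall>\<sigma>\<in>Hom Ring R T. \<sigma> f \<in> Units T \<longrightarrow>
        (\<exists>!\<tau>. \<tau> \<in> Hom Ring S T \<and> Comp Ring R S T \<tau> \<rho> = \<sigma>)))"

text \<open>
  Locality of a functor on rings (the sheaf property for the Zariski topology): if finitely many \<open>f\<close>
  generate the unit ideal of \<open>R\<close>, then \<open>F(R)\<close> is the equalizer of the two maps from the product of
  the \<open>F(R[1/f])\<close> to the product of the \<open>F(R[1/(fg)])\<close>. \<open>S f\<close> and \<open>\<rho> f\<close> denote a localization at \<open>f\<close>.
\<close>

definition local_ring_functor :: "('a, 'b) ring_functor \<Rightarrow> bool" where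
  "local_ring_functor F \<longleftrightarrow>
     (\<forall>R E S \<rho> \<xi>. cring R \<and> finite E \<and> E \<subseteq> carrier R \<and> genideal R E = carrier R \<and>
        (\<forall>f\<in>E. is_localization R f (S f) (\<rho> f) \<and> \<xi> f \<in> Fob F (S f)) \<and>
        (\<forall>f\<in>E. \<forall>g\<in>E. \<forall>T \<tau>. is_localization R (f \<otimes>\<^bsub>R\<^esub> g) T \<tau> \<longrightarrow>
           (\<forall>\<alpha>\<in>Hom Ring (S f) T. \<forall>\<beta>\<in>Hom Ring (S g) T.
              Comp Ring R (S f) T \<alpha> (\<rho> f) = \<tau> \<and> Comp Ring R (S g) T \<beta> (\<rho> g) = \<tau> \<longrightarrow>
              Fmor F (S f) T \<alpha> (\<xi> f) = Fmor F (S g) T \<beta> (\<xi> g)))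
        \<longrightarrow> (\<exists>!x. x \<in> Fob F R \<and> (\<forall>f\<in>E. Fmor F R (S f) (\<rho> f) x = \<xi> f)))"

definition ring_open_subfunctor :: "('a, 'b) ring_functor \<Rightarrow> ('a ring \<Rightarrow> 'b set) \<Rightarrow> bool" where
  "ring_open_subfunctor F G \<longleftrightarrow> is_subfunctor Ring F G \<and>
     (\<forall>R \<phi>. cring R \<and> nat_trans Ring (hom_functor Ring R) F \<phi> \<longrightarrow>
        (\<exists>I. ideal I R \<and>
           (\<forall>S. cring S \<longrightarrow> (\<forall>\<rho>\<in>Hom Ring R S.
              \<phi> S \<rho> \<in> G S \<longleftrightarrow> genideal S (\<rho> ` I) = carrier S))))"

definition ring_open_cover :: "('a, 'b) ring_functor \<Rightarrow> ('a ring \<Rightarrow> 'b set) set \<Rightarrow> bool" where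
  "ring_open_cover F \<G> \<longleftrightarrow> (\<forall>G\<in>\<G>. ring_open_subfunctor F G) \<and>
     (\<forall>K. field K \<longrightarrow> Fob F K = (\<Union>G\<in>\<G>. G K))"

definition Z_scheme :: "('a, 'b) ring_functor \<Rightarrow> bool" where
  "Z_scheme F \<longleftrightarrow> is_functor Ring F \<and> local_ring_functor F \<and>
     (\<exists>\<G>. ring_open_cover F \<G> \<and>
        (\<forall>G\<in>\<G>. \<exists>R. cring R \<and> nat_iso Ring (hom_functor Ring R) (F\<lparr>Fob := G\<rparr>)))"

definition noetherian_Z_scheme :: "('a, 'b) ring_functor \<Rightarrow> bool" where
  "noetherian_Z_scheme F \<longleftrightarrow> Z_scheme F \<and>
     (\<exists>\<G>. finite \<G> \<and> ring_open_cover F \<G> \<and>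
        (\<forall>G\<in>\<G>. \<exists>R. cring R \<and> noetherian_ring R \<and>
           nat_iso Ring (hom_functor Ring R) (F\<lparr>Fob := G\<rparr>)))"

section \<open>Schemes over F1\<close>

text \<open>\<open>\<beta>\<^sup>*\<close> sends a ring to its multiplicative monoid.\<close>

definition beta_star :: "'a ring \<Rightarrow> 'a mo" where
  "beta_star R = \<lparr>carrier = carrier R, mult = mult R, one = one R, azero = zero R\<rparr>"

datatype 'a mr_ob = Mon "'a mo" | Rng "'a ring"

text \<open>
  The glued category. The morphisms from a monoid \<open>M\<close> to a ring \<open>R\<close> are taken in the form
  \<open>Hom(M, \<beta>\<^sup>*(R))\<close>, which is naturally isomorphic to \<open>Hom(\<int>[M], R)\<close> by adjunction.
\<close>

fun MR_hom :: "'a mr_ob \<Rightarrow> 'a mr_ob \<Rightarrow> ('a \<Rightarrow> 'a) set" where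
  "MR_hom (Mon M) (Mon N) = Hom Mo M N"
| "MR_hom (Rng R) (Rng S) = Hom Ring R S"
| "MR_hom (Mon M) (Rng R) = mo_hom M (beta_star R)"
| "MR_hom (Rng R) (Mon M) = {}"

fun MR_carrier :: "'a mr_ob \<Rightarrow> 'a set" where
  "MR_carrier (Mon M) = carrier M"
| "MR_carrier (Rng R) = carrier R"

definition MR :: "('a mr_ob, 'a \<Rightarrow> 'a) cat" where
  "MR = \<lparr>Ob = Mon ` Ob Mo \<union> Rng ` Ob Ring,
         Hom = MR_hom,
         Ident = (\<lambda>x. restrict (\<lambda>a. a) (MR_carrier x)),
         Comp = (\<lambda>x y z g f. compose (MR_carrier x) g f)\<rparr>"

type_synonym ('a, 'b) mr_functor = "('a mr_ob, 'a \<Rightarrow> 'a, 'b) set_functor"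

definition mo_part :: "('a, 'b) mr_functor \<Rightarrow> ('a, 'b) mo_functor" where
  "mo_part \<X> = \<lparr>Fob = (\<lambda>M. Fob \<X> (Mon M)), Fmor = (\<lambda>M N. Fmor \<X> (Mon M) (Mon N))\<rparr>"

definition ring_part :: "('a, 'b) mr_functor \<Rightarrow> ('a, 'b) ring_functor" where
  "ring_part \<X> = \<lparr>Fob = (\<lambda>R. Fob \<X> (Rng R)), Fmor = (\<lambda>R S. Fmor \<X> (Rng R) (Rng S))\<rparr>"

text \<open>
  The natural transformation \<open>e\<close>: its component at \<open>R\<close> is the image under the functor of the morphism
  \<open>\<beta>\<^sup>*(R) \<rightarrow> R\<close> that corresponds to the identity of \<open>\<beta>\<^sup>*(R)\<close>.
\<close>

definition ev :: "('a, 'b) mr_functor \<Rightarrow> 'a ring \<Rightarrow> 'b \<Rightarrow> 'b" where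
  "ev \<X> R = Fmor \<X> (Mon (beta_star R)) (Rng R) (restrict (\<lambda>a. a) (carrier R))"

definition F1_scheme :: "('a, 'b) mr_functor \<Rightarrow> bool" where
  "F1_scheme \<X> \<longleftrightarrow> is_functor MR \<X> \<and> Z_scheme (ring_part \<X>) \<and> mo_scheme (mo_part \<X>) \<and>
     (\<forall>K. field K \<longrightarrow>
        bij_betw (ev \<X> K) (Fob (mo_part \<X>) (beta_star K)) (Fob (ring_part \<X>) K))"

definition noetherian_F1_scheme :: "('a, 'b) mr_functor \<Rightarrow> bool" where
  "noetherian_F1_scheme \<X> \<longleftrightarrow> F1_scheme \<X> \<and>
     noetherian_mo_scheme (mo_part \<X>) \<and> noetherian_Z_scheme (ring_part \<X>)"

section \<open>Rational functions, Kurokawa tensor product and zeta function\<close>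

type_synonym ratfun = "complex poly fract"

definition rat_s :: ratfun where
  "rat_s = to_fract [:0, 1:]"

definition rat_eval :: "ratfun \<Rightarrow> complex \<Rightarrow> complex" where
  "rat_eval f z = poly (fst (quot_of_fract f)) z / poly (snd (quot_of_fract f)) z"

text \<open>The order of vanishing of a nonzero rational function; negative at a pole.\<close>

definition rat_order :: "ratfun \<Rightarrow> complex \<Rightarrow> int" where
  "rat_order f a = int (Polynomial.order a (fst (quot_of_fract f)))
     - int (Polynomial.order a (snd (quot_of_fract f)))"

definition rat_support :: "ratfun \<Rightarrow> complex set" where
  "rat_support f = {a. rat_order f a \<noteq> 0}"

text \<open>
  For \<open>f = \<Prod>\<^sub>i (s - a\<^sub>i)\<^bsup>m\<^sub>i\<^esup>\<close> with distinct \<open>a\<^sub>i\<close>, the exponent \<open>m\<^sub>i\<close> is the order of \<open>f\<close> at \<open>a\<^sub>i\<close>.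
\<close>

definition kurokawa :: "ratfun \<Rightarrow> ratfun \<Rightarrow> ratfun" where
  "kurokawa f g = (\<Prod>a\<in>rat_support f. \<Prod>b\<in>rat_support g.
     to_fract [:- (a + b), 1:] powi (rat_order f a * rat_order g b))"

fun kurokawa_power :: "ratfun \<Rightarrow> nat \<Rightarrow> ratfun" where
  "kurokawa_power f 0 = rat_s"
| "kurokawa_power f (Suc 0) = f"
| "kurokawa_power f (Suc (Suc n)) = kurokawa (kurokawa_power f (Suc n)) f"

definition poly_at :: "int poly \<Rightarrow> real \<Rightarrow> real" where
  "poly_at N x = poly (map_poly real_of_int N) x"

text \<open>The \<open>r\<close>-th summand, \<open>r \<ge> 1\<close>, of the exponent of \<open>Z(q, T)\<close> is the term with index \<open>r - 1\<close>.\<close>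

definition Z_term :: "int poly \<Rightarrow> real \<Rightarrow> real \<Rightarrow> nat \<Rightarrow> real" where
  "Z_term N q T r = poly_at N (q ^ Suc r) * T ^ Suc r / real (Suc r)"

definition Z_fun :: "int poly \<Rightarrow> real \<Rightarrow> real \<Rightarrow> real" where
  "Z_fun N q T = exp (\<Sum>r. Z_term N q T r)"

text \<open>
  \<open>\<zeta>\<close> is the zeta function with counting polynomial \<open>N\<close>: the rational function whose values at all
  sufficiently large real \<open>s\<close> are the limits as \<open>q \<rightarrow> 1\<close> from above; for \<open>q < 1\<close> and large \<open>s\<close> the
  series diverges.
\<close>

definition is_zeta_function :: "int poly \<Rightarrow> ratfun \<Rightarrow> bool" where
  "is_zeta_function N \<zeta> \<longleftrightarrow> (\<exists>s\<^sub>0::real. \<forall>s>s\<^sub>0.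
     (\<forall>q>1. summable (Z_term N q (q powr (- s)))) \<and>
     ((\<lambda>q. complex_of_real (Z_fun N q (q powr (- s)) * (q - 1) powi poly N 1))
        \<longlongrightarrow> rat_eval \<zeta> (complex_of_real s)) (at_right 1))"

lemma is_zeta_function_unique:
  assumes "is_zeta_function N f" and "is_zeta_function N g"
  shows "f = g"
proof -
  obtain a where
    a: "\<And>s. s > a \<Longrightarrow> ((\<lambda>q. complex_of_real (Z_fun N q (q powr (- s)) * (q - 1) powi poly N 1))
        \<longlongrightarrow> rat_eval f (complex_of_real s)) (at_right 1)"
    using assms(1) unfolding is_zeta_function_def by blast
  obtain b where
    b: "\<And>s. s > b \<Longrightarrow> ((\<lambda>q. complex_of_real (Z_fun N q (q powr (- s)) * (q - 1) powi poly N 1))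
        \<longlongrightarrow> rat_eval g (complex_of_real s)) (at_right 1)"
    using assms(2) unfolding is_zeta_function_def by blast
  obtain pf qf pg qg where
    quot: "quot_of_fract f = (pf, qf)" "quot_of_fract g = (pg, qg)"
    by fastforce
  have nz: "qf \<noteq> 0" "qg \<noteq> 0"
    using snd_quot_of_fract_nonzero[of f] snd_quot_of_fract_nonzero[of g] quot by auto
  have eq: "rat_eval f (complex_of_real s) = rat_eval g (complex_of_real s)" if "s > max a b" for s
    using tendsto_unique[OF _ a b] that by simp
  define Z where "Z = {z. poly (qf * qg * (pf * qg - pg * qf)) z = 0}"
  have "complex_of_real ` {max a b<..} \<subseteq> Z"
  proof (rule image_subsetI)
    fix s assume "s \<in> {max a b<..}"
    then have e: "poly pf (of_real s) / poly qf (of_real s) = poly pg (of_real s) / poly qg (of_real s)"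
      using eq[of s] by (simp add: rat_eval_def quot)
    show "complex_of_real s \<in> Z"
    proof (cases "poly qf (of_real s) = 0 \<or> poly qg (of_real s) = 0")
      case True
      then show ?thesis by (auto simp: Z_def)
    next
      case False
      with e show ?thesis by (simp add: Z_def frac_eq_eq)
    qed
  qed
  moreover have "infinite (complex_of_real ` {max a b<..})"
    by (subst finite_image_iff) (auto simp: inj_on_def infinite_Ioi)
  ultimately have "infinite Z" by (meson finite_subset)
  then have "qf * qg * (pf * qg - pg * qf) = 0"
    unfolding Z_def using poly_roots_finite by blast
  with nz have "pf * qg = pg * qf" by simp
  then have "quot_to_fract (pf, qf) = quot_to_fract (pg, qg)"
    using nz by (simp add: quot_to_fract_def eq_fract)
  then show ?thesis
    using quot by (metis quot_to_fract_quot_of_fract)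
qed

end

(*
  Over F_1[H] the spectrum is one point, and a morphism from it to X is a point x of X together with a
  homomorphism from the units U_x of the stalk at x to H. So X(F_1[H]) is the disjoint union of the
  sets Hom(U_x, H), and everything follows once X is finite and every U_x is free of finite rank
  n(x): then N(y + 1) = sum of y^n(x) over the points x, and the field case is H = K - {0}.

  X is finite because its points correspond to the F_1-points, and a Noetherian monoid has only finitely
  many homomorphisms to {0, 1}. U_x is finitely generated because the identity of U_x is a point
  over F_1[U_x]; it lies in a Noetherian chart, so it is already defined over F_1[H'] for a finitely
  generated subgroup H', and naturality in H forces H' = U_x.

  Finally (1 - 1/s) has the n-th Kurokawa power prod (s - k)^((-1)^(n-k) binom(n,k)), and the zeta
  function is computed termwise from (y - 1)^n = sum (-1)^(n-k) binom(n,k) y^k.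
*)
theory Submission
  imports Defs "HOL-Analysis.Complex_Transcendental"
begin

section \<open>Finitely generated torsion-free abelian groups\<close>

text \<open>The charts \<open>Spec M\<close> of \<open>X\<close> and the Noetherian charts of the
  functor are never compared: functor and space are linked only by the natural bijection on points,
  so finiteness of \<open>X\<close> and of its unit groups has to be read off from values at monoids
  F_1[H]. The geometric charts supply two facts about a stalk: its zero is not a unit, which allows
  a homomorphism on units to be extended by 0, and it injects into pairs of elements of
  \<open>'a\<close>, so that F_1[U_x] has a copy over \<open>'a\<close> at which the functor can be
  evaluated. Noetherian means the chain condition on congruences, so each use of it consists in
  building congruences adapted to the purpose; for the units these are the relations "equal up to a
  factor in K", for a growing chain of subgroups K. Monoids of the form F_1[H] are handled through
  the intrinsic condition \<open>mo_field\<close>. It covers the copies of \<open>F1n n\<close> and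
  the multiplicative monoids of fields alike, and in both counts the argument of N is the number of
  units plus one.\<close>

lemma exists_integer_relation:
  fixes v :: "'c \<Rightarrow> 'i \<Rightarrow> int"
  assumes "finite I" "finite C" "card I < card C"
  shows "\<exists>c. (\<exists>b\<in>C. c b \<noteq> 0) \<and> (\<forall>i\<in>I. (\<Sum>b\<in>C. c b * v b i) = 0)"
  using assms
proof (induction I arbitrary: C v rule: finite_induct)
  case empty
  then obtain b where "b \<in> C" by fastforce
  then show ?case by (intro exI[of _ "\<lambda>_. 1"]) auto
next
  case (insert x I)
  show ?case
  proof (cases "\<exists>p\<in>C. v p x \<noteq> 0")
    case False
    have "card I < card C" using insert by simp
    from insert.IH[OF insert.prems(1) this, of v] show ?thesis using False by auto
  next
    case True
    then obtain p where p: "p \<in> C" "v p x \<noteq> 0" by blast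
    \<comment> \<open>Elimination of the coordinate \<open>x\<close> with pivot \<open>p\<close>,
      cross-multiplied instead of divided so as to stay in the integers. All \<open>w b\<close>
      vanish at \<open>x\<close>.\<close>
    define w where "w b i = v p x * v b i - v b x * v p i" for b i
    have "card I < card (C - {p})" using insert p by simp
    from insert.IH[OF _ this, of w] insert.prems
    obtain d where d: "\<exists>b\<in>C - {p}. d b \<noteq> 0" "\<forall>i\<in>I. (\<Sum>b\<in>C - {p}. d b * w b i) = 0" by auto
    \<comment> \<open>Obtained by substituting the definition of \<open>w\<close> into the relation
      \<open>d\<close>. The factor \<open>v p x\<close> is nonzero, so a nonzero coefficient of
      \<open>d\<close> stays nonzero.\<close>
    define c where "c b = (if b = p then - (\<Sum>b\<in>C - {p}. d b * v b x) else v p x * d b)" for b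
    have sum: "(\<Sum>b\<in>C. c b * v b i) = (\<Sum>b\<in>C - {p}. d b * w b i)" for i
    proof -
      have "(\<Sum>b\<in>C. c b * v b i) = c p * v p i + (\<Sum>b\<in>C - {p}. c b * v b i)"
        using insert.prems p by (simp add: sum.remove)
      also have "\<dots> = (\<Sum>b\<in>C - {p}. d b * w b i)"
        by (simp add: c_def w_def sum_distrib_left sum_subtractf algebra_simps)
      finally show ?thesis .
    qed
    have "\<exists>b\<in>C. c b \<noteq> 0" using d(1) p(2) by (auto simp: c_def)
    moreover have "w b x = 0" for b by (simp add: w_def)
    ultimately show ?thesis
      using d(2) by (intro exI[of _ c]) (auto simp: sum)
  qed
qed

text \<open>An integer linear combination in multiplicative notation. The generators form an indexed
  tuple, not a set, because a change of generators may make two entries coincide.\<close>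

definition (in monoid) tuple_prod :: "'i set \<Rightarrow> ('i \<Rightarrow> 'a) \<Rightarrow> ('i \<Rightarrow> int) \<Rightarrow> 'a" where
  "tuple_prod I a c = finprod G (\<lambda>i. a i [^] c i) I"

context comm_group
begin

lemma tuple_prod_closed [simp]: "a \<in> I \<rightarrow> carrier G \<Longrightarrow> tuple_prod I a c \<in> carrier G"
  unfolding tuple_prod_def by (intro finprod_closed) auto

lemma tuple_prod_cong:
  "a \<in> I \<rightarrow> carrier G \<Longrightarrow> (\<And>i. i \<in> I \<Longrightarrow> a i = b i) \<Longrightarrow> (\<And>i. i \<in> I \<Longrightarrow> c i = d i) \<Longrightarrow>
    tuple_prod I a c = tuple_prod I b d"
  unfolding tuple_prod_def by (intro finprod_cong') (auto simp: Pi_def)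

lemma tuple_prod_add:
  assumes "a \<in> I \<rightarrow> carrier G"
  shows "tuple_prod I a (\<lambda>i. c i + d i) = tuple_prod I a c \<otimes> tuple_prod I a d"
proof -
  have "tuple_prod I a (\<lambda>i. c i + d i) = finprod G (\<lambda>i. a i [^] c i \<otimes> a i [^] d i) I"
    unfolding tuple_prod_def using assms by (intro finprod_cong') (auto simp: int_pow_mult Pi_def)
  also have "\<dots> = tuple_prod I a c \<otimes> tuple_prod I a d"
    unfolding tuple_prod_def using assms by (intro finprod_multf) auto
  finally show ?thesis .
qed

lemma tuple_prod_0: "tuple_prod I a (\<lambda>i. 0) = \<one>"
  unfolding tuple_prod_def by simp

lemma tuple_prod_minus:
  assumes "a \<in> I \<rightarrow> carrier G"
  shows "tuple_prod I a (\<lambda>i. - c i) = inv (tuple_prod I a c)"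
proof -
  have "tuple_prod I a (\<lambda>i. - c i) \<otimes> tuple_prod I a c = \<one>"
    by (simp add: tuple_prod_add[OF assms, symmetric] tuple_prod_0)
  then show ?thesis using assms by (simp add: inv_equality)
qed

lemma tuple_prod_remove:
  assumes "a \<in> I \<rightarrow> carrier G" "finite I" "i \<in> I"
  shows "tuple_prod I a c = a i [^] c i \<otimes> tuple_prod (I - {i}) a c"
proof -
  have "I = insert i (I - {i})" using assms(3) by auto
  then have "tuple_prod I a c = finprod G (\<lambda>i. a i [^] c i) (insert i (I - {i}))"
    unfolding tuple_prod_def by simp
  also have "\<dots> = a i [^] c i \<otimes> tuple_prod (I - {i}) a c"
    unfolding tuple_prod_def using assms by (intro finprod_insert) auto
  finally show ?thesis .
qed

lemma tuple_prod_single: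
  assumes "a \<in> I \<rightarrow> carrier G" "finite I" "i \<in> I"
  shows "tuple_prod I a (\<lambda>j. if j = i then k else 0) = a i [^] k"
proof -
  have ai: "a i \<in> carrier G" and a': "a \<in> I - {i} \<rightarrow> carrier G" using assms by auto
  have "tuple_prod (I - {i}) a (\<lambda>j. if j = i then k else 0) = tuple_prod (I - {i}) a (\<lambda>j. 0)"
    by (rule tuple_prod_cong[OF a']) auto
  then show ?thesis
    using ai by (subst tuple_prod_remove[OF assms]) (simp add: tuple_prod_0)
qed

lemma tuple_prod_mult_const:
  assumes "a \<in> I \<rightarrow> carrier G"
  shows "tuple_prod I a (\<lambda>i. k * c i) = tuple_prod I a c [^] k"
proof (cases "finite I")
  case True
  then show ?thesis using assms
  proof (induction I rule: finite_induct)
    case empty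
    then show ?case by (simp add: tuple_prod_def)
  next
    case (insert x I)
    then have a: "a \<in> I \<rightarrow> carrier G" "a x \<in> carrier G" by auto
    have 1: "tuple_prod (insert x I) a d = a x [^] d x \<otimes> tuple_prod I a d" for d
      using tuple_prod_remove[OF insert.prems, of x d] insert.hyps by simp
    show ?case
      using a insert by (simp add: 1 int_pow_distrib int_pow_pow mult.commute)
  qed
qed (simp add: tuple_prod_def)

lemma tuple_prod_sum:
  assumes "a \<in> I \<rightarrow> carrier G"
  shows "tuple_prod I a (\<lambda>i. \<Sum>b\<in>C. c b * v b i) = finprod G (\<lambda>b. tuple_prod I a (v b) [^] c b) C"
proof (induction C rule: infinite_finite_induct)
  case (insert x C)
  then show ?case
    using assms by (simp add: tuple_prod_add tuple_prod_mult_const Pi_def)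
qed (simp_all add: tuple_prod_0)

text \<open>An elementary change of generators: the power of \<open>a i\<close> gained by the new
  \<open>j\<close>-th entry is taken back from the exponent of \<open>a i\<close>. So the new tuple
  still spans, and relations are carried over.\<close>

lemma tuple_prod_shear:
  assumes a: "a \<in> I \<rightarrow> carrier G" and I: "finite I" "i \<in> I" "j \<in> I" "i \<noteq> j"
  shows "tuple_prod I (a(j := a j \<otimes> a i [^] e)) (d(i := d i - e * d j)) = tuple_prod I a d"
proof -
  define b where "b = a(j := a j \<otimes> a i [^] e)"
  define f where "f = d(i := d i - e * d j)"
  have ai: "a i \<in> carrier G" "a j \<in> carrier G" using a I by auto
  then have b: "b \<in> I \<rightarrow> carrier G" using a by (auto simp: b_def)
  define K where "K = I - {i} - {j}"
  have split: "tuple_prod I x c = x i [^] c i \<otimes> (x j [^] c j \<otimes> tuple_prod K x c)"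
    if "x \<in> I \<rightarrow> carrier G" for x c
    using tuple_prod_remove[of x I i c] tuple_prod_remove[of x "I - {i}" j c] that I
    by (simp add: K_def Pi_def)
  have aK: "a \<in> K \<rightarrow> carrier G" using a by (auto simp: K_def)
  have eq: "tuple_prod K b f = tuple_prod K a d"
    by (rule sym, rule tuple_prod_cong[OF aK]) (auto simp: b_def f_def K_def)
  have "b i [^] f i \<otimes> b j [^] f j = a i [^] (d i - e * d j) \<otimes> (a j [^] d j \<otimes> a i [^] (e * d j))"
    using I ai by (simp add: b_def f_def int_pow_distrib int_pow_pow)
  also have "\<dots> = (a i [^] (d i - e * d j) \<otimes> a i [^] (e * d j)) \<otimes> a j [^] d j"
    using ai by (simp add: m_ac)
  also have "\<dots> = a i [^] d i \<otimes> a j [^] d j"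
    using ai by (simp add: int_pow_mult[symmetric])
  finally have 2: "b i [^] f i \<otimes> b j [^] f j = a i [^] d i \<otimes> a j [^] d j" .
  have bi: "b i \<in> carrier G" "b j \<in> carrier G" using b I by auto
  show ?thesis
    unfolding b_def[symmetric] f_def[symmetric] split[OF b] split[OF a] eq
    using 2 ai bi aK by (simp add: m_assoc[symmetric])
qed

definition spanning :: "'i set \<Rightarrow> ('i \<Rightarrow> 'a) \<Rightarrow> bool" where
  "spanning I a \<longleftrightarrow> a \<in> I \<rightarrow> carrier G \<and> (\<forall>g\<in>carrier G. \<exists>c. g = tuple_prod I a c)"

lemma generate_tuple_prod:
  assumes "a \<in> I \<rightarrow> carrier G" "finite I" "g \<in> generate G (a ` I)"
  shows "\<exists>c. g = tuple_prod I a c"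
  using assms(3)
proof (induction rule: generate.induct)
  case one
  then show ?case using tuple_prod_0 by metis
next
  case (incl h)
  then obtain i where i: "i \<in> I" "h = a i" by blast
  then have "h = tuple_prod I a (\<lambda>j. if j = i then 1 else 0)"
    using assms by (simp add: tuple_prod_single funcset_mem[OF assms(1)])
  then show ?case by blast
next
  case (inv h)
  then obtain i where i: "i \<in> I" "h = a i" by blast
  then have "inv h = tuple_prod I a (\<lambda>j. if j = i then -1 else 0)"
    using assms by (simp add: tuple_prod_single int_pow_neg funcset_mem[OF assms(1)])
  then show ?case by blast
next
  case (eng h1 h2)
  then show ?case using tuple_prod_add[OF assms(1)] by metis
qed

end

lemma torsion_free_int_pow:
  fixes G :: "'g monoid" (structure)
  assumes "group G" "torsion_free G" "u \<in> carrier G" "u [^] (k::int) = \<one>" "k \<noteq> 0"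
  shows "u = \<one>"
proof -
  interpret group G by fact
  have "u [^] nat \<bar>k\<bar> = \<one>"
    using assms(3-5) int_pow_neg[OF assms(3), of k]
    by (cases "k \<ge> 0") (simp_all add: int_pow_int[symmetric] abs_if)
  moreover have "nat \<bar>k\<bar> > 0" using assms(5) by simp
  ultimately show ?thesis
    using assms(2,3) unfolding torsion_free_def by blast
qed

text \<open>
  Choose a spanning tuple of minimal length and, among all its nontrivial relations, one of minimal
  weight; two nonzero exponents would allow a Euclidean step that lowers the weight.
\<close>

lemma torsion_free_imp_basis:
  fixes G :: "'g monoid" (structure) and I0 :: "'i set"
  assumes G: "comm_group G" and tf: "torsion_free G" and sp: "finite I0" "comm_group.spanning G I0 a0"
  obtains I :: "'i set" and a where "finite I" "comm_group.spanning G I a"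
    "\<And>c. monoid.tuple_prod G I a c = \<one> \<Longrightarrow> \<forall>i\<in>I. c i = 0"
proof -
  interpret comm_group G by fact
  define Q where "Q m \<longleftrightarrow> (\<exists>(I::'i set) a. finite I \<and> spanning I a \<and> card I = m)" for m
  define m where "m = (LEAST m. Q m)"
  have "Q (card I0)" using sp unfolding Q_def by blast
  then have Qm: "Q m" unfolding m_def by (rule LeastI)
  have min: "m \<le> card I" if "finite I" "spanning I a" for I :: "'i set" and a
    unfolding m_def using that by (intro Least_le) (auto simp: Q_def)
  obtain I :: "'i set" and a1 where I: "finite I" "spanning I a1" "card I = m"
    using Qm unfolding Q_def by blast
  have rel: "\<forall>i\<in>I. c i = 0" if "spanning I a" "tuple_prod I a c = \<one>" for a c
    using that
  proof (induction "\<Sum>i\<in>I. nat \<bar>c i\<bar>" arbitrary: a c rule: less_induct)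
    case less
    have aG: "a \<in> I \<rightarrow> carrier G" using less.prems by (simp add: spanning_def)
    show ?case
    proof (rule ccontr)
      assume "\<not> ?case"
      then obtain i0 where i0: "i0 \<in> I" "c i0 \<noteq> 0" by blast
      show False
      proof (cases "\<exists>j\<in>I. j \<noteq> i0 \<and> c j \<noteq> 0")
        case True
        then obtain i j where ij: "i \<in> I" "j \<in> I" "i \<noteq> j" "c i \<noteq> 0" "c j \<noteq> 0" "\<bar>c j\<bar> \<le> \<bar>c i\<bar>"
          using i0 by (metis nle_le)
        \<comment> \<open>The sign for which subtracting \<open>e * c j\<close> lowers the absolute
          value of \<open>c i\<close> by that of \<open>c j\<close>, which is positive and not
          larger.\<close>
        define e where "e = sgn (c i) * sgn (c j)"
        define b d where "b = a(j := a j \<otimes> a i [^] e)" and "d = c(i := c i - e * c j)"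
        have "a i \<in> carrier G" "a j \<in> carrier G" using aG ij by auto
        then have bG: "b \<in> I \<rightarrow> carrier G" using aG by (auto simp: b_def)
        have "spanning I b"
          unfolding spanning_def
        proof (intro conjI ballI)
          fix g assume "g \<in> carrier G"
          then obtain f where "g = tuple_prod I a f" using less.prems by (auto simp: spanning_def)
          then show "\<exists>f. g = tuple_prod I b f"
            unfolding b_def using tuple_prod_shear[OF aG I(1) ij(1-3), of e f] by metis
        qed (rule bG)
        moreover have "tuple_prod I b d = \<one>"
          unfolding b_def d_def using tuple_prod_shear[OF aG I(1) ij(1-3), of e c] less.prems by simp
        moreover have "(\<Sum>i\<in>I. nat \<bar>d i\<bar>) < (\<Sum>i\<in>I. nat \<bar>c i\<bar>)"
        proof (rule sum_strict_mono_ex1[OF I(1)])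
          have "nat \<bar>d i\<bar> < nat \<bar>c i\<bar>"
            using ij by (auto simp: d_def e_def sgn_if abs_if split: if_splits)
          then show "\<exists>i\<in>I. nat \<bar>d i\<bar> < nat \<bar>c i\<bar>" "\<forall>k\<in>I. nat \<bar>d k\<bar> \<le> nat \<bar>c k\<bar>"
            using ij(1) by (auto simp: d_def)
        qed
        ultimately have "\<forall>i\<in>I. d i = 0" using less.hyps by blast
        then show False using ij by (auto simp: d_def split: if_splits)
      next
        case False
        have a': "a \<in> I - {i0} \<rightarrow> carrier G" "a i0 \<in> carrier G" using aG i0 by auto
        have "tuple_prod I a c = tuple_prod I a (\<lambda>j. if j = i0 then c i0 else 0)"
          by (rule tuple_prod_cong[OF aG]) (use False in auto)
        then have "a i0 [^] c i0 = \<one>"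
          using less.prems by (simp add: tuple_prod_single[OF aG I(1) i0(1)])
        then have one: "a i0 = \<one>"
          using torsion_free_int_pow[OF is_group tf a'(2)] i0 by blast
        have "spanning (I - {i0}) a"
          unfolding spanning_def
        proof (intro conjI ballI a')
          fix g assume "g \<in> carrier G"
          then obtain f where "g = tuple_prod I a f" using less.prems by (auto simp: spanning_def)
          then have "g = tuple_prod (I - {i0}) a f"
            using tuple_prod_remove[OF aG I(1) i0(1), of f] one a' by simp
          then show "\<exists>f. g = tuple_prod (I - {i0}) a f" by blast
        qed
        then have "m \<le> card (I - {i0})" using min I(1) by blast
        then show False using I i0 by (metis card_Diff1_less not_le)
      qed
    qed
  qed
  from that[OF I(1,2)] rel[OF I(2)] show ?thesis by blast
qed

text \<open>Equal entries of the tuple would satisfy the relation with exponents 1 and -1; hence a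
  basis gives an independent set of \<open>card I\<close> elements. A larger set cannot be
  independent, since its coordinate vectors satisfy an integer relation by
  \<open>exists_integer_relation\<close>.\<close>

lemma ab_rank_basis:
  fixes G :: "'g monoid" (structure)
  assumes G: "comm_group G" and I: "finite I" "comm_group.spanning G I a"
    and ind: "\<And>c. monoid.tuple_prod G I a c = \<one> \<Longrightarrow> \<forall>i\<in>I. c i = 0"
  shows "ab_rank G = card I"
proof -
  interpret comm_group G by fact
  have aG: "a \<in> I \<rightarrow> carrier G" using I by (simp add: spanning_def)
  have inj: "inj_on a I"
  proof (rule inj_onI, rule ccontr)
    fix i j assume ij: "i \<in> I" "j \<in> I" "a i = a j" "i \<noteq> j"
    let ?c = "\<lambda>k. (if k = i then 1 else 0) + (if k = j then -1 else 0) :: int"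
    have "tuple_prod I a ?c = a i [^] (1::int) \<otimes> a j [^] (-1::int)"
      by (simp add: tuple_prod_add[OF aG] tuple_prod_single[OF aG I(1)] ij)
    also have "\<dots> = \<one>" using funcset_mem[OF aG ij(2)] ij(3) by (simp add: int_pow_neg)
    finally have "?c i = 0" using ind ij(1) by blast
    then show False using ij(4) by simp
  qed
  have "ab_independent G (a ` I)"
    unfolding ab_independent_def
  proof (intro conjI allI impI ballI)
    fix c :: "'g \<Rightarrow> int" and b assume c: "finprod G (\<lambda>b. b [^] c b) (a ` I) = \<one>" and b: "b \<in> a ` I"
    have "finprod G (\<lambda>b. b [^] c b) (a ` I) = tuple_prod I a (c \<circ> a)"
      unfolding tuple_prod_def comp_def using aG by (intro finprod_reindex inj) auto
    then show "c b = 0" using ind[of "c \<circ> a"] c b by auto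
  qed (use aG I in auto)
  moreover have "card (a ` I) = card I" by (rule card_image[OF inj])
  moreover have "card C \<le> card I" if C: "ab_independent G C" for C
  proof (rule ccontr)
    assume less: "\<not> ?thesis"
    have C': "C \<subseteq> carrier G" "finite C" using C by (auto simp: ab_independent_def)
    then have "\<forall>b\<in>C. \<exists>c. b = tuple_prod I a c" using I by (auto simp: spanning_def)
    then obtain v where v: "b = tuple_prod I a (v b)" if "b \<in> C" for b by metis
    obtain c where c: "\<exists>b\<in>C. c b \<noteq> 0" "\<forall>i\<in>I. (\<Sum>b\<in>C. c b * v b i) = 0"
      using exists_integer_relation[OF I(1) C'(2), of v] less by auto
    have "finprod G (\<lambda>b. b [^] c b) C = finprod G (\<lambda>b. tuple_prod I a (v b) [^] c b) C"
      using v C' aG by (intro finprod_cong') (auto simp: Pi_def)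
    also have "\<dots> = tuple_prod I a (\<lambda>i. \<Sum>b\<in>C. c b * v b i)"
      by (rule tuple_prod_sum[OF aG, symmetric])
    also have "\<dots> = tuple_prod I a (\<lambda>i. 0)"
      by (rule tuple_prod_cong[OF aG]) (use c in auto)
    finally have "finprod G (\<lambda>b. b [^] c b) C = \<one>" by (simp add: tuple_prod_0)
    then show False using C c(1) unfolding ab_independent_def by blast
  qed
  ultimately show ?thesis
    unfolding ab_rank_def by (intro cSup_eq_maximum) (auto intro!: exI[of _ "a ` I"])
qed

lemma hom_tuple_prod:
  assumes "comm_group G" "comm_group H" "h \<in> hom G H" "a \<in> I \<rightarrow> carrier G"
  shows "h (monoid.tuple_prod G I a c) = monoid.tuple_prod H I (\<lambda>i. h (a i)) c"
proof -
  interpret G: comm_group G by fact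
  interpret H: comm_group H by fact
  interpret group_hom G H h using assms(3) by unfold_locales
  show ?thesis
    using assms(4)
  proof (induction I rule: infinite_finite_induct)
    case (insert x I)
    then show ?case
      by (simp add: G.tuple_prod_def H.tuple_prod_def hom_int_pow Pi_def)
  qed (simp_all add: G.tuple_prod_def H.tuple_prod_def)
qed

text \<open>The universal property of a free abelian group: values on a basis can be prescribed
  freely and determine the homomorphism.\<close>

lemma bij_betw_hom_basis:
  fixes G :: "'g monoid" and H :: "'h monoid"
  assumes GH: "comm_group G" "comm_group H" and I: "finite I" "comm_group.spanning G I a"
    and ind: "\<And>c. monoid.tuple_prod G I a c = \<one>\<^bsub>G\<^esub> \<Longrightarrow> \<forall>i\<in>I. c i = 0"
  shows "bij_betw (\<lambda>h. restrict (\<lambda>i. h (a i)) I) (hom G H \<inter> extensional (carrier G))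
    (I \<rightarrow>\<^sub>E carrier H)"
proof -
  interpret G: comm_group G by fact
  interpret H: comm_group H by fact
  have aG: "a \<in> I \<rightarrow> carrier G" using I by (simp add: G.spanning_def)
  \<comment> \<open>The chosen exponents are determined only on \<open>I\<close>; outside it they
    are arbitrary. Comparisons therefore go through \<open>uniq\<close> and
    \<open>tuple_prod_cong\<close>.\<close>
  define co where "co g = (SOME c. g = G.tuple_prod I a c)" for g
  have co: "g = G.tuple_prod I a (co g)" if "g \<in> carrier G" for g
    using I that unfolding co_def G.spanning_def by (metis (mono_tags, lifting) someI)
  have uniq: "\<forall>i\<in>I. c i = d i" if "G.tuple_prod I a c = G.tuple_prod I a d" for c d
  proof -
    have "G.tuple_prod I a (\<lambda>i. c i + - d i) = \<one>\<^bsub>G\<^esub>"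
      using aG that by (simp only: G.tuple_prod_add[OF aG] G.tuple_prod_minus[OF aG]) simp
    from ind[OF this] show ?thesis by auto
  qed
  show ?thesis
    unfolding bij_betw_def
  proof (intro conjI inj_onI subset_antisym subsetI)
    fix h k assume h: "h \<in> hom G H \<inter> extensional (carrier G)" and k: "k \<in> hom G H \<inter> extensional (carrier G)"
      and eq: "restrict (\<lambda>i. h (a i)) I = restrict (\<lambda>i. k (a i)) I"
    show "h = k"
    proof (rule extensionalityI)
      fix g assume g: "g \<in> carrier G"
      have hG: "(\<lambda>i. h (a i)) \<in> I \<rightarrow> carrier H" using h aG by (auto simp: hom_def)
      have hk: "h (a i) = k (a i)" if "i \<in> I" for i
        using fun_cong[OF eq, of i] that by simp
      have "h g = H.tuple_prod I (\<lambda>i. h (a i)) (co g)"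
        using hom_tuple_prod[OF GH _ aG, of h "co g"] h co[OF g] by simp
      also have "\<dots> = H.tuple_prod I (\<lambda>i. k (a i)) (co g)"
        by (rule H.tuple_prod_cong[OF hG]) (simp_all add: hk)
      also have "\<dots> = k g"
        using hom_tuple_prod[OF GH _ aG, of k "co g"] k co[OF g] by simp
      finally show "h g = k g" .
    qed (use h k in auto)
  next
    fix t assume "t \<in> (\<lambda>h. restrict (\<lambda>i. h (a i)) I) ` (hom G H \<inter> extensional (carrier G))"
    then show "t \<in> I \<rightarrow>\<^sub>E carrier H" using aG by (auto simp: hom_def)
  next
    fix t assume t: "t \<in> I \<rightarrow>\<^sub>E carrier H"
    then have tH: "t \<in> I \<rightarrow> carrier H" by auto
    define h where "h = restrict (\<lambda>g. H.tuple_prod I t (co g)) (carrier G)"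
    have "h \<in> hom G H"
    proof (rule homI)
      fix x y assume xy: "x \<in> carrier G" "y \<in> carrier G"
      have "G.tuple_prod I a (co (x \<otimes>\<^bsub>G\<^esub> y)) = G.tuple_prod I a (\<lambda>i. co x i + co y i)"
        using co xy by (metis G.m_closed G.tuple_prod_add[OF aG])
      then have "H.tuple_prod I t (co (x \<otimes>\<^bsub>G\<^esub> y)) = H.tuple_prod I t (\<lambda>i. co x i + co y i)"
        by (intro H.tuple_prod_cong[OF tH]) (auto dest: uniq)
      then show "h (x \<otimes>\<^bsub>G\<^esub> y) = h x \<otimes>\<^bsub>H\<^esub> h y"
        using xy by (simp add: h_def H.tuple_prod_add[OF tH])
    qed (use tH in \<open>auto simp: h_def\<close>)
    moreover have "restrict (\<lambda>i. h (a i)) I = t"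
    proof (rule extensionalityI[of _ I])
      fix i assume i: "i \<in> I"
      then have ai: "a i \<in> carrier G" using aG by auto
      have "G.tuple_prod I a (co (a i)) = G.tuple_prod I a (\<lambda>j. if j = i then 1 else 0)"
        using co[OF ai] ai by (simp add: G.tuple_prod_single[OF aG I(1) i])
      then have "H.tuple_prod I t (co (a i)) = H.tuple_prod I t (\<lambda>j. if j = i then 1 else 0)"
        by (intro H.tuple_prod_cong[OF tH]) (auto dest: uniq)
      also have "\<dots> = t i" by (simp add: H.tuple_prod_single[OF tH I(1) i] funcset_mem[OF tH i])
      finally show "restrict (\<lambda>i. h (a i)) I i = t i" using i ai by (simp add: h_def)
    qed (use t in \<open>auto simp: PiE_def\<close>)
    ultimately show "t \<in> (\<lambda>h. restrict (\<lambda>i. h (a i)) I) ` (hom G H \<inter> extensional (carrier G))"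
      by (intro image_eqI[of _ _ h]) (auto simp: h_def)
  qed
qed

theorem card_hom_torsion_free:
  fixes G :: "'g monoid" and H :: "'h monoid"
  assumes GH: "comm_group G" "comm_group H" and tf: "torsion_free G"
    and B: "finite B" "B \<subseteq> carrier G" "generate G B = carrier G" and fin: "finite (carrier H)"
  shows "finite (hom G H \<inter> extensional (carrier G))"
    and "card (hom G H \<inter> extensional (carrier G)) = card (carrier H) ^ ab_rank G"
proof -
  interpret G: comm_group G by fact
  have sp: "G.spanning B (\<lambda>b. b)"
    unfolding G.spanning_def using G.generate_tuple_prod[of "\<lambda>b. b" B] B by auto
  obtain I :: "'g set" and a where I: "finite I" "G.spanning I a"
    and ind: "\<And>c. G.tuple_prod I a c = \<one>\<^bsub>G\<^esub> \<Longrightarrow> \<forall>i\<in>I. c i = 0"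
    by (rule torsion_free_imp_basis[OF GH(1) tf B(1) sp]) blast
  note bij = bij_betw_hom_basis[OF GH I ind]
  have "finite (I \<rightarrow>\<^sub>E carrier H)" using I fin by (simp add: finite_PiE)
  then show "finite (hom G H \<inter> extensional (carrier G))"
    using bij_betw_finite[OF bij] by simp
  show "card (hom G H \<inter> extensional (carrier G)) = card (carrier H) ^ ab_rank G"
    using bij_betw_same_card[OF bij] I
    by (simp add: ab_rank_basis[OF GH(1) I ind] card_funcsetE)
qed

section \<open>Noetherian monoids\<close>

lemma noetherian_mo_maximal:
  assumes M: "noetherian_mo M" and R0: "mo_congruence M R0" "P R0"
  obtains R where "mo_congruence M R" "P R" "\<And>R'. mo_congruence M R' \<Longrightarrow> R \<subset> R' \<Longrightarrow> \<not> P R'"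
proof -
  have "wf {(R', R). mo_congruence M R \<and> mo_congruence M R' \<and> R \<subset> R'}"
    unfolding wf_iff_no_infinite_down_chain
  proof
    assume "\<exists>f. \<forall>i. (f (Suc i), f i) \<in> {(R', R). mo_congruence M R \<and> mo_congruence M R' \<and> R \<subset> R'}"
    then obtain f where "\<forall>i. (f (Suc i), f i) \<in> {(R', R). mo_congruence M R \<and> mo_congruence M R' \<and> R \<subset> R'}" ..
    then have f: "(f (Suc i), f i) \<in> {(R', R). mo_congruence M R \<and> mo_congruence M R' \<and> R \<subset> R'}" for i ..
    have "mo_congruence M (f i)" "f i \<subset> f (Suc i)" for i using f[of i] by simp_all
    then have "(\<forall>i. mo_congruence M (f i)) \<and> (\<forall>i. f i \<subset> f (Suc i))" by simp
    then show False using M unfolding noetherian_mo_def by metis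
  qed
  moreover have "R0 \<in> {R. mo_congruence M R \<and> P R}" using R0 by simp
  ultimately show ?thesis
  proof (rule wfE_min)
    fix R assume R: "R \<in> {R. mo_congruence M R \<and> P R}"
      and min: "\<And>R'. (R', R) \<in> {(R', R). mo_congruence M R \<and> mo_congruence M R' \<and> R \<subset> R'} \<Longrightarrow>
        R' \<notin> {R. mo_congruence M R \<and> P R}"
    show ?thesis
    proof (rule that[of R])
      fix R' assume "mo_congruence M R'" "R \<subset> R'"
      then show "\<not> P R'" using R min[of R'] by simp
    qed (use R in simp_all)
  qed
qed

lemma mo_congruenceI:
  assumes "R \<subseteq> carrier M \<times> carrier M"
    and "\<And>x. x \<in> carrier M \<Longrightarrow> (x, x) \<in> R"
    and "\<And>x y. (x, y) \<in> R \<Longrightarrow> (y, x) \<in> R"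
    and "\<And>x y z. (x, y) \<in> R \<Longrightarrow> (y, z) \<in> R \<Longrightarrow> (x, z) \<in> R"
    and "\<And>a b c d. (a, b) \<in> R \<Longrightarrow> (c, d) \<in> R \<Longrightarrow> (a \<otimes>\<^bsub>M\<^esub> c, b \<otimes>\<^bsub>M\<^esub> d) \<in> R"
  shows "mo_congruence M R"
  unfolding mo_congruence_def equiv_def refl_on_def sym_def trans_def
  using assms by blast

lemma mo_congruenceD:
  assumes "mo_congruence M R"
  shows "(x, y) \<in> R \<Longrightarrow> x \<in> carrier M \<and> y \<in> carrier M"
    and "x \<in> carrier M \<Longrightarrow> (x, x) \<in> R"
    and "(x, y) \<in> R \<Longrightarrow> (y, x) \<in> R"
    and "(x, y) \<in> R \<Longrightarrow> (y, z) \<in> R \<Longrightarrow> (x, z) \<in> R"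
    and "(a, b) \<in> R \<Longrightarrow> (c, d) \<in> R \<Longrightarrow> (a \<otimes>\<^bsub>M\<^esub> c, b \<otimes>\<^bsub>M\<^esub> d) \<in> R"
proof -
  have R: "R \<subseteq> carrier M \<times> carrier M" "refl_on (carrier M) R" "sym R" "trans R"
    using assms by (auto simp: mo_congruence_def elim: equivE dest: equiv_type)
  show "(x, y) \<in> R \<Longrightarrow> x \<in> carrier M \<and> y \<in> carrier M" using R(1) by blast
  show "x \<in> carrier M \<Longrightarrow> (x, x) \<in> R" using R(2) by (rule refl_onD)
  show "(x, y) \<in> R \<Longrightarrow> (y, x) \<in> R" using R(3) by (rule symD)
  show "(x, y) \<in> R \<Longrightarrow> (y, z) \<in> R \<Longrightarrow> (x, z) \<in> R" using R(4) by (rule transD)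
  show "(a, b) \<in> R \<Longrightarrow> (c, d) \<in> R \<Longrightarrow> (a \<otimes>\<^bsub>M\<^esub> c, b \<otimes>\<^bsub>M\<^esub> d) \<in> R"
    using assms unfolding mo_congruence_def by blast
qed

text \<open>
  Noetherian induction on congruences: homomorphisms with value \<open>0\<close> at \<open>a\<close> respect the congruence
  that collapses the ideal \<open>aM\<close>, those with value \<open>1\<close> the one that identifies \<open>a\<close> with \<open>1\<close>.
\<close>

lemma finite_mo_hom_two_elements:
  assumes M: "noetherian_mo M" and N: "is_mo N" "carrier N = {\<one>\<^bsub>N\<^esub>, azero N}"
  shows "finite (mo_hom M N)"
proof (rule ccontr)
  assume inf: "infinite (mo_hom M N)"
  have mo: "is_mo M" using M by (simp add: noetherian_mo_def)
  interpret M: comm_monoid M using mo by (simp add: is_mo_def)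
  interpret N: comm_monoid N using N by (simp add: is_mo_def)
  have zM: "azero M \<in> carrier M" "\<And>x. x \<in> carrier M \<Longrightarrow> azero M \<otimes>\<^bsub>M\<^esub> x = azero M"
    using mo by (auto simp: is_mo_def)
  have zN: "azero N \<in> carrier N" "\<And>x. x \<in> carrier N \<Longrightarrow> azero N \<otimes>\<^bsub>N\<^esub> x = azero N"
    using N by (auto simp: is_mo_def)
  define S where "S R = {f \<in> mo_hom M N. \<forall>(a, b)\<in>R. f a = f b}" for R
  have "S (Id_on (carrier M)) = mo_hom M N" by (auto simp: S_def)
  moreover have "mo_congruence M (Id_on (carrier M))"
    by (rule mo_congruenceI) auto
  ultimately obtain R where R: "mo_congruence M R" "infinite (S R)"
    and max: "\<And>R'. mo_congruence M R' \<Longrightarrow> R \<subset> R' \<Longrightarrow> finite (S R')"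
    using noetherian_mo_maximal[OF M, of _ "\<lambda>R. infinite (S R)"] inf by metis
  note Rc = mo_congruenceD(1)[OF R(1)] and Rr = mo_congruenceD(2)[OF R(1)]
    and Rs = mo_congruenceD(3)[OF R(1)] and Rt = mo_congruenceD(4)[OF R(1)]
    and Rm = mo_congruenceD(5)[OF R(1)]
  \<comment> \<open>If \<open>a\<close> were congruent neither to 0 nor to 1, then \<open>R1\<close>
    and \<open>R2\<close> would be strictly larger than \<open>R\<close>, hence would admit finitely
    many homomorphisms each. Every homomorphism in \<open>S R\<close> has value 0 or 1 at
    \<open>a\<close> and so respects one of them.\<close>
  have key: "(a, azero M) \<in> R \<or> (a, \<one>\<^bsub>M\<^esub>) \<in> R" if a: "a \<in> carrier M" for a
  proof (rule ccontr)
    assume neg: "\<not> ?thesis"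
    \<comment> \<open>Membership in the ideal generated by \<open>a\<close> in the quotient by
      \<open>R\<close>.\<close>
    define in_aM where "in_aM x \<longleftrightarrow> (\<exists>u\<in>carrier M. (x, a \<otimes>\<^bsub>M\<^esub> u) \<in> R)" for x
    define R1 where "R1 = R \<union> {(x, y). in_aM x \<and> in_aM y}"
    \<comment> \<open>Independent exponents on the two sides identify \<open>a\<close> with 1
      (exponents 0 and 1), and they make transitivity work after multiplication by further powers of
      \<open>a\<close>.\<close>
    define R2 where "R2 = {(x, y) \<in> carrier M \<times> carrier M.
      \<exists>(i::nat) (j::nat). (a [^]\<^bsub>M\<^esub> i \<otimes>\<^bsub>M\<^esub> x, a [^]\<^bsub>M\<^esub> j \<otimes>\<^bsub>M\<^esub> y) \<in> R}"
    have in_R: "in_aM y" if "(x, y) \<in> R" "in_aM x" for x y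
      using that Rs Rt unfolding in_aM_def by blast
    have in_mult: "in_aM (x \<otimes>\<^bsub>M\<^esub> z)" if x: "in_aM x" and z: "z \<in> carrier M" for x z
    proof -
      obtain u where u: "u \<in> carrier M" "(x, a \<otimes>\<^bsub>M\<^esub> u) \<in> R" using x by (auto simp: in_aM_def)
      have "(x \<otimes>\<^bsub>M\<^esub> z, a \<otimes>\<^bsub>M\<^esub> (u \<otimes>\<^bsub>M\<^esub> z)) \<in> R"
        using Rm[OF u(2) Rr[OF z]] a u z by (simp add: M.m_assoc)
      then show ?thesis unfolding in_aM_def using u z by blast
    qed
    have in_c: "x \<in> carrier M" if "in_aM x" for x using that Rc by (auto simp: in_aM_def)
    have R1: "mo_congruence M R1"
    proof (rule mo_congruenceI)
      show "R1 \<subseteq> carrier M \<times> carrier M" using Rc in_c by (auto simp: R1_def)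
    next
      fix x y z assume "(x, y) \<in> R1" "(y, z) \<in> R1"
      then show "(x, z) \<in> R1" using Rt Rs in_R unfolding R1_def by blast
    next
      fix x y z w assume "(x, y) \<in> R1" "(z, w) \<in> R1"
      then consider "(x, y) \<in> R" "(z, w) \<in> R" | "in_aM x" "in_aM y" "z \<in> carrier M" "w \<in> carrier M"
        | "in_aM z" "in_aM w" "x \<in> carrier M" "y \<in> carrier M"
        unfolding R1_def using Rc in_c by blast
      then show "(x \<otimes>\<^bsub>M\<^esub> z, y \<otimes>\<^bsub>M\<^esub> w) \<in> R1"
      proof cases
        case 1
        then show ?thesis using Rm by (simp add: R1_def)
      next
        case 2
        then show ?thesis using in_mult by (simp add: R1_def)
      next
        case 3
        then have "in_aM (z \<otimes>\<^bsub>M\<^esub> x)" "in_aM (w \<otimes>\<^bsub>M\<^esub> y)" using in_mult by simp_all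
        then show ?thesis using 3 in_c by (simp add: R1_def M.m_comm)
      qed
    qed (use Rr Rs in \<open>auto simp: R1_def\<close>)
    have pw: "a [^]\<^bsub>M\<^esub> (i::nat) \<in> carrier M" for i using a by simp
    have sw: "a [^]\<^bsub>M\<^esub> (i + k::nat) \<otimes>\<^bsub>M\<^esub> (x \<otimes>\<^bsub>M\<^esub> z) =
        (a [^]\<^bsub>M\<^esub> i \<otimes>\<^bsub>M\<^esub> x) \<otimes>\<^bsub>M\<^esub> (a [^]\<^bsub>M\<^esub> k \<otimes>\<^bsub>M\<^esub> z)"
      if "x \<in> carrier M" "z \<in> carrier M" for i k x z
      using a that by (simp add: M.nat_pow_mult[symmetric] M.m_ac)
    have R2I: "(x, y) \<in> R2"
      if "x \<in> carrier M" "y \<in> carrier M" "(a [^]\<^bsub>M\<^esub> i \<otimes>\<^bsub>M\<^esub> x, a [^]\<^bsub>M\<^esub> j \<otimes>\<^bsub>M\<^esub> y) \<in> R"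
      for x y and i j :: nat
      using that by (auto simp: R2_def)
    have R2: "mo_congruence M R2"
    proof (rule mo_congruenceI)
      fix x assume x: "x \<in> carrier M"
      then show "(x, x) \<in> R2" using R2I[OF x x Rr[OF M.m_closed[OF pw[of 0] x]]] by blast
    next
      fix x y assume "(x, y) \<in> R2"
      then show "(y, x) \<in> R2" unfolding R2_def using Rs by blast
    next
      fix x y z assume xy: "(x, y) \<in> R2" and yz: "(y, z) \<in> R2"
      then obtain i j k l :: nat where
        1: "(a [^]\<^bsub>M\<^esub> i \<otimes>\<^bsub>M\<^esub> x, a [^]\<^bsub>M\<^esub> j \<otimes>\<^bsub>M\<^esub> y) \<in> R" and
        2: "(a [^]\<^bsub>M\<^esub> k \<otimes>\<^bsub>M\<^esub> y, a [^]\<^bsub>M\<^esub> l \<otimes>\<^bsub>M\<^esub> z) \<in> R"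
        and c: "x \<in> carrier M" "y \<in> carrier M" "z \<in> carrier M"
        unfolding R2_def by blast
      have sh: "a [^]\<^bsub>M\<^esub> p \<otimes>\<^bsub>M\<^esub> (a [^]\<^bsub>M\<^esub> q \<otimes>\<^bsub>M\<^esub> v) = a [^]\<^bsub>M\<^esub> (p + q) \<otimes>\<^bsub>M\<^esub> v"
        if "v \<in> carrier M" for p q :: nat and v
        using a that by (simp add: M.nat_pow_mult[symmetric] M.m_assoc)
      have "(a [^]\<^bsub>M\<^esub> (k + i) \<otimes>\<^bsub>M\<^esub> x, a [^]\<^bsub>M\<^esub> (k + j) \<otimes>\<^bsub>M\<^esub> y) \<in> R"
        using Rm[OF Rr[OF pw[of k]] 1] c by (simp add: sh)
      moreover have "(a [^]\<^bsub>M\<^esub> (j + k) \<otimes>\<^bsub>M\<^esub> y, a [^]\<^bsub>M\<^esub> (j + l) \<otimes>\<^bsub>M\<^esub> z) \<in> R"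
        using Rm[OF Rr[OF pw[of j]] 2] c by (simp add: sh)
      ultimately have "(a [^]\<^bsub>M\<^esub> (k + i) \<otimes>\<^bsub>M\<^esub> x, a [^]\<^bsub>M\<^esub> (j + l) \<otimes>\<^bsub>M\<^esub> z) \<in> R"
        using Rt[of _ "a [^]\<^bsub>M\<^esub> (k + j) \<otimes>\<^bsub>M\<^esub> y"] by (simp add: add.commute[of j k])
      then show "(x, z) \<in> R2" using R2I c by metis
    next
      fix x y z w assume "(x, y) \<in> R2" "(z, w) \<in> R2"
      then obtain i j k l :: nat where
        1: "(a [^]\<^bsub>M\<^esub> i \<otimes>\<^bsub>M\<^esub> x, a [^]\<^bsub>M\<^esub> j \<otimes>\<^bsub>M\<^esub> y) \<in> R" and
        2: "(a [^]\<^bsub>M\<^esub> k \<otimes>\<^bsub>M\<^esub> z, a [^]\<^bsub>M\<^esub> l \<otimes>\<^bsub>M\<^esub> w) \<in> R"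
        and c: "x \<in> carrier M" "y \<in> carrier M" "z \<in> carrier M" "w \<in> carrier M"
        unfolding R2_def by blast
      have "(a [^]\<^bsub>M\<^esub> (i + k) \<otimes>\<^bsub>M\<^esub> (x \<otimes>\<^bsub>M\<^esub> z), a [^]\<^bsub>M\<^esub> (j + l) \<otimes>\<^bsub>M\<^esub> (y \<otimes>\<^bsub>M\<^esub> w)) \<in> R"
        using Rm[OF 1 2] c by (simp add: sw)
      then show "(x \<otimes>\<^bsub>M\<^esub> z, y \<otimes>\<^bsub>M\<^esub> w) \<in> R2" using R2I c by (metis M.m_closed)
    qed (auto simp: R2_def)
    have "in_aM a"
      unfolding in_aM_def using a Rr[OF a] by (intro bexI[of _ "\<one>\<^bsub>M\<^esub>"]) auto
    moreover have "in_aM (azero M)"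
      unfolding in_aM_def using a zM Rr[OF zM(1)]
      by (intro bexI[of _ "azero M"]) (auto simp: M.m_comm[of a "azero M"])
    ultimately have "(a, azero M) \<in> R1" by (simp add: R1_def)
    moreover have "R \<subseteq> R1" by (auto simp: R1_def)
    ultimately have "R \<subset> R1" using neg by blast
    then have fin1: "finite (S R1)" using max R1 by blast
    have "R \<subseteq> R2"
    proof (rule subsetI, clarify)
      fix x y assume xy: "(x, y) \<in> R"
      then have "(a [^]\<^bsub>M\<^esub> (0::nat) \<otimes>\<^bsub>M\<^esub> x, a [^]\<^bsub>M\<^esub> (0::nat) \<otimes>\<^bsub>M\<^esub> y) \<in> R" using Rc[OF xy] by simp
      then show "(x, y) \<in> R2" unfolding R2_def using Rc[OF xy] by blast
    qed
    moreover have "(a, \<one>\<^bsub>M\<^esub>) \<in> R2"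
    proof -
      have "(a [^]\<^bsub>M\<^esub> (0::nat) \<otimes>\<^bsub>M\<^esub> a, a [^]\<^bsub>M\<^esub> (1::nat) \<otimes>\<^bsub>M\<^esub> \<one>\<^bsub>M\<^esub>) \<in> R" using a Rr by simp
      then show ?thesis unfolding R2_def using a by blast
    qed
    ultimately have "R \<subset> R2" using neg by blast
    then have fin2: "finite (S R2)" using max R2 by blast
    have "S R \<subseteq> S R1 \<union> S R2"
    proof
      fix f assume f: "f \<in> S R"
      then have fh: "f \<in> mo_hom M N" and fR: "\<And>x y. (x, y) \<in> R \<Longrightarrow> f x = f y" by (auto simp: S_def)
      have mult: "f (x \<otimes>\<^bsub>M\<^esub> y) = f x \<otimes>\<^bsub>N\<^esub> f y" "f x \<in> carrier N"
        if "x \<in> carrier M" "y \<in> carrier M" for x y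
        using fh that by (auto simp: mo_hom_def hom_def)
      have "f a = \<one>\<^bsub>N\<^esub> \<or> f a = azero N" using mult(2)[OF a a] N by auto
      then show "f \<in> S R1 \<union> S R2"
      proof
        assume zero: "f a = azero N"
        have "f x = azero N" if x: "in_aM x" for x
        proof -
          obtain u where u: "u \<in> carrier M" "(x, a \<otimes>\<^bsub>M\<^esub> u) \<in> R"
            using x unfolding in_aM_def by blast
          have "f x = f a \<otimes>\<^bsub>N\<^esub> f u" using fR[OF u(2)] mult(1)[OF a u(1)] by simp
          then show ?thesis using zero zN(2)[OF mult(2)[OF u(1) u(1)]] by simp
        qed
        then show ?thesis using fh fR by (auto simp: S_def R1_def)
      next
        assume one: "f a = \<one>\<^bsub>N\<^esub>"
        have pow: "f (a [^]\<^bsub>M\<^esub> (i::nat)) = \<one>\<^bsub>N\<^esub>" for i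
        proof (induction i)
          case 0
          show ?case using fh by (simp add: mo_hom_def)
        next
          case (Suc i)
          then show ?case using a one mult(1)[OF pw[of i] a] by simp
        qed
        have "f x = f y" if "(x, y) \<in> R2" for x y
        proof -
          obtain i j :: nat where ij: "(a [^]\<^bsub>M\<^esub> i \<otimes>\<^bsub>M\<^esub> x, a [^]\<^bsub>M\<^esub> j \<otimes>\<^bsub>M\<^esub> y) \<in> R"
            and c: "x \<in> carrier M" "y \<in> carrier M"
            using \<open>(x, y) \<in> R2\<close> unfolding R2_def by blast
          have "f (a [^]\<^bsub>M\<^esub> n \<otimes>\<^bsub>M\<^esub> z) = f z" if "z \<in> carrier M" for n :: nat and z
            using mult[OF pw[of n] that] mult(2)[OF that that] pow that by simp
          then show ?thesis using fR[OF ij] c by metis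
        qed
        then show ?thesis using fh by (auto simp: S_def)
      qed
    qed
    then show False using fin1 fin2 R(2) by (meson finite_Un finite_subset)
  qed
  \<comment> \<open>By \<open>key\<close> the quotient by \<open>R\<close> has no classes besides
    those of 0 and 1, on which all homomorphisms agree. So the infinite set \<open>S R\<close> has
    at most one element.\<close>
  have eq: "f = g" if f: "f \<in> S R" and g: "g \<in> S R" for f g
  proof (rule extensionalityI[of _ "carrier M"])
    fix a assume "a \<in> carrier M"
    from key[OF this] show "f a = g a"
      using f g unfolding S_def mo_hom_def by fastforce
  qed (use f g in \<open>auto simp: S_def mo_hom_def\<close>)
  obtain f where "f \<in> S R" using infinite_imp_nonempty[OF R(2)] by blast
  then have "S R \<subseteq> {f}" using eq by auto
  then show False using R(2) finite_subset by auto
qed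

text \<open>If the units were not finitely generated, they would contain a strictly increasing chain
  of subgroups K. The relations "\<open>\<psi> x\<close> equals \<open>\<psi> y\<close> up to a
  factor in K" are congruences on \<open>M\<close>, and \<open>gen\<close>, which writes each unit
  as a quotient of values of \<open>\<psi>\<close>, makes them strictly increasing too.\<close>

lemma noetherian_mo_finitely_generated_units:
  assumes M: "noetherian_mo M" and N: "is_mo N" and \<psi>: "\<psi> \<in> mo_hom M N"
    and gen: "\<And>u. u \<in> Units N \<Longrightarrow> \<exists>a\<in>carrier M. \<exists>b\<in>carrier M. \<psi> b \<in> Units N \<and> \<psi> a = u \<otimes>\<^bsub>N\<^esub> \<psi> b"
  shows "\<exists>B. finite B \<and> B \<subseteq> Units N \<and> generate (units_of N) B = Units N"
proof (rule ccontr)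
  assume neg: "\<not> ?thesis"
  interpret N: comm_monoid N using N by (simp add: is_mo_def)
  interpret U: comm_group "units_of N" by (rule N.units_comm_group)
  let ?gen = "generate (units_of N)"
  have \<psi>c: "\<psi> x \<in> carrier N" if "x \<in> carrier M" for x
    using \<psi> that by (auto simp: mo_hom_def hom_def)
  have \<psi>m: "\<psi> (x \<otimes>\<^bsub>M\<^esub> y) = \<psi> x \<otimes>\<^bsub>N\<^esub> \<psi> y" if "x \<in> carrier M" "y \<in> carrier M" for x y
    using \<psi> that by (auto simp: mo_hom_def hom_def)
  note \<psi>h = \<psi>c \<psi>m
  have mM: "x \<otimes>\<^bsub>M\<^esub> y \<in> carrier M" if "x \<in> carrier M" "y \<in> carrier M" for x y
    using M that comm_monoid.axioms(1) monoid.m_closed unfolding noetherian_mo_def is_mo_def by metis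
  have sub: "subgroup (?gen B) (units_of N)" if "B \<subseteq> Units N" for B
    using U.generate_is_subgroup[of B] that by (simp add: units_of_carrier)
  have step: "\<exists>C. (finite C \<and> C \<subseteq> Units N) \<and> ?gen B \<subset> ?gen C" if B: "finite B \<and> B \<subseteq> Units N" for B
  proof -
    have "?gen B \<subseteq> Units N" using sub[of B] B subgroup.subset by (fastforce simp: units_of_carrier)
    then obtain u where u: "u \<in> Units N" "u \<notin> ?gen B" using neg B by blast
    have "?gen B \<subseteq> ?gen (insert u B)" by (rule U.mono_generate) auto
    moreover have "u \<in> ?gen (insert u B)" by (rule generate.incl) auto
    ultimately show ?thesis using B u by (intro exI[of _ "insert u B"]) auto
  qed
  have "\<exists>C :: nat \<Rightarrow> _. \<forall>n. (finite (C n) \<and> C n \<subseteq> Units N) \<and> ?gen (C n) \<subset> ?gen (C (Suc n))"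
    by (rule dependent_nat_choice) (use step in auto)
  then obtain C :: "nat \<Rightarrow> _"
    where "\<forall>n. (finite (C n) \<and> C n \<subseteq> Units N) \<and> ?gen (C n) \<subset> ?gen (C (Suc n))" ..
  then have C: "C n \<subseteq> Units N" "?gen (C n) \<subset> ?gen (C (Suc n))" for n by simp_all
  define K where "K n = ?gen (C n)" for n
  have KU: "k \<in> Units N" if "k \<in> K n" for k n
    using subgroup.subset[OF sub[OF C(1)]] that by (auto simp: K_def units_of_carrier)
  have KUc: "k \<in> carrier N" if "k \<in> K n" for k n
    using KU[OF that] by (rule N.Units_closed)
  have K1: "\<one>\<^bsub>N\<^esub> \<in> K n" for n
    using subgroup.one_closed[OF sub[OF C(1)]] by (simp add: K_def units_of_one)
  have Km: "k \<otimes>\<^bsub>N\<^esub> l \<in> K n" if "k \<in> K n" "l \<in> K n" for k l n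
    using subgroup.m_closed[OF sub[OF C(1)]] that by (simp add: K_def units_of_mult)
  have Ki: "inv\<^bsub>N\<^esub> k \<in> K n" if "k \<in> K n" for k n
    using subgroup.m_inv_closed[OF sub[OF C(1)], of k n] that KU[OF that]
    by (simp add: K_def N.units_of_inv)
  \<comment> \<open>The congruence of equality in \<open>N\<close> modulo multiplication by
    \<open>K n\<close>, pulled back to \<open>M\<close> along \<open>\<psi>\<close>.\<close>
  define R where "R n = {(x, y) \<in> carrier M \<times> carrier M. \<exists>k\<in>K n. \<psi> x = k \<otimes>\<^bsub>N\<^esub> \<psi> y}" for n
  have RI: "(x, y) \<in> R n"
    if "x \<in> carrier M" "y \<in> carrier M" "k \<in> K n" "\<psi> x = k \<otimes>\<^bsub>N\<^esub> \<psi> y" for x y k n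
    using that by (auto simp: R_def)
  have "mo_congruence M (R n)" for n
  proof (rule mo_congruenceI)
    fix x assume x: "x \<in> carrier M"
    show "(x, x) \<in> R n" by (rule RI[OF x x K1]) (use \<psi>h x in simp)
  next
    fix x y assume "(x, y) \<in> R n"
    then obtain k where k: "k \<in> K n" "\<psi> x = k \<otimes>\<^bsub>N\<^esub> \<psi> y" and c: "x \<in> carrier M" "y \<in> carrier M"
      unfolding R_def by blast
    have "\<psi> y = inv\<^bsub>N\<^esub> k \<otimes>\<^bsub>N\<^esub> \<psi> x"
      using N.m_assoc[of "inv\<^bsub>N\<^esub> k" k "\<psi> y"] k(2) KU[OF k(1)] KUc[OF k(1)] \<psi>c c by simp
    then show "(y, x) \<in> R n" using RI[OF c(2,1) Ki[OF k(1)]] by blast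
  next
    fix x y z assume "(x, y) \<in> R n" "(y, z) \<in> R n"
    then obtain k l where k: "k \<in> K n" "\<psi> x = k \<otimes>\<^bsub>N\<^esub> \<psi> y" "l \<in> K n" "\<psi> y = l \<otimes>\<^bsub>N\<^esub> \<psi> z"
      and c: "x \<in> carrier M" "y \<in> carrier M" "z \<in> carrier M"
      unfolding R_def by blast
    have "\<psi> x = (k \<otimes>\<^bsub>N\<^esub> l) \<otimes>\<^bsub>N\<^esub> \<psi> z"
      using k KUc[OF k(1)] KUc[OF k(3)] \<psi>h c by (simp add: N.m_assoc)
    then show "(x, z) \<in> R n" using RI[OF c(1,3) Km[OF k(1,3)]] by blast
  next
    fix x y z w assume "(x, y) \<in> R n" "(z, w) \<in> R n"
    then obtain k l where k: "k \<in> K n" "\<psi> x = k \<otimes>\<^bsub>N\<^esub> \<psi> y" "l \<in> K n" "\<psi> z = l \<otimes>\<^bsub>N\<^esub> \<psi> w"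
      and c: "x \<in> carrier M" "y \<in> carrier M" "z \<in> carrier M" "w \<in> carrier M"
      unfolding R_def by blast
    have "\<psi> (x \<otimes>\<^bsub>M\<^esub> z) = (k \<otimes>\<^bsub>N\<^esub> l) \<otimes>\<^bsub>N\<^esub> \<psi> (y \<otimes>\<^bsub>M\<^esub> w)"
      using k KUc[OF k(1)] KUc[OF k(3)] \<psi>h c by (simp add: N.m_ac)
    then show "(x \<otimes>\<^bsub>M\<^esub> z, y \<otimes>\<^bsub>M\<^esub> w) \<in> R n" using RI[OF mM mM Km[OF k(1,3)]] c by blast
  qed (auto simp: R_def)
  moreover have "R n \<subset> R (Suc n)" for n
  proof -
    have "K n \<subset> K (Suc n)" using C(2) by (simp add: K_def)
    then obtain u where u: "u \<in> K (Suc n)" "u \<notin> K n" by blast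
    obtain a b where ab: "a \<in> carrier M" "b \<in> carrier M" "\<psi> b \<in> Units N" "\<psi> a = u \<otimes>\<^bsub>N\<^esub> \<psi> b"
      using gen KU[OF u(1)] by blast
    \<comment> \<open>The factor between \<open>\<psi> a\<close> and \<open>\<psi> b\<close> is
      unique because \<open>\<psi> b\<close> is a unit, and it equals \<open>u\<close>, which was
      chosen outside \<open>K n\<close>.\<close>
    have "(a, b) \<notin> R n"
    proof
      assume "(a, b) \<in> R n"
      then obtain k where k: "k \<in> K n" "\<psi> a = k \<otimes>\<^bsub>N\<^esub> \<psi> b" unfolding R_def by blast
      then have "u \<otimes>\<^bsub>N\<^esub> \<psi> b = k \<otimes>\<^bsub>N\<^esub> \<psi> b" using ab by simp
      then have "\<psi> b \<otimes>\<^bsub>N\<^esub> u = \<psi> b \<otimes>\<^bsub>N\<^esub> k"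
        using KUc[OF u(1)] KUc[OF k(1)] \<psi>c[OF ab(2)] by (simp add: N.m_comm)
      then have "u = k" using ab KUc[OF u(1)] KUc[OF k(1)] by (simp add: N.Units_l_cancel)
      then show False using k u by simp
    qed
    moreover have "(a, b) \<in> R (Suc n)" unfolding R_def using ab u by blast
    moreover have "R n \<subseteq> R (Suc n)" using \<open>K n \<subset> K (Suc n)\<close> unfolding R_def by blast
    ultimately show ?thesis by blast
  qed
  ultimately show False using M unfolding noetherian_mo_def by blast
qed

section \<open>Stalks\<close>

text \<open>Evaluates operations on classes that are written as unions over representatives, as in
  \<open>stalk\<close>, \<open>mo_loc\<close> and \<open>stalk_map\<close>. Well-definedness becomes
  the first premise, and a class must be nonempty for the union to have the common value.\<close>

lemma UN_pair_const:
  assumes "\<And>U s. (U, s) \<in> A \<Longrightarrow> m U s = c" "A \<noteq> {}"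
  shows "(\<Union>(U, s)\<in>A. m U s) = c"
proof -
  have "(\<Union>(U, s)\<in>A. m U s) = (\<Union>p\<in>A. c)"
    by (intro SUP_cong refl) (use assms in auto)
  then show ?thesis using assms(2) by simp
qed

lemma UN_pairs_const:
  assumes "\<And>U s V t. (U, s) \<in> A \<Longrightarrow> (V, t) \<in> B \<Longrightarrow> m U s V t = c" "A \<noteq> {}" "B \<noteq> {}"
  shows "(\<Union>(U, s)\<in>A. \<Union>(V, t)\<in>B. m U s V t) = c"
  by (intro UN_pair_const assms)

locale geom_space =
  fixes X :: "('p, 's) gspace"
  assumes geometric_space: "geometric_space X"
begin

abbreviation "opn \<equiv> openin (gtop X)"

lemma sect_is_mo: "opn U \<Longrightarrow> is_mo (sect X U)"
  by (rule geometric_space[unfolded geometric_space_def, THEN conjunct1, rule_format])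

lemma sect_comm_monoid: "opn U \<Longrightarrow> comm_monoid (sect X U)"
  using sect_is_mo by (auto simp: is_mo_def)

lemma res_hom:
  assumes "opn U" "opn V" "V \<subseteq> U"
  shows "restrict (resm X U V) (carrier (sect X U)) \<in> mo_hom (sect X U) (sect X V)"
  using geometric_space[unfolded geometric_space_def, THEN conjunct2, THEN conjunct1, rule_format] assms
  by simp

lemma res_closed:
  assumes "opn U" "opn V" "V \<subseteq> U" "s \<in> carrier (sect X U)"
  shows "resm X U V s \<in> carrier (sect X V)"
  using res_hom[OF assms(1-3)] assms(4) by (auto simp: mo_hom_def hom_def Pi_iff)

lemma res_mult:
  assumes "opn U" "opn V" "V \<subseteq> U" "s \<in> carrier (sect X U)" "t \<in> carrier (sect X U)"
  shows "resm X U V (s \<otimes>\<^bsub>sect X U\<^esub> t) = resm X U V s \<otimes>\<^bsub>sect X V\<^esub> resm X U V t"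
proof -
  have "s \<otimes>\<^bsub>sect X U\<^esub> t \<in> carrier (sect X U)"
    using sect_comm_monoid[OF assms(1)] assms(4,5) by (simp add: comm_monoid.axioms(1) monoid.m_closed)
  then show ?thesis
    using hom_mult[of "restrict (resm X U V) (carrier (sect X U))" "sect X U" "sect X V" s t]
      res_hom[OF assms(1-3)] assms(4,5) by (simp add: mo_hom_def)
qed

lemma sect_one_closed: "opn U \<Longrightarrow> \<one>\<^bsub>sect X U\<^esub> \<in> carrier (sect X U)"
  using sect_comm_monoid by (simp add: comm_monoid.axioms(1) monoid.one_closed)

lemma sect_zero_closed: "opn U \<Longrightarrow> azero (sect X U) \<in> carrier (sect X U)"
  using sect_is_mo by (auto simp: is_mo_def)

lemma res_one:
  assumes "opn U" "opn V" "V \<subseteq> U"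
  shows "resm X U V \<one>\<^bsub>sect X U\<^esub> = \<one>\<^bsub>sect X V\<^esub>"
  using res_hom[OF assms] sect_one_closed[OF assms(1)] by (auto simp: mo_hom_def)

lemma res_zero:
  assumes "opn U" "opn V" "V \<subseteq> U"
  shows "resm X U V (azero (sect X U)) = azero (sect X V)"
  using res_hom[OF assms] sect_zero_closed[OF assms(1)] by (auto simp: mo_hom_def)

lemma res_id: "opn U \<Longrightarrow> s \<in> carrier (sect X U) \<Longrightarrow> resm X U U s = s"
  by (rule geometric_space[unfolded geometric_space_def, THEN conjunct2, THEN conjunct2,
    THEN conjunct1, rule_format])

lemma res_res:
  assumes "opn U" "opn V" "opn W" "W \<subseteq> V" "V \<subseteq> U" "s \<in> carrier (sect X U)"
  shows "resm X V W (resm X U V s) = resm X U W s"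
  using geometric_space[unfolded geometric_space_def, THEN conjunct2, THEN conjunct2,
    THEN conjunct2, THEN conjunct1, rule_format] assms
  by simp

lemma germ_eqI:
  assumes "opn U" "s \<in> carrier (sect X U)" "opn V" "t \<in> carrier (sect X V)"
    and W: "opn W" "x \<in> W" "W \<subseteq> U" "W \<subseteq> V" and eq: "resm X U W s = resm X V W t"
  shows "germ X x U s = germ X x V t"
proof -
  have sub: "germ X x U' s' \<subseteq> germ X x V' t'"
    if UV: "opn U'" "s' \<in> carrier (sect X U')" "opn V'" "t' \<in> carrier (sect X V')"
      "W \<subseteq> U'" "W \<subseteq> V'" "resm X U' W s' = resm X V' W t'" for U' s' V' t'
  proof
    fix p assume p: "p \<in> germ X x U' s'"
    obtain O' r where "p = (O', r)" by (cases p)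
    with p obtain W' where O': "opn O'" "x \<in> O'" "r \<in> carrier (sect X O')"
      and W': "opn W'" "x \<in> W'" "W' \<subseteq> U'" "W' \<subseteq> O'" "resm X U' W' s' = resm X O' W' r"
      unfolding germ_def by auto
    have o: "opn (W \<inter> W')" using W W' by auto
    have "resm X V' (W \<inter> W') t' = resm X W (W \<inter> W') (resm X V' W t')"
      using UV W o by (intro res_res[symmetric]) auto
    also have "\<dots> = resm X W (W \<inter> W') (resm X U' W s')" by (simp add: UV)
    also have "\<dots> = resm X U' (W \<inter> W') s'"
      using UV W o by (intro res_res) auto
    also have "\<dots> = resm X W' (W \<inter> W') (resm X U' W' s')"
      using UV W' o by (intro res_res[symmetric]) auto
    also have "\<dots> = resm X O' (W \<inter> W') r"
      unfolding W' using O' W' o by (intro res_res) auto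
    finally show "p \<in> germ X x V' t'"
      using \<open>p = (O', r)\<close> O' W W' o UV unfolding germ_def
      by (auto intro!: exI[of _ "W \<inter> W'"])
  qed
  show ?thesis using sub[of U s V t] sub[of V t U s] assms by auto
qed

lemma germ_self:
  assumes "opn U" "x \<in> U" "s \<in> carrier (sect X U)"
  shows "(U, s) \<in> germ X x U s"
  using assms unfolding germ_def by auto

lemma germ_eqD:
  assumes "opn U" "x \<in> U" "s \<in> carrier (sect X U)" "germ X x U s = germ X x V t"
  obtains W where "opn W" "x \<in> W" "W \<subseteq> U" "W \<subseteq> V" "resm X U W s = resm X V W t"
proof -
  have "(U, s) \<in> germ X x V t" using germ_self[OF assms(1-3)] assms(4) by simp
  then show ?thesis using that unfolding germ_def by auto
qed

lemma germ_memD: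
  assumes "opn U" "s \<in> carrier (sect X U)" "(V, t) \<in> germ X x U s"
  shows "opn V" "x \<in> V" "t \<in> carrier (sect X V)" "germ X x V t = germ X x U s"
proof -
  from assms(3) obtain W where V: "opn V" "x \<in> V" "t \<in> carrier (sect X V)"
    and W: "opn W" "x \<in> W" "W \<subseteq> U" "W \<subseteq> V" "resm X U W s = resm X V W t"
    unfolding germ_def by auto
  show "opn V" "x \<in> V" "t \<in> carrier (sect X V)" by fact+
  show "germ X x V t = germ X x U s"
    by (rule germ_eqI[OF V(1,3) assms(1,2) W(1,2,4,3) W(5)[symmetric]])
qed

lemma germ_res:
  assumes "opn U" "opn V" "x \<in> V" "V \<subseteq> U" "s \<in> carrier (sect X U)"
  shows "germ X x V (resm X U V s) = germ X x U s"
proof (rule germ_eqI[of _ _ _ _ V])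
  show "resm X V V (resm X U V s) = resm X U V s"
    using assms by (intro res_id res_closed) auto
qed (use assms res_closed in auto)

lemma germ_in_stalk:
  assumes "opn U" "x \<in> U" "s \<in> carrier (sect X U)"
  shows "germ X x U s \<in> carrier (stalk X x)"
  using assms unfolding stalk_def by auto

lemma stalk_carrierE:
  assumes "A \<in> carrier (stalk X x)"
  obtains U s where "opn U" "x \<in> U" "s \<in> carrier (sect X U)" "A = germ X x U s"
  using assms unfolding stalk_def by auto

lemma stalk_memD:
  assumes "A \<in> carrier (stalk X x)" "(V, t) \<in> A"
  shows "opn V" "x \<in> V" "t \<in> carrier (sect X V)" "A = germ X x V t"
proof -
  obtain U s where "opn U" "x \<in> U" "s \<in> carrier (sect X U)" "A = germ X x U s"
    using assms(1) by (rule stalk_carrierE)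
  then show "opn V" "x \<in> V" "t \<in> carrier (sect X V)" "A = germ X x V t"
    using germ_memD[of U s V t x] assms(2) by auto
qed

lemma sect_mult_closed:
  assumes "opn U" "s \<in> carrier (sect X U)" "t \<in> carrier (sect X U)"
  shows "s \<otimes>\<^bsub>sect X U\<^esub> t \<in> carrier (sect X U)"
  using sect_comm_monoid[OF assms(1)] assms(2,3) by (simp add: comm_monoid.axioms(1) monoid.m_closed)

text \<open>Independence of the representatives: by \<open>small\<close> the product may be computed
  on any smaller neighbourhood of \<open>x\<close>, and on \<open>W1 \<inter> W2\<close> the
  representatives agree with \<open>s\<close> and \<open>t\<close>.\<close>

lemma germ_mult:
  assumes U: "opn U" "x \<in> U" "s \<in> carrier (sect X U)" and V: "opn V" "x \<in> V" "t \<in> carrier (sect X V)"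
  shows "germ X x U s \<otimes>\<^bsub>stalk X x\<^esub> germ X x V t =
    germ X x (U \<inter> V) (resm X U (U \<inter> V) s \<otimes>\<^bsub>sect X (U \<inter> V)\<^esub> resm X V (U \<inter> V) t)"
proof -
  let ?m = "\<lambda>U s V t. germ X x (U \<inter> V) (resm X U (U \<inter> V) s \<otimes>\<^bsub>sect X (U \<inter> V)\<^esub> resm X V (U \<inter> V) t)"
  have small: "?m U s V t = germ X x W (resm X U W s \<otimes>\<^bsub>sect X W\<^esub> resm X V W t)"
    if "opn U" "x \<in> U" "s \<in> carrier (sect X U)" "opn V" "x \<in> V" "t \<in> carrier (sect X V)"
      "opn W" "x \<in> W" "W \<subseteq> U" "W \<subseteq> V" for U s V t W
  proof -
    have o: "opn (U \<inter> V)" "W \<subseteq> U \<inter> V" using that by auto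
    have c: "resm X U (U \<inter> V) s \<in> carrier (sect X (U \<inter> V))" "resm X V (U \<inter> V) t \<in> carrier (sect X (U \<inter> V))"
      using that o by (auto intro: res_closed)
    have "?m U s V t = germ X x W (resm X (U \<inter> V) W
        (resm X U (U \<inter> V) s \<otimes>\<^bsub>sect X (U \<inter> V)\<^esub> resm X V (U \<inter> V) t))"
      using that o c by (intro germ_res[symmetric] sect_mult_closed) auto
    also have "\<dots> = germ X x W (resm X U W s \<otimes>\<^bsub>sect X W\<^esub> resm X V W t)"
      using that o c by (simp add: res_mult res_res)
    finally show ?thesis .
  qed
  have "?m U' s' V' t' = ?m U s V t" if m: "(U', s') \<in> germ X x U s" "(V', t') \<in> germ X x V t" for U' s' V' t'
  proof -
    note U' = germ_memD[OF U(1,3) m(1)] and V' = germ_memD[OF V(1,3) m(2)]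
    obtain W1 where W1: "opn W1" "x \<in> W1" "W1 \<subseteq> U'" "W1 \<subseteq> U" "resm X U' W1 s' = resm X U W1 s"
      using germ_eqD[OF U'] by metis
    obtain W2 where W2: "opn W2" "x \<in> W2" "W2 \<subseteq> V'" "W2 \<subseteq> V" "resm X V' W2 t' = resm X V W2 t"
      using germ_eqD[OF V'] by metis
    let ?W = "W1 \<inter> W2"
    have o: "opn ?W" "x \<in> ?W" using W1 W2 by auto
    have 1: "resm X U' ?W s' = resm X U ?W s"
      using res_res[of U' W1 ?W s'] res_res[of U W1 ?W s] U U' W1 o by simp
    have 2: "resm X V' ?W t' = resm X V ?W t"
      using res_res[of V' W2 ?W t'] res_res[of V W2 ?W t] V V' W2 o by simp
    have sub: "?W \<subseteq> U'" "?W \<subseteq> V'" "?W \<subseteq> U" "?W \<subseteq> V" using W1 W2 by auto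
    show ?thesis
      unfolding small[OF U'(1-3) V'(1-3) o sub(1,2)] small[OF U V o sub(3,4)] 1 2 ..
  qed
  note eq = this
  have "germ X x U s \<noteq> {}" "germ X x V t \<noteq> {}"
    using germ_self[OF U] germ_self[OF V] by blast+
  from UN_pairs_const[of "germ X x U s" "germ X x V t" ?m, OF eq this]
  show ?thesis unfolding stalk_def monoid.simps .
qed

lemma germ_mult_same:
  assumes "opn U" "x \<in> U" "s \<in> carrier (sect X U)" "t \<in> carrier (sect X U)"
  shows "germ X x U s \<otimes>\<^bsub>stalk X x\<^esub> germ X x U t = germ X x U (s \<otimes>\<^bsub>sect X U\<^esub> t)"
  using germ_mult[OF assms(1-3) assms(1,2,4)] assms by (simp add: res_id)

lemma points_open: "opn (points X)" by simp

lemma stalk_one: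
  assumes "opn U" "x \<in> U"
  shows "\<one>\<^bsub>stalk X x\<^esub> = germ X x U \<one>\<^bsub>sect X U\<^esub>"
proof -
  have "U \<subseteq> points X" using assms by (simp add: openin_subset)
  then show ?thesis
    using germ_res[OF points_open assms _ sect_one_closed[OF points_open]]
    by (simp add: stalk_def res_one assms)
qed

lemma stalk_zero:
  assumes "opn U" "x \<in> U"
  shows "azero (stalk X x) = germ X x U (azero (sect X U))"
proof -
  have "U \<subseteq> points X" using assms by (simp add: openin_subset)
  then show ?thesis
    using germ_res[OF points_open assms _ sect_zero_closed[OF points_open]]
    by (simp add: stalk_def res_zero assms)
qed

text \<open>Puts three germs on one neighbourhood, so that the monoid laws of the stalk reduce to
  those of the sections there.\<close>

lemma stalk_common3:
  assumes "A \<in> carrier (stalk X x)" "B \<in> carrier (stalk X x)" "C \<in> carrier (stalk X x)"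
  obtains U s t r where "opn U" "x \<in> U" "s \<in> carrier (sect X U)" "t \<in> carrier (sect X U)"
    "r \<in> carrier (sect X U)" "A = germ X x U s" "B = germ X x U t" "C = germ X x U r"
proof -
  obtain U1 s where 1: "opn U1" "x \<in> U1" "s \<in> carrier (sect X U1)" "A = germ X x U1 s"
    using assms(1) by (rule stalk_carrierE)
  obtain U2 t where 2: "opn U2" "x \<in> U2" "t \<in> carrier (sect X U2)" "B = germ X x U2 t"
    using assms(2) by (rule stalk_carrierE)
  obtain U3 r where 3: "opn U3" "x \<in> U3" "r \<in> carrier (sect X U3)" "C = germ X x U3 r"
    using assms(3) by (rule stalk_carrierE)
  let ?U = "U1 \<inter> U2 \<inter> U3"
  have o: "opn ?U" "x \<in> ?U" using 1 2 3 by auto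
  have sub: "?U \<subseteq> U1" "?U \<subseteq> U2" "?U \<subseteq> U3" by auto
  have c: "resm X U1 ?U s \<in> carrier (sect X ?U)" "resm X U2 ?U t \<in> carrier (sect X ?U)"
    "resm X U3 ?U r \<in> carrier (sect X ?U)"
    using 1 2 3 o sub by (auto intro!: res_closed)
  show ?thesis
  proof (rule that[OF o c])
    show "A = germ X x ?U (resm X U1 ?U s)"
      using germ_res[OF 1(1) o sub(1) 1(3)] 1(4) by simp
    show "B = germ X x ?U (resm X U2 ?U t)"
      using germ_res[OF 2(1) o sub(2) 2(3)] 2(4) by simp
    show "C = germ X x ?U (resm X U3 ?U r)"
      using germ_res[OF 3(1) o sub(3) 3(3)] 3(4) by simp
  qed
qed

lemma stalk_is_mo:
  assumes x: "x \<in> points X"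
  shows "is_mo (stalk X x)"
proof -
  have "comm_monoid (stalk X x)"
  proof (rule comm_monoidI)
    fix A B assume AB: "A \<in> carrier (stalk X x)" "B \<in> carrier (stalk X x)"
    obtain U s t where U: "opn U" "x \<in> U" "s \<in> carrier (sect X U)" "t \<in> carrier (sect X U)"
      "A = germ X x U s" "B = germ X x U t"
      using stalk_common3[OF AB AB(1)] by metis
    then show "A \<otimes>\<^bsub>stalk X x\<^esub> B \<in> carrier (stalk X x)"
      by (simp add: germ_mult_same germ_in_stalk sect_mult_closed)
    interpret S: comm_monoid "sect X U" using U sect_comm_monoid by blast
    show "A \<otimes>\<^bsub>stalk X x\<^esub> B = B \<otimes>\<^bsub>stalk X x\<^esub> A"
      using U by (simp add: germ_mult_same S.m_comm)
  next
    show "\<one>\<^bsub>stalk X x\<^esub> \<in> carrier (stalk X x)"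
      using x by (simp add: stalk_one[OF points_open] germ_in_stalk sect_one_closed)
  next
    fix A B C assume ABC: "A \<in> carrier (stalk X x)" "B \<in> carrier (stalk X x)" "C \<in> carrier (stalk X x)"
    obtain U s t r where U: "opn U" "x \<in> U" "s \<in> carrier (sect X U)" "t \<in> carrier (sect X U)"
      "r \<in> carrier (sect X U)" "A = germ X x U s" "B = germ X x U t" "C = germ X x U r"
      by (rule stalk_common3[OF ABC])
    interpret S: comm_monoid "sect X U" using U sect_comm_monoid by blast
    show "A \<otimes>\<^bsub>stalk X x\<^esub> B \<otimes>\<^bsub>stalk X x\<^esub> C = A \<otimes>\<^bsub>stalk X x\<^esub> (B \<otimes>\<^bsub>stalk X x\<^esub> C)"
      using U by (simp add: germ_mult_same S.m_assoc)
  next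
    fix A assume A: "A \<in> carrier (stalk X x)"
    obtain U s where U: "opn U" "x \<in> U" "s \<in> carrier (sect X U)" "A = germ X x U s"
      using A by (rule stalk_carrierE)
    interpret S: comm_monoid "sect X U" using U sect_comm_monoid by blast
    show "\<one>\<^bsub>stalk X x\<^esub> \<otimes>\<^bsub>stalk X x\<^esub> A = A"
      using U by (simp add: stalk_one[OF U(1,2)] germ_mult_same)
  qed
  moreover have "azero (stalk X x) \<in> carrier (stalk X x)"
    using x by (simp add: stalk_zero[OF points_open] germ_in_stalk sect_zero_closed)
  moreover have "azero (stalk X x) \<otimes>\<^bsub>stalk X x\<^esub> A = azero (stalk X x)" if A: "A \<in> carrier (stalk X x)" for A
  proof -
    obtain U s where U: "opn U" "x \<in> U" "s \<in> carrier (sect X U)" "A = germ X x U s"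
      using A by (rule stalk_carrierE)
    have "azero (sect X U) \<otimes>\<^bsub>sect X U\<^esub> s = azero (sect X U)"
      using U sect_is_mo[of U] by (simp add: is_mo_def)
    then show ?thesis
      using U by (simp add: stalk_zero[OF U(1,2)] germ_mult_same sect_zero_closed)
  qed
  ultimately show ?thesis by (simp add: is_mo_def)
qed

end

section \<open>Monoids whose nonzero elements are units\<close>

text \<open>The analogue of a field: up to isomorphism these are the monoids F_1[H], with H the
  group of units (\<open>mo_isomorphic_F1\<close>, \<open>mo_isomorphic_F1_units\<close>). In
  particular 1 differs from 0, since 1 is a unit.\<close>

definition mo_field :: "'a mo \<Rightarrow> bool" where
  "mo_field N \<longleftrightarrow> is_mo N \<and> Units N = carrier N - {azero N}"

locale mo_fld =
  fixes N :: "'a mo" (structure)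
  assumes mo_field: "mo_field N"
begin

lemma is_mo: "is_mo N"
  using mo_field by (simp add: mo_field_def)

sublocale comm_monoid N
  using is_mo by (simp add: is_mo_def)

lemma Units_eq: "Units N = carrier N - {azero N}"
  using mo_field by (simp add: mo_field_def)

lemma zero_closed [simp]: "azero N \<in> carrier N"
  using is_mo by (simp add: is_mo_def)

lemma zero_mult [simp]: "a \<in> carrier N \<Longrightarrow> azero N \<otimes> a = azero N"
  using is_mo by (simp add: is_mo_def)

lemma mult_zero [simp]: "a \<in> carrier N \<Longrightarrow> a \<otimes> azero N = azero N"
  using zero_mult m_comm[of a "azero N"] by simp

lemma one_neq_zero [simp]: "\<one> \<noteq> azero N"
  using Units_eq Units_one_closed by auto

lemma mult_eq_zero_iff:
  assumes "a \<in> carrier N" "b \<in> carrier N"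
  shows "a \<otimes> b = azero N \<longleftrightarrow> a = azero N \<or> b = azero N"
proof
  assume eq: "a \<otimes> b = azero N"
  show "a = azero N \<or> b = azero N"
  proof (rule ccontr)
    assume "\<not> ?thesis"
    then have "a \<in> Units N" "b \<in> Units N" using assms Units_eq by auto
    then have "a \<otimes> b \<in> Units N" by simp
    then show False using eq Units_eq by simp
  qed
qed (use assms in auto)

definition pt :: "'a set" where "pt = {azero N}"

lemma mo_ideal_iff: "mo_ideal N I \<longleftrightarrow> I = {azero N} \<or> I = carrier N"
proof
  assume I: "mo_ideal N I"
  show "I = {azero N} \<or> I = carrier N"
  proof (cases "I = {azero N}")
    case False
    then obtain a where a: "a \<in> I" "a \<noteq> azero N" using I by (auto simp: mo_ideal_def)
    then have "a \<in> Units N" using I Units_eq by (auto simp: mo_ideal_def)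
    have "x \<in> I" if x: "x \<in> carrier N" for x
    proof -
      have "a \<otimes> (inv a \<otimes> x) \<in> I" using I a x \<open>a \<in> Units N\<close> by (simp add: mo_ideal_def)
      then show ?thesis using \<open>a \<in> Units N\<close> x by (simp add: m_assoc[symmetric] Units_closed)
    qed
    then show ?thesis using I by (auto simp: mo_ideal_def)
  qed simp
qed (auto simp: mo_ideal_def)

lemma mo_prime_iff: "mo_prime N P \<longleftrightarrow> P = pt"
proof
  assume "mo_prime N P"
  then show "P = pt" unfolding mo_prime_def mo_ideal_iff pt_def by auto
next
  assume "P = pt"
  then show "mo_prime N P"
    unfolding mo_prime_def mo_ideal_iff pt_def by (auto simp: mult_eq_zero_iff)
qed

lemma openin_Spec: "openin (gtop (Spec N)) U \<longleftrightarrow> U = {} \<or> U = {pt}"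
proof -
  have "openin (gtop (Spec N)) U \<longleftrightarrow> (\<exists>I. mo_ideal N I \<and> U = {P. mo_prime N P \<and> \<not> I \<subseteq> P})"
    using istopology_Spec[OF is_mo] by (simp add: Spec_def Spec_top_def)
  also have "\<dots> \<longleftrightarrow> U = {P. P = pt \<and> \<not> {azero N} \<subseteq> P} \<or> U = {P. P = pt \<and> \<not> carrier N \<subseteq> P}"
    unfolding mo_ideal_iff mo_prime_iff by auto
  also have "{P. P = pt \<and> \<not> {azero N} \<subseteq> P} = {}" by (auto simp: pt_def)
  also have "{P. P = pt \<and> \<not> carrier N \<subseteq> P} = {pt}"
    using one_closed one_neq_zero unfolding pt_def by blast
  finally show ?thesis .
qed

lemma points_Spec: "points (Spec N) = {pt}"
  using openin_Spec openin_topspace openin_subset[of "gtop (Spec N)" "{pt}"] by blast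

lemma openin_Spec_top: "openin (Spec_top N) U \<longleftrightarrow> U = {} \<or> U = {pt}"
  using openin_Spec by (simp add: Spec_def)

text \<open>The fraction a/1. Denominators outside \<open>pt\<close> are units, so every fraction
  has this form and \<open>fr\<close> identifies \<open>N\<close> with its localization at
  \<open>pt\<close>.\<close>

definition fr :: "'a \<Rightarrow> ('a \<times> 'a) set" where "fr a = frac N pt a \<one>"

lemma mem_frac:
  assumes "a \<in> carrier N" "s \<in> carrier N - pt"
  shows "(b, t) \<in> frac N pt a s \<longleftrightarrow> b \<in> carrier N \<and> t \<in> carrier N - pt \<and> t \<otimes> a = s \<otimes> b"
proof -
  have "(\<exists>u\<in>carrier N - pt. u \<otimes> (t \<otimes> a) = u \<otimes> (s \<otimes> b)) \<longleftrightarrow> t \<otimes> a = s \<otimes> b"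
    if bt: "b \<in> carrier N" "t \<in> carrier N"
  proof
    assume "\<exists>u\<in>carrier N - pt. u \<otimes> (t \<otimes> a) = u \<otimes> (s \<otimes> b)"
    then obtain u where u: "u \<in> carrier N - pt" "u \<otimes> (t \<otimes> a) = u \<otimes> (s \<otimes> b)" ..
    then have "u \<in> Units N" using Units_eq by (simp add: pt_def)
    then show "t \<otimes> a = s \<otimes> b" using u bt assms by (simp add: Units_l_cancel)
  next
    assume "t \<otimes> a = s \<otimes> b"
    then show "\<exists>u\<in>carrier N - pt. u \<otimes> (t \<otimes> a) = u \<otimes> (s \<otimes> b)"
      by (intro bexI[of _ \<one>]) (simp_all add: pt_def)
  qed
  then show ?thesis unfolding frac_def by auto
qed

lemma one_not_pt [simp]: "\<one> \<notin> pt" by (simp add: pt_def)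

lemma one_notin_pt: "\<one> \<in> carrier N - pt" by simp

lemma mem_fr:
  assumes "a \<in> carrier N"
  shows "(b, t) \<in> fr a \<longleftrightarrow> b \<in> carrier N \<and> t \<in> carrier N - pt \<and> t \<otimes> a = b"
  using mem_frac[OF assms one_notin_pt, of b t] by (auto simp: fr_def)

lemma fr_self: "a \<in> carrier N \<Longrightarrow> (a, \<one>) \<in> fr a"
  by (simp add: mem_fr)

lemma frac_eq:
  assumes a: "a \<in> carrier N" "s \<in> carrier N - pt" and b: "b \<in> carrier N" "t \<in> carrier N - pt"
    and eq: "t \<otimes> a = s \<otimes> b"
  shows "frac N pt a s = frac N pt b t"
proof -
  have *: "frac N pt a s \<subseteq> frac N pt b t"
    if a: "a \<in> carrier N" "s \<in> carrier N - pt" and b: "b \<in> carrier N" "t \<in> carrier N - pt"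
    and eq: "t \<otimes> a = s \<otimes> b" for a b s t
  proof
    fix p assume "p \<in> frac N pt a s"
    then obtain c u where p: "p = (c, u)" "c \<in> carrier N" "u \<in> carrier N - pt" "u \<otimes> a = s \<otimes> c"
      using mem_frac[OF a] by (cases p) auto
    have "s \<in> Units N" using a Units_eq by (simp add: pt_def)
    have "s \<otimes> (u \<otimes> b) = u \<otimes> (t \<otimes> a)" using a b p by (simp add: eq m_lcomm)
    also have "\<dots> = t \<otimes> (s \<otimes> c)" using a b p by (simp add: m_lcomm flip: p(4))
    also have "\<dots> = s \<otimes> (t \<otimes> c)" using a b p by (simp add: m_lcomm)
    finally have "u \<otimes> b = t \<otimes> c" using \<open>s \<in> Units N\<close> a b p by (simp add: Units_l_cancel)
    then show "p \<in> frac N pt b t" using mem_frac[OF b] p by simp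
  qed
  show ?thesis using *[OF a b eq] *[OF b a eq[symmetric]] by blast
qed

lemma frac_eq_fr:
  assumes "a \<in> carrier N" "s \<in> carrier N - pt"
  shows "frac N pt a s = fr (inv s \<otimes> a)"
proof -
  have s: "s \<in> Units N" using assms Units_eq by (simp add: pt_def)
  show ?thesis
    unfolding fr_def
    by (rule frac_eq) (use assms s one_notin_pt in \<open>auto simp: m_assoc[symmetric]\<close>)
qed

lemma fr_inj:
  assumes "a \<in> carrier N" "b \<in> carrier N"
  shows "fr a = fr b \<longleftrightarrow> a = b"
proof
  assume "fr a = fr b"
  moreover have "(a, \<one>) \<in> fr a"
    using assms by (simp add: fr_self)
  ultimately have "(a, \<one>) \<in> fr b" by simp
  then show "a = b" using assms by (simp add: mem_fr)
qed simp

lemma mo_loc_carrier: "carrier (mo_loc N pt) = fr ` carrier N"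
proof
  show "carrier (mo_loc N pt) \<subseteq> fr ` carrier N"
  proof
    fix A assume "A \<in> carrier (mo_loc N pt)"
    then obtain a s where "A = frac N pt a s" "a \<in> carrier N" "s \<in> carrier N - pt"
      unfolding mo_loc_def by auto
    moreover from this have "s \<in> Units N" using Units_eq by (simp add: pt_def)
    ultimately show "A \<in> fr ` carrier N" by (simp add: frac_eq_fr)
  qed
  show "fr ` carrier N \<subseteq> carrier (mo_loc N pt)"
  proof
    fix A assume "A \<in> fr ` carrier N"
    then obtain a where "A = frac N pt a \<one>" "a \<in> carrier N" by (auto simp: fr_def)
    then show "A \<in> carrier (mo_loc N pt)"
      unfolding mo_loc_def partial_object.simps using one_notin_pt by blast
  qed
qed

lemma mo_loc_mult:
  assumes "a \<in> carrier N" "b \<in> carrier N"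
  shows "fr a \<otimes>\<^bsub>mo_loc N pt\<^esub> fr b = fr (a \<otimes> b)"
proof -
  have eq: "frac N pt (a' \<otimes> b') (s \<otimes> t) = fr (a \<otimes> b)"
    if m: "(a', s) \<in> fr a" "(b', t) \<in> fr b" for a' s b' t
  proof -
    have 1: "a' \<in> carrier N" "s \<in> carrier N - pt" "s \<otimes> a = a'"
      and 2: "b' \<in> carrier N" "t \<in> carrier N - pt" "t \<otimes> b = b'"
      using m assms by (simp_all add: mem_fr)
    have "s \<otimes> t \<in> carrier N - pt" using 1 2 by (auto simp: pt_def mult_eq_zero_iff)
    moreover have "\<one> \<otimes> (a' \<otimes> b') = s \<otimes> t \<otimes> (a \<otimes> b)"
      using 1 2 assms by (auto simp: m_ac)
    ultimately show ?thesis
      unfolding fr_def using 1 2 assms one_notin_pt by (intro frac_eq) auto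
  qed
  have "fr a \<noteq> {}" "fr b \<noteq> {}" using fr_self assms by blast+
  from UN_pairs_const[of "fr a" "fr b" "\<lambda>a s b t. frac N pt (a \<otimes> b) (s \<otimes> t)", OF eq this]
  show ?thesis unfolding mo_loc_def monoid.simps .
qed

text \<open>The identification of \<open>N\<close> with the sections over the whole space
  \<open>{pt}\<close>; see \<open>sect_carrier\<close>.\<close>

definition \<iota> :: "'a \<Rightarrow> 'a set \<Rightarrow> ('a \<times> 'a) set" where
  "\<iota> a = restrict (\<lambda>P. fr a) {pt}"

lemma \<iota>_inj: "a \<in> carrier N \<Longrightarrow> b \<in> carrier N \<Longrightarrow> \<iota> a = \<iota> b \<longleftrightarrow> a = b"
  unfolding \<iota>_def using fr_inj[of a b] by (metis restrict_apply' singletonI)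

lemma sect_carrier: "carrier (sect (Spec N) {pt}) = \<iota> ` carrier N"
proof -
  have "Spec_sections N {pt} = {pt} \<rightarrow>\<^sub>E carrier (mo_loc N pt)"
  proof (intro subset_antisym subsetI)
    fix \<sigma> assume \<sigma>: "\<sigma> \<in> {pt} \<rightarrow>\<^sub>E carrier (mo_loc N pt)"
    then have "\<sigma> pt \<in> fr ` carrier N" using mo_loc_carrier by auto
    then obtain a where a: "a \<in> carrier N" "\<sigma> pt = fr a" by blast
    have "\<forall>P\<in>{pt}. \<exists>V. openin (Spec_top N) V \<and> P \<in> V \<and> V \<subseteq> {pt} \<and>
       (\<exists>a\<in>carrier N. \<exists>s\<in>carrier N. \<forall>Q\<in>V. s \<notin> Q \<and> \<sigma> Q = frac N Q a s)"
    proof (intro ballI exI[of _ "{pt}"] conjI)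
      have "\<forall>Q\<in>{pt}. \<one> \<notin> Q \<and> \<sigma> Q = frac N Q a \<one>" using a by (simp add: fr_def)
      then show "\<exists>a\<in>carrier N. \<exists>s\<in>carrier N. \<forall>Q\<in>{pt}. s \<notin> Q \<and> \<sigma> Q = frac N Q a s"
        using a(1) one_closed by blast
    qed (simp_all add: openin_Spec_top)
    then show "\<sigma> \<in> Spec_sections N {pt}"
      unfolding Spec_sections_def using \<sigma> by (simp add: PiE_iff)
  qed (simp add: Spec_sections_def PiE_iff)
  also have "\<dots> = \<iota> ` carrier N"
  proof (intro subset_antisym subsetI)
    fix \<sigma> assume \<sigma>: "\<sigma> \<in> {pt} \<rightarrow>\<^sub>E carrier (mo_loc N pt)"
    then have "\<sigma> pt \<in> fr ` carrier N" using mo_loc_carrier by auto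
    then obtain a where a: "a \<in> carrier N" "\<sigma> pt = fr a" by blast
    have "\<sigma> = \<iota> a"
      by (rule extensionalityI[of _ "{pt}"]) (use \<sigma> a in \<open>auto simp: \<iota>_def PiE_def\<close>)
    then show "\<sigma> \<in> \<iota> ` carrier N" using a by blast
  next
    fix \<sigma> assume "\<sigma> \<in> \<iota> ` carrier N"
    then obtain a where "a \<in> carrier N" "\<sigma> = \<iota> a" by blast
    then show "\<sigma> \<in> {pt} \<rightarrow>\<^sub>E carrier (mo_loc N pt)"
      unfolding \<iota>_def PiE_iff by (simp add: mo_loc_carrier)
  qed
  finally show ?thesis by (simp add: Spec_def)
qed

lemma sect_mult:
  assumes "a \<in> carrier N" "b \<in> carrier N"
  shows "\<iota> a \<otimes>\<^bsub>sect (Spec N) {pt}\<^esub> \<iota> b = \<iota> (a \<otimes> b)"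
  by (rule extensionalityI[of _ "{pt}"]) (auto simp: Spec_def \<iota>_def mo_loc_mult assms)

lemma sect_one: "\<one>\<^bsub>sect (Spec N) {pt}\<^esub> = \<iota> \<one>"
  by (rule extensionalityI[of _ "{pt}"]) (auto simp: Spec_def \<iota>_def fr_def mo_loc_def)

lemma sect_zero: "azero (sect (Spec N) {pt}) = \<iota> (azero N)"
  by (rule extensionalityI[of _ "{pt}"]) (auto simp: Spec_def \<iota>_def fr_def mo_loc_def)

lemma sect_empty: "carrier (sect (Spec N) {}) = {\<lambda>_. undefined}"
  by (auto simp: Spec_def Spec_sections_def)

lemma res_Spec: "resm (Spec N) U V \<sigma> = restrict \<sigma> V"
  by (simp add: Spec_def)

lemma restrict_\<iota>: "restrict (\<iota> a) {pt} = \<iota> a"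
  by (simp add: \<iota>_def)

text \<open>The identification of \<open>N\<close> with the stalk at \<open>pt\<close>. Since
  \<open>{pt}\<close> is the only neighbourhood of the point, a germ, taken as the set of all its
  representatives, is a singleton; see \<open>germ_Spec\<close>.\<close>

definition j :: "'a \<Rightarrow> ('a set set \<times> ('a set \<Rightarrow> ('a \<times> 'a) set)) set" where
  "j a = {({pt}, \<iota> a)}"

lemma germ_Spec:
  assumes "a \<in> carrier N"
  shows "germ (Spec N) pt {pt} (\<iota> a) = j a"
proof -
  have "(V, t) \<in> germ (Spec N) pt {pt} (\<iota> a) \<longleftrightarrow> V = {pt} \<and> t = \<iota> a" for V t
  proof
    assume "(V, t) \<in> germ (Spec N) pt {pt} (\<iota> a)"
    then obtain W where V: "V = {pt}" "t \<in> carrier (sect (Spec N) V)"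
      and W: "W = {pt}" "restrict (\<iota> a) W = restrict t W"
      unfolding germ_def openin_Spec res_Spec by auto
    obtain b where "t = \<iota> b" using V by (auto simp: sect_carrier)
    then show "V = {pt} \<and> t = \<iota> a" using V W by (simp add: restrict_\<iota>)
  next
    assume "V = {pt} \<and> t = \<iota> a"
    then show "(V, t) \<in> germ (Spec N) pt {pt} (\<iota> a)"
      using assms unfolding germ_def openin_Spec res_Spec
      by (simp add: sect_carrier) blast
  qed
  then show ?thesis unfolding j_def by auto
qed

lemma stalk_Spec_carrier: "carrier (stalk (Spec N) pt) = j ` carrier N"
proof -
  have "carrier (stalk (Spec N) pt) = {germ (Spec N) pt {pt} s |s. s \<in> carrier (sect (Spec N) {pt})}"
    unfolding stalk_def openin_Spec by auto
  also have "\<dots> = j ` carrier N"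
    unfolding sect_carrier using germ_Spec by (auto simp: image_iff)
  finally show ?thesis .
qed

lemma j_inj: "a \<in> carrier N \<Longrightarrow> b \<in> carrier N \<Longrightarrow> j a = j b \<longleftrightarrow> a = b"
  unfolding j_def by (simp add: \<iota>_inj)

lemma stalk_Spec_mult:
  assumes "a \<in> carrier N" "b \<in> carrier N"
  shows "j a \<otimes>\<^bsub>stalk (Spec N) pt\<^esub> j b = j (a \<otimes> b)"
  using assms by (simp add: stalk_def j_def[of a] j_def[of b] res_Spec restrict_\<iota> sect_mult germ_Spec)

lemma stalk_Spec_one: "\<one>\<^bsub>stalk (Spec N) pt\<^esub> = j \<one>"
  by (simp add: stalk_def points_Spec sect_one germ_Spec)

lemma stalk_Spec_zero: "azero (stalk (Spec N) pt) = j (azero N)"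
  by (simp add: stalk_def points_Spec sect_zero germ_Spec)

lemma stalk_Spec_Units: "Units (stalk (Spec N) pt) = j ` Units N"
proof (intro subset_antisym subsetI)
  fix A assume "A \<in> Units (stalk (Spec N) pt)"
  then obtain B where "A \<in> carrier (stalk (Spec N) pt)" "B \<in> carrier (stalk (Spec N) pt)"
    "B \<otimes>\<^bsub>stalk (Spec N) pt\<^esub> A = \<one>\<^bsub>stalk (Spec N) pt\<^esub>"
    unfolding Units_def by auto
  then obtain a b where ab: "a \<in> carrier N" "b \<in> carrier N" "A = j a" "j (b \<otimes> a) = j \<one>"
    by (auto simp: stalk_Spec_carrier stalk_Spec_mult stalk_Spec_one)
  then have "b \<otimes> a = \<one>" by (simp add: j_inj)
  then have "a \<in> Units N" using ab m_comm[of a b] unfolding Units_def by auto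
  then show "A \<in> j ` Units N" using ab by blast
next
  fix A assume "A \<in> j ` Units N"
  then obtain a where a: "a \<in> Units N" "A = j a" by blast
  then have "j (inv a) \<otimes>\<^bsub>stalk (Spec N) pt\<^esub> A = \<one>\<^bsub>stalk (Spec N) pt\<^esub>"
    "A \<otimes>\<^bsub>stalk (Spec N) pt\<^esub> j (inv a) = \<one>\<^bsub>stalk (Spec N) pt\<^esub>"
    by (simp_all add: stalk_Spec_mult stalk_Spec_one Units_closed)
  moreover have "A \<in> carrier (stalk (Spec N) pt)" "j (inv a) \<in> carrier (stalk (Spec N) pt)"
    using a by (auto simp: stalk_Spec_carrier Units_closed)
  ultimately show "A \<in> Units (stalk (Spec N) pt)" unfolding Units_def by blast
qed

lemma j_in_Units_iff:
  assumes a: "a \<in> carrier N"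
  shows "j a \<in> Units (stalk (Spec N) pt) \<longleftrightarrow> a \<in> Units N"
proof
  assume "j a \<in> Units (stalk (Spec N) pt)"
  then obtain b where b: "b \<in> Units N" "j a = j b" by (auto simp: stalk_Spec_Units)
  then have "a = b" using a by (simp add: j_inj Units_closed)
  then show "a \<in> Units N" using b by simp
qed (simp add: stalk_Spec_Units)

end

section \<open>Points with values in \<open>\<F>\<^sub>1[H]\<close>\<close>

text \<open>This makes extension by 0 from the units multiplicative: a product containing a non-unit
  is again a non-unit.\<close>

lemma (in comm_monoid) mult_in_Units_iff:
  assumes "a \<in> carrier G" "b \<in> carrier G"
  shows "a \<otimes> b \<in> Units G \<longleftrightarrow> a \<in> Units G \<and> b \<in> Units G"
proof
  have *: "a \<in> Units G" if ab: "a \<in> carrier G" "b \<in> carrier G" "a \<otimes> b \<in> Units G" for a b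
  proof -
    have "a \<otimes> (b \<otimes> inv (a \<otimes> b)) = \<one>" using ab by (simp add: m_assoc[symmetric])
    moreover from this have "(b \<otimes> inv (a \<otimes> b)) \<otimes> a = \<one>" using ab by (simp add: m_comm)
    moreover have "b \<otimes> inv (a \<otimes> b) \<in> carrier G" using ab by simp
    ultimately show ?thesis using ab(1) unfolding Units_def by blast
  qed
  assume "a \<otimes> b \<in> Units G"
  then show "a \<in> Units G \<and> b \<in> Units G"
    using *[of a b] *[of b a] assms by (simp add: m_comm)
qed simp

text \<open>
  Morphisms from the one-point space \<open>Spec N\<close> to \<open>X\<close>: a point \<open>x\<close> and a homomorphism from the units
  of the stalk at \<open>x\<close> to the units of \<open>N\<close>, extended by \<open>0\<close> to all of the stalk.
\<close>

locale spec_points = X: geom_space X + mo_fld N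
  for X :: "('p, 's) gspace" and N :: "'a mo" (structure) +
  assumes zero_not_unit: "x \<in> points X \<Longrightarrow> azero (stalk X x) \<notin> Units (stalk X x)"
begin

abbreviation homs :: "'p \<Rightarrow> (('p set \<times> 's) set \<Rightarrow> 'a) set" where
  "homs x \<equiv> hom (units_of (stalk X x)) (units_of N) \<inter> extensional (carrier (units_of (stalk X x)))"

text \<open>A local homomorphism to \<open>N\<close> sends exactly the units to units, hence all
  non-units to 0, so no other extension of \<open>h\<close> is possible. That it preserves 0 is the
  assumption \<open>zero_not_unit\<close>.\<close>

definition zext :: "'p \<Rightarrow> (('p set \<times> 's) set \<Rightarrow> 'a) \<Rightarrow> ('p set \<times> 's) set \<Rightarrow> 'a" where
  "zext x h A = (if A \<in> Units (stalk X x) then h A else azero N)"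

text \<open>If \<open>x\<close> is not in \<open>V\<close>, the preimage of \<open>V\<close> is
  empty, and the only section over the empty set is the function that is \<open>undefined\<close>
  everywhere (\<open>sect_empty\<close>).\<close>

definition \<Psi> :: "'p \<Rightarrow> (('p set \<times> 's) set \<Rightarrow> 'a) \<Rightarrow> ('a set, 'a set \<Rightarrow> ('a \<times> 'a) set, 'p, 's) gmor" where
  "\<Psi> x h = (restrict (\<lambda>_. x) {pt},
     restrict (\<lambda>V. restrict (\<lambda>t. if x \<in> V then \<iota> (zext x h (germ X x V t)) else (\<lambda>_. undefined))
       (carrier (sect X V))) {V. openin (gtop X) V})"

lemma fst_\<Psi>: "fst (\<Psi> x h) = restrict (\<lambda>_. x) {pt}" by (simp add: \<Psi>_def)

lemma snd_\<Psi>: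
  assumes "openin (gtop X) V" "t \<in> carrier (sect X V)"
  shows "snd (\<Psi> x h) V t = (if x \<in> V then \<iota> (zext x h (germ X x V t)) else (\<lambda>_. undefined))"
  using assms by (simp add: \<Psi>_def)

lemma preim_restrict: "preim (Spec N) (restrict (\<lambda>_. x) {pt}) V = (if x \<in> V then {pt} else {})"
  by (auto simp: preim_def points_Spec)

context
  fixes x h assumes x: "x \<in> points X" and h: "h \<in> homs x"
begin

interpretation S: comm_monoid "stalk X x"
  using X.stalk_is_mo[OF x] by (simp add: is_mo_def)

lemma zext_closed: "zext x h A \<in> carrier N"
proof -
  have "h A \<in> Units N" if "A \<in> Units (stalk X x)"
    using h that by (auto simp: hom_def units_of_carrier)
  then show ?thesis by (simp add: zext_def Units_closed)
qed

lemma zext_Units_iff: "zext x h A \<in> Units N \<longleftrightarrow> A \<in> Units (stalk X x)"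
proof -
  have "h A \<in> Units N" if "A \<in> Units (stalk X x)"
    using h that by (auto simp: hom_def units_of_carrier)
  then show ?thesis by (simp add: zext_def Units_eq)
qed

lemma zext_mult:
  assumes "A \<in> carrier (stalk X x)" "B \<in> carrier (stalk X x)"
  shows "zext x h (A \<otimes>\<^bsub>stalk X x\<^esub> B) = zext x h A \<otimes> zext x h B"
proof -
  have "h (A \<otimes>\<^bsub>stalk X x\<^esub> B) = h A \<otimes> h B" "h A \<in> carrier N" "h B \<in> carrier N"
    if "A \<in> Units (stalk X x)" "B \<in> Units (stalk X x)"
    using h that by (auto simp: hom_def units_of_carrier units_of_mult)
  moreover have "zext x h A \<in> carrier N" "zext x h B \<in> carrier N" by (rule zext_closed)+
  ultimately show ?thesis
    using S.mult_in_Units_iff[OF assms] by (auto simp: zext_def)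
qed

lemma zext_one: "zext x h \<one>\<^bsub>stalk X x\<^esub> = \<one>"
proof -
  have "h \<one>\<^bsub>units_of (stalk X x)\<^esub> = \<one>\<^bsub>units_of N\<^esub>"
    using h S.units_group units_group by (auto intro: hom_one)
  then show ?thesis by (simp add: zext_def units_of_one)
qed

lemma zext_zero: "zext x h (azero (stalk X x)) = azero N"
  by (simp add: zext_def zero_not_unit[OF x])

lemma snd_\<Psi>_mo_hom:
  assumes V: "openin (gtop X) V"
  shows "snd (\<Psi> x h) V \<in> mo_hom (sect X V) (sect (Spec N) (preim (Spec N) (fst (\<Psi> x h)) V))"
proof -
  interpret V: comm_monoid "sect X V" by (rule X.sect_comm_monoid[OF V])
  have z: "azero (sect X V) \<in> carrier (sect X V)" by (rule X.sect_zero_closed[OF V])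
  have ext: "snd (\<Psi> x h) V \<in> extensional (carrier (sect X V))" using V by (simp add: \<Psi>_def)
  show ?thesis
  proof (cases "x \<in> V")
    case True
    note germ = X.germ_in_stalk[OF V True]
    have "snd (\<Psi> x h) V \<in> hom (sect X V) (sect (Spec N) {pt})"
    proof (rule homI)
      fix s t assume "s \<in> carrier (sect X V)" "t \<in> carrier (sect X V)"
      then show "snd (\<Psi> x h) V (s \<otimes>\<^bsub>sect X V\<^esub> t) =
          snd (\<Psi> x h) V s \<otimes>\<^bsub>sect (Spec N) {pt}\<^esub> snd (\<Psi> x h) V t"
        using True V germ
        by (simp add: snd_\<Psi> sect_mult zext_closed X.germ_mult_same[symmetric] zext_mult)
    qed (use True V in \<open>simp add: snd_\<Psi> sect_carrier zext_closed\<close>)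
    moreover have "snd (\<Psi> x h) V \<one>\<^bsub>sect X V\<^esub> = \<iota> \<one>" "snd (\<Psi> x h) V (azero (sect X V)) = \<iota> (azero N)"
      using True V z
      by (simp_all add: snd_\<Psi> X.stalk_one[OF V True, symmetric] X.stalk_zero[OF V True, symmetric]
        zext_one zext_zero)
    ultimately show ?thesis
      using True ext by (simp add: mo_hom_def fst_\<Psi> preim_restrict sect_one sect_zero)
  next
    case False
    then have "snd (\<Psi> x h) V t = (\<lambda>_. undefined)" if "t \<in> carrier (sect X V)" for t
      using V that by (simp add: snd_\<Psi>)
    then show ?thesis
      using False ext z unfolding mo_hom_def fst_\<Psi> preim_restrict
      by (auto simp: hom_def sect_empty) (auto simp: Spec_def)
  qed
qed

lemma stalk_map_\<Psi>:
  assumes A: "A \<in> carrier (stalk X x)"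
  shows "stalk_map (Spec N) X (\<Psi> x h) pt A = j (zext x h A)"
proof -
  have fst: "fst (\<Psi> x h) pt = x" by (simp add: fst_\<Psi>)
  have eq: "germ (Spec N) pt (preim (Spec N) (fst (\<Psi> x h)) V) (snd (\<Psi> x h) V t) = j (zext x h A)"
    if "(V, t) \<in> A" for V t
    using X.stalk_memD[OF A that]
    by (simp add: snd_\<Psi> fst_\<Psi> preim_restrict germ_Spec zext_closed)
  have "A \<noteq> {}" using A X.germ_self by (auto elim!: X.stalk_carrierE)
  from UN_pair_const[of A "\<lambda>V t. germ (Spec N) pt (preim (Spec N) (fst (\<Psi> x h)) V) (snd (\<Psi> x h) V t)", OF eq this]
  show ?thesis using A by (simp add: stalk_map_def fst)
qed

lemma \<Psi>_in_gmor: "\<Psi> x h \<in> gmor (Spec N) X"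
proof -
  have "continuous_map (gtop (Spec N)) (gtop X) (fst (\<Psi> x h))"
    unfolding fst_\<Psi> continuous_map_def points_Spec openin_Spec using x by auto
  moreover have "snd (\<Psi> x h) V' (resm X V V' t) =
      resm (Spec N) (preim (Spec N) (fst (\<Psi> x h)) V) (preim (Spec N) (fst (\<Psi> x h)) V') (snd (\<Psi> x h) V t)"
    if V: "openin (gtop X) V" "openin (gtop X) V'" "V' \<subseteq> V" and t: "t \<in> carrier (sect X V)" for V V' t
  proof -
    have r: "resm X V V' t \<in> carrier (sect X V')" using V t by (rule X.res_closed)
    have empty: "restrict \<sigma> {} = (\<lambda>_. undefined)" for \<sigma> :: "'a set \<Rightarrow> ('a \<times> 'a) set" by auto
    show ?thesis
    proof (cases "x \<in> V'")
      case True
      then have "x \<in> V" using V by auto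
      then show ?thesis
        using True V t r by (simp add: snd_\<Psi> fst_\<Psi> preim_restrict res_Spec restrict_\<iota> X.germ_res)
    next
      case False
      then show ?thesis
        using V t r empty by (simp add: snd_\<Psi> fst_\<Psi> preim_restrict res_Spec)
    qed
  qed
  moreover have "local_hom (stalk X x) (stalk (Spec N) pt) (stalk_map (Spec N) X (\<Psi> x h) pt)"
    unfolding local_hom_def
  proof
    show "stalk_map (Spec N) X (\<Psi> x h) pt \<in> mo_hom (stalk X x) (stalk (Spec N) pt)"
      unfolding mo_hom_def
    proof (intro CollectI conjI homI)
      show "stalk_map (Spec N) X (\<Psi> x h) pt \<in> extensional (carrier (stalk X x))"
        by (simp add: stalk_map_def fst_\<Psi>)
      have "azero (stalk X x) \<in> carrier (stalk X x)" using X.stalk_is_mo[OF x] by (simp add: is_mo_def)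
      then show "stalk_map (Spec N) X (\<Psi> x h) pt (azero (stalk X x)) = azero (stalk (Spec N) pt)"
        by (simp add: stalk_map_\<Psi> zext_zero stalk_Spec_zero)
    qed (simp_all add: stalk_map_\<Psi> zext_closed zext_mult zext_one stalk_Spec_carrier stalk_Spec_mult
        stalk_Spec_one)
    show "{A \<in> carrier (stalk X x). stalk_map (Spec N) X (\<Psi> x h) pt A \<in> Units (stalk (Spec N) pt)} =
        Units (stalk X x)"
    proof -
      have "stalk_map (Spec N) X (\<Psi> x h) pt A \<in> Units (stalk (Spec N) pt) \<longleftrightarrow> A \<in> Units (stalk X x)"
        if A: "A \<in> carrier (stalk X x)" for A
        using A by (simp add: stalk_map_\<Psi> j_in_Units_iff zext_closed zext_Units_iff)
      then show ?thesis using S.Units_closed by blast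
    qed
  qed
  ultimately show ?thesis
    using snd_\<Psi>_mo_hom unfolding gmor_def
    by (simp add: points_Spec fst_\<Psi>) (simp add: \<Psi>_def)
qed

end

text \<open>A section over a neighbourhood of \<open>x\<close> is sent to a section over
  \<open>{pt}\<close>, which is known from its germ; so the morphism is recovered from
  \<open>x\<close> and the stalk map. By locality the stalk map in turn is recovered from its values
  on units.\<close>

lemma gmor_eq_\<Psi>:
  assumes f: "f \<in> gmor (Spec N) X"
  shows "\<exists>x\<in>points X. \<exists>h\<in>homs x. f = \<Psi> x h"
proof -
  define x where "x = fst f pt"
  have cont: "continuous_map (gtop (Spec N)) (gtop X) (fst f)" and ext: "fst f \<in> extensional {pt}"
    and ext2: "snd f \<in> extensional {V. openin (gtop X) V}"
    and mo: "\<And>V. openin (gtop X) V \<Longrightarrow> snd f V \<in> mo_hom (sect X V) (sect (Spec N) (preim (Spec N) (fst f) V))"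
    and loc: "local_hom (stalk X x) (stalk (Spec N) pt) (stalk_map (Spec N) X f pt)"
    using f by (simp_all add: gmor_def points_Spec x_def)
  have x: "x \<in> points X" using cont by (auto simp: continuous_map_def points_Spec x_def)
  have fst: "fst f = restrict (\<lambda>_. x) {pt}"
    by (rule extensionalityI[OF ext]) (auto simp: x_def)
  interpret S: comm_monoid "stalk X x" using X.stalk_is_mo[OF x] by (simp add: is_mo_def)
  let ?\<sigma> = "stalk_map (Spec N) X f pt"
  have \<sigma>: "?\<sigma> \<in> mo_hom (stalk X x) (stalk (Spec N) pt)" and \<sigma>U: "{A \<in> carrier (stalk X x). ?\<sigma> A \<in> Units (stalk (Spec N) pt)} = Units (stalk X x)"
    using loc by (auto simp: local_hom_def)
  \<comment> \<open>The stalk map at \<open>x\<close>, read as a map into \<open>N\<close> through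
    the identification \<open>j\<close>.\<close>
  define g where "g A = (THE a. a \<in> carrier N \<and> ?\<sigma> A = j a)" for A
  have g: "g A \<in> carrier N" "?\<sigma> A = j (g A)" if A: "A \<in> carrier (stalk X x)" for A
  proof -
    have "?\<sigma> A \<in> carrier (stalk (Spec N) pt)" using \<sigma> A by (auto simp: mo_hom_def hom_def)
    then obtain a where "a \<in> carrier N" "?\<sigma> A = j a" by (auto simp: stalk_Spec_carrier)
    then have "\<exists>!a. a \<in> carrier N \<and> ?\<sigma> A = j a" using j_inj by auto
    from theI'[OF this] show "g A \<in> carrier N" "?\<sigma> A = j (g A)" unfolding g_def by auto
  qed
  have g_mult: "g (A \<otimes>\<^bsub>stalk X x\<^esub> B) = g A \<otimes> g B"
    if AB: "A \<in> carrier (stalk X x)" "B \<in> carrier (stalk X x)" for A B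
  proof -
    have "j (g (A \<otimes>\<^bsub>stalk X x\<^esub> B)) = j (g A \<otimes> g B)"
      using \<sigma> AB g by (auto simp: mo_hom_def hom_def stalk_Spec_mult)
    then show ?thesis using j_inj g AB by simp
  qed
  have g_Units: "g A \<in> Units N \<longleftrightarrow> A \<in> Units (stalk X x)" if A: "A \<in> carrier (stalk X x)" for A
  proof -
    have "A \<in> Units (stalk X x) \<longleftrightarrow> ?\<sigma> A \<in> Units (stalk (Spec N) pt)" using \<sigma>U A by blast
    also have "\<dots> \<longleftrightarrow> g A \<in> Units N"
      unfolding g(2)[OF A] by (rule j_in_Units_iff[OF g(1)[OF A]])
    finally show ?thesis by simp
  qed
  define h where "h = restrict g (Units (stalk X x))"
  have h: "h \<in> homs x"
    using g_mult g_Units S.Units_closed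
    by (auto simp: h_def units_of_carrier units_of_mult intro!: homI)
  have zext: "zext x h A = g A" if A: "A \<in> carrier (stalk X x)" for A
    using g_Units[OF A] g(1)[OF A] by (auto simp: zext_def h_def Units_eq)
  have snd: "snd f V t = \<iota> (g (germ X x V t))"
    if V: "openin (gtop X) V" "x \<in> V" and t: "t \<in> carrier (sect X V)" for V t
  proof -
    let ?A = "germ X x V t"
    have A: "?A \<in> carrier (stalk X x)" using V t by (rule X.germ_in_stalk)
    have p: "preim (Spec N) (fst f) V = {pt}" using V by (simp add: fst preim_restrict)
    have "snd f V t \<in> carrier (sect (Spec N) {pt})"
      using mo[OF V(1)] t by (auto simp: p mo_hom_def hom_def)
    then obtain b where b: "b \<in> carrier N" "snd f V t = \<iota> b" by (auto simp: sect_carrier)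
    have "?\<sigma> ?A = (\<Union>(V, t)\<in>?A. germ (Spec N) pt (preim (Spec N) (fst f) V) (snd f V t))"
      unfolding stalk_map_def x_def[symmetric] using A by simp
    then have "germ (Spec N) pt (preim (Spec N) (fst f) V) (snd f V t) \<subseteq> ?\<sigma> ?A"
      using X.germ_self[OF V t] by blast
    then have "germ (Spec N) pt {pt} (\<iota> b) \<subseteq> ?\<sigma> ?A" by (simp add: p b)
    then have "j b \<subseteq> j (g ?A)" using b g(2)[OF A] by (simp add: germ_Spec)
    \<comment> \<open>The union in \<open>stalk_map\<close> yields only an inclusion, but both sides
      are singletons.\<close>
    then have "j b = j (g ?A)" by (simp add: j_def)
    then show ?thesis using b by (simp add: j_def)
  qed
  have "snd f = snd (\<Psi> x h)"
  proof (rule extensionalityI[OF ext2])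
    fix V assume "V \<in> {V. openin (gtop X) V}"
    then have V: "openin (gtop X) V" by simp
    show "snd f V = snd (\<Psi> x h) V"
    proof (rule extensionalityI)
      show "snd f V \<in> extensional (carrier (sect X V))" using mo[OF V] by (simp add: mo_hom_def)
      show "snd (\<Psi> x h) V \<in> extensional (carrier (sect X V))" using V by (simp add: \<Psi>_def)
      fix t assume t: "t \<in> carrier (sect X V)"
      show "snd f V t = snd (\<Psi> x h) V t"
      proof (cases "x \<in> V")
        case True
        then show ?thesis
          using V t snd zext[OF X.germ_in_stalk[OF V True t]] by (simp add: snd_\<Psi>)
      next
        case False
        then have "snd f V t \<in> carrier (sect (Spec N) {})"
          using mo[OF V] t by (auto simp: fst preim_restrict mo_hom_def hom_def)
        then show ?thesis using False V t by (simp add: snd_\<Psi> sect_empty)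
      qed
    qed
  qed (simp add: \<Psi>_def)
  then have "f = \<Psi> x h" using fst by (simp add: prod_eq_iff fst_\<Psi>)
  then show ?thesis using x h by blast
qed

lemma \<Psi>_inject:
  assumes x: "x \<in> points X" "h \<in> homs x" and y: "y \<in> points X" "k \<in> homs y" and eq: "\<Psi> x h = \<Psi> y k"
  shows "x = y \<and> h = k"
proof
  have "fst (\<Psi> x h) pt = fst (\<Psi> y k) pt" using eq by simp
  then show xy: "x = y" by (simp add: fst_\<Psi>)
  interpret S: comm_monoid "stalk X x" using X.stalk_is_mo[OF x(1)] by (simp add: is_mo_def)
  show "h = k"
  proof (rule extensionalityI[of _ "Units (stalk X x)"])
    fix A assume A: "A \<in> Units (stalk X x)"
    then obtain V t where V: "openin (gtop X) V" "x \<in> V" "t \<in> carrier (sect X V)" "A = germ X x V t"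
      using S.Units_closed by (metis X.stalk_carrierE)
    have "\<iota> (zext x h A) = \<iota> (zext x k A)"
      using fun_cong[OF fun_cong[OF arg_cong[OF eq, of snd], of V], of t] V xy by (simp add: snd_\<Psi>)
    moreover have "zext x h A \<in> carrier N" "zext x k A \<in> carrier N"
      using zext_closed[OF x] zext_closed[OF y] xy by simp_all
    ultimately have "zext x h A = zext x k A"
      using \<iota>_inj by simp
    then show "h A = k A" using A by (simp add: zext_def)
  qed (use x y xy in \<open>auto simp: units_of_carrier\<close>)
qed

lemma bij_betw_\<Psi>: "bij_betw (\<lambda>(x, h). \<Psi> x h) (SIGMA x:points X. homs x) (gmor (Spec N) X)"
  unfolding bij_betw_def
proof
  show "inj_on (\<lambda>(x, h). \<Psi> x h) (SIGMA x:points X. homs x)"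
    using \<Psi>_inject by (auto simp: inj_on_def)
  show "(\<lambda>(x, h). \<Psi> x h) ` (SIGMA x:points X. homs x) = gmor (Spec N) X"
  proof (intro subset_antisym subsetI)
    fix f assume "f \<in> gmor (Spec N) X"
    then obtain x h where "x \<in> points X" "h \<in> homs x" "f = \<Psi> x h"
      using gmor_eq_\<Psi> by blast
    then show "f \<in> (\<lambda>(x, h). \<Psi> x h) ` (SIGMA x:points X. homs x)"
      by (intro image_eqI[of _ _ "(x, h)"]) simp_all
  qed (use \<Psi>_in_gmor in auto)
qed

end

section \<open>Change of the monoid, and local charts\<close>

text \<open>A nonzero \<open>a\<close> is invertible, so \<open>\<rho> a = 0\<close> would give 1 =
  0 in \<open>N'\<close>. Consequently the map of spectra sends the point to the point, and
  denominators stay admissible.\<close>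

lemma (in mo_fld) mo_hom_to_mo_fld_zero_iff:
  assumes N': "mo_fld N'" and \<rho>: "\<rho> \<in> mo_hom N N'" and a: "a \<in> carrier N"
  shows "\<rho> a = azero N' \<longleftrightarrow> a = azero N"
proof
  interpret N': mo_fld N' by (rule N')
  assume eq: "\<rho> a = azero N'"
  show "a = azero N"
  proof (rule ccontr)
    assume "a \<noteq> azero N"
    then have u: "a \<in> Units N" using a Units_eq by simp
    then have "inv a \<in> carrier N" by simp
    then have "\<rho> (a \<otimes> inv a) = \<rho> a \<otimes>\<^bsub>N'\<^esub> \<rho> (inv a)" "\<rho> (inv a) \<in> carrier N'"
      using \<rho> a by (auto simp: mo_hom_def hom_def simp del: Units_r_inv)
    then have "\<rho> \<one> = azero N'" using u eq by simp
    then show False using \<rho> N'.one_neq_zero by (simp add: mo_hom_def)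
  qed
qed (use \<rho> in \<open>simp add: mo_hom_def\<close>)

text \<open>Naturality of the description by pairs \<open>(x, h)\<close>: a change of
  \<open>N\<close> along \<open>\<rho>\<close> fixes the point and composes \<open>h\<close> with
  \<open>\<rho>\<close>. Extension by 0 commutes with \<open>\<rho>\<close> because
  \<open>\<rho>\<close> preserves 0.\<close>

lemma (in spec_points) gcomp_Spec_map:
  assumes N': "spec_points X N'" and \<rho>: "\<rho> \<in> mo_hom N N'"
    and x: "x \<in> points X" and h: "h \<in> homs x"
  shows "gcomp (Spec N') (Spec N) X (\<Psi> x h) (Spec_map N N' \<rho>) =
      spec_points.\<Psi> X N' x (restrict (\<lambda>A. \<rho> (h A)) (Units (stalk X x)))"
proof -
  interpret N': spec_points X N' by (rule N')
  have fldN': "mo_fld N'" by unfold_locales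
  have \<rho>c: "\<rho> a \<in> carrier N'" if "a \<in> carrier N" for a using \<rho> that by (auto simp: mo_hom_def hom_def)
  let ?k = "restrict (\<lambda>A. \<rho> (h A)) (Units (stalk X x))"
  have zx: "N'.zext x ?k A = \<rho> (zext x h A)" for A
    using \<rho> by (simp add: zext_def N'.zext_def mo_hom_def)
  have comap: "{a \<in> carrier N. \<rho> a \<in> N'.pt} = pt"
    using mo_hom_to_mo_fld_zero_iff[OF fldN' \<rho>] by (auto simp: pt_def N'.pt_def)
  define \<phi> where "\<phi> = restrict (\<lambda>_. pt) {N'.pt}"
  have \<phi>: "restrict (\<lambda>Q. {a \<in> carrier N. \<rho> a \<in> Q}) (points (Spec N')) = \<phi>"
    by (rule extensionalityI[of _ "{N'.pt}"]) (auto simp: \<phi>_def N'.points_Spec comap)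
  have Spec_map: "Spec_map N N' \<rho> = (\<phi>, restrict (\<lambda>U. restrict
      (\<lambda>\<sigma>. restrict (\<lambda>Q. \<Union>(a, s)\<in>\<sigma> (\<phi> Q). frac N' Q (\<rho> a) (\<rho> s)) (preim (Spec N') \<phi> U))
        (carrier (sect (Spec N) U))) {U. openin (gtop (Spec N)) U})"
    unfolding Spec_map_def Let_def \<phi> ..
  have fst: "fst (Spec_map N N' \<rho>) = \<phi>" by (simp add: Spec_map)
  have pre: "preim (Spec N') \<phi> V = (if pt \<in> V then {N'.pt} else {})" for V
    by (auto simp: preim_def N'.points_Spec \<phi>_def)
  have fracN': "(\<Union>(a, s)\<in>fr b. frac N' N'.pt (\<rho> a) (\<rho> s)) = N'.fr (\<rho> b)" if b: "b \<in> carrier N" for b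
  proof (rule UN_pair_const)
    fix a s assume "(a, s) \<in> fr b"
    then have as: "a \<in> carrier N" "s \<in> carrier N" "s \<notin> pt" "s \<otimes> b = a"
      using mem_fr[OF b, of a s] by auto
    then have "\<rho> s \<in> carrier N' - N'.pt"
      using mo_hom_to_mo_fld_zero_iff[OF fldN' \<rho> as(2)] \<rho>c by (simp add: pt_def N'.pt_def)
    moreover have "\<rho> a = \<rho> s \<otimes>\<^bsub>N'\<^esub> \<rho> b"
      using \<rho> as b by (auto simp: mo_hom_def hom_def)
    ultimately show "frac N' N'.pt (\<rho> a) (\<rho> s) = N'.fr (\<rho> b)"
      unfolding N'.fr_def using as b \<rho>c by (intro N'.frac_eq) auto
  qed (use fr_self[OF b] in blast)
  have snd_pt: "snd (Spec_map N N' \<rho>) {pt} (\<iota> b) = N'.\<iota> (\<rho> b)" if b: "b \<in> carrier N" for b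
  proof -
    have "snd (Spec_map N N' \<rho>) {pt} (\<iota> b) =
        restrict (\<lambda>Q. \<Union>(a, s)\<in>\<iota> b (\<phi> Q). frac N' Q (\<rho> a) (\<rho> s)) {N'.pt}"
      using b by (simp add: Spec_map openin_Spec sect_carrier pre)
    also have "\<dots> = N'.\<iota> (\<rho> b)"
      by (rule extensionalityI[of _ "{N'.pt}"]) (auto simp: \<phi>_def \<iota>_def N'.\<iota>_def fracN'[OF b])
    finally show ?thesis .
  qed
  have snd_empty: "snd (Spec_map N N' \<rho>) {} (\<lambda>_. undefined) = (\<lambda>_. undefined)"
    by (auto simp: Spec_map openin_Spec sect_empty pre)
  show ?thesis
  proof (rule prod_eqI)
    show "fst (gcomp (Spec N') (Spec N) X (\<Psi> x h) (Spec_map N N' \<rho>)) = fst (N'.\<Psi> x ?k)"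
      by (auto simp: gcomp_def fst \<phi>_def fst_\<Psi> N'.fst_\<Psi> N'.points_Spec compose_def restrict_def)
    show "snd (gcomp (Spec N') (Spec N) X (\<Psi> x h) (Spec_map N N' \<rho>)) = snd (N'.\<Psi> x ?k)"
    proof (rule extensionalityI[of _ "{W. openin (gtop X) W}"])
      fix W assume "W \<in> {W. openin (gtop X) W}"
      then have W: "openin (gtop X) W" by simp
      show "snd (gcomp (Spec N') (Spec N) X (\<Psi> x h) (Spec_map N N' \<rho>)) W = snd (N'.\<Psi> x ?k) W"
      proof (rule extensionalityI[of _ "carrier (sect X W)"])
        fix t assume t: "t \<in> carrier (sect X W)"
        show "snd (gcomp (Spec N') (Spec N) X (\<Psi> x h) (Spec_map N N' \<rho>)) W t = snd (N'.\<Psi> x ?k) W t"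
          using W t zext_closed[OF x h]
          by (simp add: gcomp_def compose_def fst_\<Psi> preim_restrict snd_\<Psi> N'.snd_\<Psi> snd_pt snd_empty zx)
      qed (use W in \<open>simp_all add: gcomp_def compose_def N'.\<Psi>_def\<close>)
    qed (simp_all add: gcomp_def N'.\<Psi>_def)
  qed
qed

section \<open>Stalks inside a chart of the geometric scheme\<close>

locale geom_chart = geom_space X for X :: "('p, 's) gspace" +
  fixes U :: "'p set" and M :: "'a mo" and x :: 'p and f g
  assumes U: "openin (gtop X) U" "x \<in> U" and M: "is_mo M"
    and f: "f \<in> gmor (open_subspace X U) (Spec M)" and g: "g \<in> gmor (Spec M) (open_subspace X U)"
    and gf: "gcomp (open_subspace X U) (Spec M) (open_subspace X U) g f = gid (open_subspace X U)"
begin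

abbreviation "Y \<equiv> open_subspace X U"

lemma sect_Y: "sect Y V = sect X V" and resm_Y: "resm Y = resm X"
  by (simp_all add: open_subspace_def)

lemma openin_Y: "openin (gtop Y) V \<longleftrightarrow> opn V \<and> V \<subseteq> U"
  using openin_open_subtopology[OF U(1)] by (simp add: open_subspace_def)

lemma points_Y: "points Y = U"
  using openin_subset[OF U(1)] by (auto simp: open_subspace_def)

lemma openin_Spec_iff:
  "openin (gtop (Spec M)) V \<longleftrightarrow> (\<exists>I. mo_ideal M I \<and> V = {P. mo_prime M P \<and> \<not> I \<subseteq> P})"
  using istopology_Spec[OF M] by (simp add: Spec_def Spec_top_def)

lemma points_Spec_prime: "P \<in> points (Spec M) \<Longrightarrow> mo_prime M P"
  using openin_topspace[of "gtop (Spec M)"] unfolding openin_Spec_iff by auto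

definition P where "P = fst f x"

lemma f_points: "y \<in> U \<Longrightarrow> fst f y \<in> points (Spec M)"
  using f points_Y by (auto simp: gmor_def continuous_map_def)

lemma g_f: "y \<in> U \<Longrightarrow> fst g (fst f y) = y"
proof -
  assume y: "y \<in> U"
  have "fst (gcomp Y (Spec M) Y g f) y = fst (gid Y) y" by (simp add: gf)
  then show ?thesis using y by (simp add: gcomp_def gid_def points_Y compose_def)
qed

lemma P_prime: "mo_prime M P"
  unfolding P_def using points_Spec_prime f_points U by blast

lemma preim_g_open:
  assumes "opn V" "V \<subseteq> U"
  shows "openin (gtop (Spec M)) (preim (Spec M) (fst g) V)"
proof -
  have "openin (gtop Y) V" using assms by (simp add: openin_Y)
  then show ?thesis
    using g unfolding gmor_def continuous_map_def preim_def by auto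
qed

lemma P_in_preim: "x \<in> V \<Longrightarrow> P \<in> preim (Spec M) (fst g) V"
  using f_points[OF U(2)] g_f[OF U(2)] by (simp add: preim_def P_def)

lemma preim_f_open:
  assumes "openin (gtop (Spec M)) W"
  shows "opn (preim Y (fst f) W)" "preim Y (fst f) W \<subseteq> U" "openin (gtop Y) (preim Y (fst f) W)"
proof -
  show o: "openin (gtop Y) (preim Y (fst f) W)"
    using f assms unfolding gmor_def continuous_map_def preim_def by auto
  show "opn (preim Y (fst f) W)" "preim Y (fst f) W \<subseteq> U" using o by (simp_all add: openin_Y)
qed

lemma f_closed:
  assumes "openin (gtop (Spec M)) W" "\<sigma> \<in> carrier (sect (Spec M) W)"
  shows "snd f W \<sigma> \<in> carrier (sect X (preim Y (fst f) W))"
proof -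
  have "snd f W \<in> mo_hom (sect (Spec M) W) (sect Y (preim Y (fst f) W))"
    using f assms(1) by (simp add: gmor_def)
  then show ?thesis using assms(2) by (auto simp: mo_hom_def hom_def sect_Y)
qed

lemma f_res:
  assumes "openin (gtop (Spec M)) W" "openin (gtop (Spec M)) W'" "W' \<subseteq> W" "\<sigma> \<in> carrier (sect (Spec M) W)"
  shows "snd f W' (restrict \<sigma> W') = resm X (preim Y (fst f) W) (preim Y (fst f) W') (snd f W \<sigma>)"
proof -
  have "snd f W' (resm (Spec M) W W' \<sigma>) = resm Y (preim Y (fst f) W) (preim Y (fst f) W') (snd f W \<sigma>)"
    using f assms by (simp add: gmor_def)
  then show ?thesis by (simp add: Spec_def resm_Y)
qed

text \<open>A unit 0 forces 0 = 1 in the stalk, hence already in the sections over some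
  neighbourhood of \<open>x\<close>. Moving this by \<open>g\<close> to \<open>Spec M\<close> and
  evaluating at \<open>P\<close> gives 1/1 = 0/1 in the localization, so some \<open>u\<close>
  outside \<open>P\<close> equals \<open>u\<close> times 0, that is 0, which lies in
  \<open>P\<close>.\<close>

lemma zero_not_unit: "azero (stalk X x) \<notin> Units (stalk X x)"
proof
  have x: "x \<in> points X" using U openin_subset by blast
  interpret S: comm_monoid "stalk X x" using stalk_is_mo[OF x] by (simp add: is_mo_def)
  interpret M: comm_monoid M using M by (simp add: is_mo_def)
  assume "azero (stalk X x) \<in> Units (stalk X x)"
  then obtain c where "c \<in> carrier (stalk X x)" "azero (stalk X x) \<otimes>\<^bsub>stalk X x\<^esub> c = \<one>\<^bsub>stalk X x\<^esub>"
    unfolding Units_def by auto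
  then have "\<one>\<^bsub>stalk X x\<^esub> = azero (stalk X x)" using stalk_is_mo[OF x] by (simp add: is_mo_def)
  then have "germ X x U \<one>\<^bsub>sect X U\<^esub> = germ X x U (azero (sect X U))"
    by (simp add: stalk_one[OF U] stalk_zero[OF U])
  then obtain W where W: "opn W" "x \<in> W" "W \<subseteq> U" "resm X U W \<one>\<^bsub>sect X U\<^esub> = resm X U W (azero (sect X U))"
    using germ_eqD[OF U sect_one_closed[OF U(1)]] by metis
  then have eq: "\<one>\<^bsub>sect X W\<^esub> = azero (sect X W)" using U by (simp add: res_one res_zero)
  let ?W = "preim (Spec M) (fst g) W"
  have "snd g W \<in> mo_hom (sect Y W) (sect (Spec M) ?W)"
    using g W by (simp add: gmor_def openin_Y)
  then have "\<one>\<^bsub>sect (Spec M) ?W\<^esub> = azero (sect (Spec M) ?W)"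
    using eq by (auto simp: mo_hom_def sect_Y)
  then have "\<one>\<^bsub>sect (Spec M) ?W\<^esub> P = azero (sect (Spec M) ?W) P" by simp
  then have fr: "frac M P \<one>\<^bsub>M\<^esub> \<one>\<^bsub>M\<^esub> = frac M P (azero M) \<one>\<^bsub>M\<^esub>"
    using P_in_preim[OF W(2)] by (simp add: Spec_def mo_loc_def)
  have z: "azero M \<in> carrier M" "azero M \<in> P" "\<one>\<^bsub>M\<^esub> \<notin> P" "\<And>u. u \<in> carrier M \<Longrightarrow> azero M \<otimes>\<^bsub>M\<^esub> u = azero M"
    using M P_prime by (auto simp: is_mo_def mo_prime_def mo_ideal_def)
  have "(azero M, \<one>\<^bsub>M\<^esub>) \<in> frac M P (azero M) \<one>\<^bsub>M\<^esub>"
    unfolding frac_def using z by auto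
  then have "(azero M, \<one>\<^bsub>M\<^esub>) \<in> frac M P \<one>\<^bsub>M\<^esub> \<one>\<^bsub>M\<^esub>" by (simp add: fr)
  then obtain u where u: "u \<in> carrier M" "u \<notin> P" "u = u \<otimes>\<^bsub>M\<^esub> azero M"
    unfolding frac_def using z by auto
  then have "u = azero M" using z M.m_comm[of u "azero M"] by simp
  then show False using u z by simp
qed

definition fsec :: "'a set set \<Rightarrow> 'a \<times> 'a \<Rightarrow> 'a set \<Rightarrow> ('a \<times> 'a) set" where
  "fsec W c = restrict (\<lambda>Q. frac M Q (fst c) (snd c)) W"

text \<open>The pair \<open>c\<close> is a numerator and a denominator of a fraction that is valid
  near \<open>P\<close> and that \<open>f\<close> carries to the germ \<open>A\<close>. A germ may
  have many codes but a code has one germ, so a choice of codes bounds the size of the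
  stalk.\<close>

definition code :: "('p set \<times> 's) set \<Rightarrow> 'a \<times> 'a \<Rightarrow> bool" where
  "code A c \<longleftrightarrow> (\<exists>W. openin (gtop (Spec M)) W \<and> P \<in> W \<and> fst c \<in> carrier M \<and> snd c \<in> carrier M \<and>
     (\<forall>Q\<in>W. snd c \<notin> Q) \<and> A = germ X x (preim Y (fst f) W) (snd f W (fsec W c)))"

lemma fsec_closed:
  assumes "openin (gtop (Spec M)) W" "fst c \<in> carrier M" "snd c \<in> carrier M" "\<forall>Q\<in>W. snd c \<notin> Q"
  shows "fsec W c \<in> carrier (sect (Spec M) W)"
proof -
  have "fsec W c Q \<in> carrier (mo_loc M Q)" if "Q \<in> W" for Q
    using assms that by (auto simp: fsec_def mo_loc_def)
  moreover have "\<forall>Q\<in>W. snd c \<notin> Q \<and> fsec W c Q = frac M Q (fst c) (snd c)"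
    using assms by (simp add: fsec_def)
  moreover have "openin (Spec_top M) W" using assms(1) by (simp add: Spec_def)
  moreover have "fsec W c \<in> extensional W" by (simp add: fsec_def)
  ultimately have "fsec W c \<in> Spec_sections M W"
    unfolding Spec_sections_def using assms(2,3) by (auto simp: PiE_iff)
  then show ?thesis by (simp add: Spec_def)
qed

lemma x_in_preim_f: "P \<in> W \<Longrightarrow> x \<in> preim Y (fst f) W"
  using U(2) points_Y by (simp add: preim_def P_def)

text \<open>The neighbourhoods belonging to the two codes may differ, but on their intersection both
  germs come from the same fraction.\<close>

lemma code_inject:
  assumes "code A c" "code B c"
  shows "A = B"
proof -
  obtain W where W: "openin (gtop (Spec M)) W" "P \<in> W" "fst c \<in> carrier M" "snd c \<in> carrier M"
     "\<forall>Q\<in>W. snd c \<notin> Q" "A = germ X x (preim Y (fst f) W) (snd f W (fsec W c))"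
    using assms(1) unfolding code_def by blast
  obtain W' where W': "openin (gtop (Spec M)) W'" "P \<in> W'"
     "\<forall>Q\<in>W'. snd c \<notin> Q" "B = germ X x (preim Y (fst f) W') (snd f W' (fsec W' c))"
    using assms(2) unfolding code_def by blast
  let ?V = "W \<inter> W'"
  have V: "openin (gtop (Spec M)) ?V" "P \<in> ?V" using W W' by auto
  have shrink: "germ X x (preim Y (fst f) O') (snd f O' (fsec O' c)) =
      germ X x (preim Y (fst f) ?V) (snd f ?V (fsec ?V c))"
    if O': "openin (gtop (Spec M)) O'" "\<forall>Q\<in>O'. snd c \<notin> Q" "?V \<subseteq> O'" for O'
  proof -
    have c: "fsec O' c \<in> carrier (sect (Spec M) O')" using fsec_closed O' W by blast
    have "restrict (fsec O' c) ?V = fsec ?V c"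
      using O'(3) by (intro ext) (auto simp: fsec_def restrict_def)
    then have "snd f ?V (fsec ?V c) =
        resm X (preim Y (fst f) O') (preim Y (fst f) ?V) (snd f O' (fsec O' c))"
      using f_res[OF O'(1) V(1) O'(3) c] by simp
    moreover have "preim Y (fst f) ?V \<subseteq> preim Y (fst f) O'" using O'(3) by (auto simp: preim_def)
    ultimately show ?thesis
      using germ_res preim_f_open O'(1) V x_in_preim_f f_closed[OF O'(1) c] by simp
  qed
  show ?thesis using shrink[OF W(1,5)] shrink[OF W'(1,3)] W W' by simp
qed

text \<open>Moved by \<open>g\<close> to \<open>Spec M\<close>, a section representing the germ is a
  single fraction near \<open>P\<close>, by the definition of \<open>Spec_sections\<close>. The
  relation \<open>gf\<close> ensures that \<open>f\<close> brings this section back to the original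
  one.\<close>

lemma code_exists:
  assumes A: "A \<in> carrier (stalk X x)"
  shows "\<exists>c. code A c"
proof -
  obtain V t where V: "opn V" "x \<in> V" "t \<in> carrier (sect X V)" "A = germ X x V t"
    using A by (rule stalk_carrierE)
  define V' where "V' = V \<inter> U"
  define t' where "t' = resm X V V' t"
  have V': "opn V'" "x \<in> V'" "V' \<subseteq> V" "V' \<subseteq> U" using V U by (auto simp: V'_def)
  have t': "t' \<in> carrier (sect X V')" using V V' by (simp add: t'_def res_closed)
  have A': "A = germ X x V' t'" using V V' by (simp add: t'_def germ_res)
  define W0 where "W0 = preim (Spec M) (fst g) V'"
  define \<sigma> where "\<sigma> = snd g V' t'"
  have W0: "openin (gtop (Spec M)) W0" "P \<in> W0"
    using V' by (simp_all add: W0_def preim_g_open P_in_preim)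
  have oY: "openin (gtop Y) V'" using V' by (simp add: openin_Y)
  have "snd g V' \<in> mo_hom (sect Y V') (sect (Spec M) W0)"
    using g oY by (simp add: gmor_def W0_def)
  then have \<sigma>: "\<sigma> \<in> carrier (sect (Spec M) W0)"
    using t' by (auto simp: \<sigma>_def mo_hom_def hom_def sect_Y)
  have "snd (gcomp Y (Spec M) Y g f) V' t' = snd (gid Y) V' t'" by (simp add: gf)
  then have f\<sigma>: "snd f W0 \<sigma> = t'"
    using oY t' by (simp add: gcomp_def gid_def compose_def sect_Y W0_def \<sigma>_def)
  have pre: "preim Y (fst f) W0 = V'"
    using f_points g_f V'(4) unfolding preim_def W0_def points_Y by auto
  have "\<sigma> \<in> Spec_sections M W0" using \<sigma> by (simp add: Spec_def)
  then obtain W a s where W: "openin (Spec_top M) W" "P \<in> W" "W \<subseteq> W0" "a \<in> carrier M" "s \<in> carrier M"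
    "\<forall>Q\<in>W. s \<notin> Q \<and> \<sigma> Q = frac M Q a s"
    using W0(2) unfolding Spec_sections_def by blast
  have oW: "openin (gtop (Spec M)) W" using W by (simp add: Spec_def)
  have "restrict \<sigma> W = fsec W (a, s)"
    unfolding fsec_def by (rule restrict_ext) (use W in simp)
  then have eq: "snd f W (fsec W (a, s)) = resm X V' (preim Y (fst f) W) t'"
    using f_res[OF W0(1) oW W(3) \<sigma>] by (simp add: f\<sigma> pre)
  have "preim Y (fst f) W \<subseteq> V'" unfolding pre[symmetric] using W(3) by (auto simp: preim_def)
  then have "A = germ X x (preim Y (fst f) W) (snd f W (fsec W (a, s)))"
    using A' eq germ_res[OF V'(1) preim_f_open(1)[OF oW] x_in_preim_f[OF W(2)] _ t'] by simp
  then have "code A (a, s)"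
    unfolding code_def using oW W by auto
  then show ?thesis by blast
qed

lemma stalk_inject: "\<exists>c :: _ \<Rightarrow> 'a \<times> 'a. inj_on c (carrier (stalk X x))"
proof -
  have "inj_on (\<lambda>A. SOME c. code A c) (carrier (stalk X x))"
  proof (rule inj_onI)
    fix A B assume "A \<in> carrier (stalk X x)" "B \<in> carrier (stalk X x)"
    then have "code A (SOME c. code A c)" "code B (SOME c. code B c)"
      using code_exists by (auto intro: someI_ex)
    moreover assume "(SOME c. code A c) = (SOME c. code B c)"
    ultimately show "A = B" using code_inject by metis
  qed
  then show ?thesis by blast
qed

end

lemma geometric_mo_scheme_stalk:
  fixes X :: "('p, 's) gspace"
  assumes X: "geometric_mo_scheme TYPE('a) X" and x: "x \<in> points X"
  shows "azero (stalk X x) \<notin> Units (stalk X x)"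
    and "\<exists>c :: _ \<Rightarrow> 'a \<times> 'a. inj_on c (carrier (stalk X x))"
proof -
  obtain U and M :: "'a mo" where "openin (gtop X) U" "x \<in> U" "is_mo M"
    "gspace_isomorphic (open_subspace X U) (Spec M)"
    using X x unfolding geometric_mo_scheme_def by blast
  then obtain f g where "geom_chart X U M x f g"
    using X unfolding gspace_isomorphic_def geometric_mo_scheme_def geom_chart_def geom_space_def
      geom_chart_axioms_def by blast
  then interpret geom_chart X U M x f g .
  show "azero (stalk X x) \<notin> Units (stalk X x)" by (rule zero_not_unit)
  show "\<exists>c :: _ \<Rightarrow> 'a \<times> 'a. inj_on c (carrier (stalk X x))" by (rule stalk_inject)
qed

section \<open>Counting points of a Noetherian scheme\<close>

lemma mo_isomorphic_F1:
  assumes M: "is_mo M" and H: "comm_group H" and iso: "mo_isomorphic M (F1 H)"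
  shows "mo_field M"
    and "\<exists>\<theta>\<in>hom H (units_of M). bij_betw \<theta> (carrier H) (Units M)"
proof -
  interpret M: comm_monoid M using M by (simp add: is_mo_def)
  interpret H: comm_group H by (rule H)
  obtain f where f: "f \<in> mo_hom M (F1 H)" "bij_betw f (carrier M) (carrier (F1 H))"
    using iso unfolding mo_isomorphic_def by blast
  have inj: "m = n" if "f m = f n" "m \<in> carrier M" "n \<in> carrier M" for m n
    using f(2) that by (auto simp: bij_betw_def inj_on_def)
  have f1: "f \<one>\<^bsub>M\<^esub> = Some \<one>\<^bsub>H\<^esub>" and f0: "f (azero M) = None" using f by (auto simp: mo_hom_def F1_def)
  have fm: "f (m \<otimes>\<^bsub>M\<^esub> n) = f m \<otimes>\<^bsub>F1 H\<^esub> f n" if "m \<in> carrier M" "n \<in> carrier M" for m n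
    using f that by (auto simp: mo_hom_def hom_def)
  have z: "azero M \<in> carrier M" "\<And>m. m \<in> carrier M \<Longrightarrow> azero M \<otimes>\<^bsub>M\<^esub> m = azero M"
    using M by (auto simp: is_mo_def)
  define \<theta> where "\<theta> a = the_inv_into (carrier M) f (Some a)" for a
  have \<theta>: "\<theta> a \<in> carrier M" "f (\<theta> a) = Some a" if "a \<in> carrier H" for a
  proof -
    have a: "Some a \<in> carrier (F1 H)" using that by (simp add: F1_def)
    have "f ` carrier M = carrier (F1 H)" using f(2) by (simp add: bij_betw_def)
    then show "\<theta> a \<in> carrier M" "f (\<theta> a) = Some a"
      using f(2) a by (auto simp: \<theta>_def bij_betw_def intro!: the_inv_into_into f_the_inv_into_f)
  qed
  have \<theta>m: "\<theta> (a \<otimes>\<^bsub>H\<^esub> b) = \<theta> a \<otimes>\<^bsub>M\<^esub> \<theta> b" if "a \<in> carrier H" "b \<in> carrier H" for a b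
    by (rule inj) (use that \<theta> in \<open>simp_all add: fm F1_def\<close>)
  have \<theta>1: "\<theta> \<one>\<^bsub>H\<^esub> = \<one>\<^bsub>M\<^esub>" by (rule inj) (simp_all add: \<theta> f1)
  have \<theta>U: "\<theta> a \<in> Units M" if a: "a \<in> carrier H" for a
  proof -
    have "\<theta> a \<otimes>\<^bsub>M\<^esub> \<theta> (inv\<^bsub>H\<^esub> a) = \<one>\<^bsub>M\<^esub>" "\<theta> (inv\<^bsub>H\<^esub> a) \<otimes>\<^bsub>M\<^esub> \<theta> a = \<one>\<^bsub>M\<^esub>"
      using a by (simp_all add: \<theta>m[symmetric] \<theta>1)
    moreover have "\<theta> (inv\<^bsub>H\<^esub> a) \<in> carrier M" using a by (simp add: \<theta>)
    ultimately show ?thesis using \<theta>(1)[OF a] unfolding Units_def by blast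
  qed
  have zU: "azero M \<notin> Units M"
  proof
    assume "azero M \<in> Units M"
    then obtain c where "c \<in> carrier M" "azero M \<otimes>\<^bsub>M\<^esub> c = \<one>\<^bsub>M\<^esub>" unfolding Units_def by auto
    then have "f \<one>\<^bsub>M\<^esub> = f (azero M)" using z by simp
    then show False by (simp add: f0 f1)
  qed
  have surj: "\<exists>a\<in>carrier H. m = \<theta> a" if m: "m \<in> carrier M" "m \<noteq> azero M" for m
  proof -
    have "f m \<in> carrier (F1 H)" using f(2) m by (auto simp: bij_betw_def)
    moreover have "f m \<noteq> None" using inj[OF _ m(1) z(1)] m(2) f0 by auto
    ultimately obtain a where a: "a \<in> carrier H" "f m = Some a" by (auto simp: F1_def)
    then have "m = \<theta> a" using inj m \<theta> by simp
    then show ?thesis using a by blast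
  qed
  show "mo_field M"
    unfolding mo_field_def using M \<theta>U zU surj M.Units_closed by blast
  show "\<exists>\<theta>\<in>hom H (units_of M). bij_betw \<theta> (carrier H) (Units M)"
  proof (intro bexI[of _ \<theta>])
    show "bij_betw \<theta> (carrier H) (Units M)"
      unfolding bij_betw_def
    proof
      show "inj_on \<theta> (carrier H)" by (rule inj_onI) (metis \<theta>(2) option.inject)
      show "\<theta> ` carrier H = Units M" using \<theta>U surj zU M.Units_closed by blast
    qed
    show "\<theta> \<in> hom H (units_of M)"
      by (rule homI) (simp_all add: units_of_carrier units_of_mult \<theta>U \<theta>m)
  qed
qed

lemma (in mo_fld) mo_isomorphic_F1_units: "mo_isomorphic N (F1 (units_of N))"
proof -
  define f where "f = restrict (\<lambda>a. if a = azero N then None else Some a) (carrier N)"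
  have "f \<in> mo_hom N (F1 (units_of N))"
    unfolding mo_hom_def
    by (auto simp: f_def F1_def units_of_def Units_eq mult_eq_zero_iff intro!: homI)
  moreover have "bij_betw f (carrier N) (carrier (F1 (units_of N)))"
    unfolding bij_betw_def
    by (auto simp: f_def F1_def units_of_def Units_eq inj_on_def image_iff split: if_splits)
  ultimately show ?thesis unfolding mo_isomorphic_def by blast
qed

text \<open>The counterpart of F_1[K] inside F_1[H] for a subgroup K of H. The inclusion is the
  morphism along which the tautological point of a stalk will be shown to descend.\<close>

lemma (in mo_fld) mo_field_subgroup:
  assumes K: "subgroup K (units_of N)"
  shows "mo_field (N\<lparr>carrier := insert (azero N) K\<rparr>)"
    and "Units (N\<lparr>carrier := insert (azero N) K\<rparr>) = K"
    and "restrict (\<lambda>a. a) (insert (azero N) K) \<in> mo_hom (N\<lparr>carrier := insert (azero N) K\<rparr>) N"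
proof -
  let ?N = "N\<lparr>carrier := insert (azero N) K\<rparr>"
  have KU: "K \<subseteq> Units N" using subgroup.subset[OF K] by (simp add: units_of_carrier)
  have Kc: "k \<in> carrier N" if "k \<in> K" for k using KU that by auto
  have K1: "\<one> \<in> K" using subgroup.one_closed[OF K] by (simp add: units_of_one)
  have Km: "a \<otimes> b \<in> K" if "a \<in> K" "b \<in> K" for a b
    using subgroup.m_closed[OF K that] by (simp add: units_of_mult)
  have Ki: "inv a \<in> K" if "a \<in> K" for a
    using subgroup.m_inv_closed[OF K that] KU that by (simp add: units_of_inv subset_iff)
  have "comm_monoid ?N"
  proof (rule comm_monoidI)
    fix x y z assume "x \<in> carrier ?N" "y \<in> carrier ?N" "z \<in> carrier ?N"
    then show "x \<otimes>\<^bsub>?N\<^esub> y \<otimes>\<^bsub>?N\<^esub> z = x \<otimes>\<^bsub>?N\<^esub> (y \<otimes>\<^bsub>?N\<^esub> z)" using Kc by (auto simp: m_assoc)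
  next
    fix x y assume "x \<in> carrier ?N" "y \<in> carrier ?N"
    then show "x \<otimes>\<^bsub>?N\<^esub> y = y \<otimes>\<^bsub>?N\<^esub> x" using Kc by (auto simp: m_comm)
  next
    fix x y assume "x \<in> carrier ?N" "y \<in> carrier ?N"
    then show "x \<otimes>\<^bsub>?N\<^esub> y \<in> carrier ?N" using Kc Km by auto
  qed (use K1 Kc in auto)
  then have mo: "is_mo ?N" using Kc by (auto simp: is_mo_def)
  show U: "Units ?N = K"
  proof (intro subset_antisym subsetI)
    fix a assume "a \<in> Units ?N"
    then obtain b where ab: "a \<in> insert (azero N) K" "b \<in> insert (azero N) K" "a \<otimes> b = \<one>"
      unfolding Units_def by auto
    have "a \<noteq> azero N" using ab Kc one_neq_zero one_neq_zero[symmetric] by auto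
    then show "a \<in> K" using ab by simp
  next
    fix a assume a: "a \<in> K"
    then have "a \<otimes> inv a = \<one>" "inv a \<otimes> a = \<one>" using KU by auto
    then show "a \<in> Units ?N" unfolding Units_def using a Ki by auto
  qed
  have "azero N \<notin> K" using KU Units_eq by auto
  then show "mo_field ?N" unfolding mo_field_def using mo U by auto
  show "restrict (\<lambda>a. a) (insert (azero N) K) \<in> mo_hom ?N N"
    unfolding mo_hom_def using Kc K1 Km by (auto intro!: homI)
qed

text \<open>Makes the count over F_1[H] applicable to fields, with H the nonzero elements.\<close>

lemma mo_field_beta_star:
  assumes "field K"
  shows "mo_field (beta_star K)" and "Units (beta_star K) = carrier K - {\<zero>\<^bsub>K\<^esub>}"
proof -
  interpret K: field K by fact
  have "comm_monoid (beta_star K)"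
    by (rule comm_monoidI) (auto simp: beta_star_def K.m_ac)
  then have mo: "is_mo (beta_star K)" by (auto simp: is_mo_def beta_star_def)
  show U: "Units (beta_star K) = carrier K - {\<zero>\<^bsub>K\<^esub>}"
    using K.field_Units by (simp add: Units_def beta_star_def)
  show "mo_field (beta_star K)"
    unfolding mo_field_def U using mo by (simp add: beta_star_def)
qed

lemma (in group) generate_bij_hom:
  assumes H: "group H" and \<theta>: "\<theta> \<in> hom G H" "bij_betw \<theta> (carrier G) (carrier H)"
    and B: "B \<subseteq> carrier H" "generate H B = carrier H"
  shows "generate G (inv_into (carrier G) \<theta> ` B) = carrier G"
proof -
  interpret H: group H by (rule H)
  let ?i = "inv_into (carrier G) \<theta>"
  have "?i \<in> iso H G" using \<theta> by (intro iso_set_sym) (simp add: iso_def)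
  then have i: "?i \<in> hom H G" by (simp add: iso_def)
  interpret i: group_hom H G ?i using i by unfold_locales
  have "generate G (?i ` B) = ?i ` carrier H"
    using i.generate_img[OF B(1)] B(2) by simp
  also have "\<dots> = carrier G"
    using bij_betw_inv_into[OF \<theta>(2)] by (simp add: bij_betw_def)
  finally show ?thesis .
qed

section \<open>Finiteness of the realization and the number of its points\<close>

locale realization =
  fixes F :: "('a, 'b) mo_functor" and X :: "('p, 's) gspace"
  assumes inf: "infinite (UNIV :: 'a set)"
    and noeth: "noetherian_mo_scheme F"
    and real: "geometric_realization F X"
begin

lemma geom_space: "geom_space X" and scheme: "geometric_mo_scheme TYPE('a) X"
  using real by (auto simp: geometric_realization_def geometric_mo_scheme_def geom_space_def)

lemma spec_points:
  assumes "mo_field N"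
  shows "spec_points X (N :: 'a mo)"
  using geom_space geometric_mo_scheme_stalk(1)[OF scheme] assms
  by (simp add: spec_points_def spec_points_axioms_def mo_fld_def)

text \<open>An open cover is only required to be exhaustive on copies of F_1[H]. Here
  \<open>N\<close> is such a copy with H = \<open>units_of N\<close>, so the point lies in one of
  the charts and is given there by a homomorphism from a Noetherian monoid.\<close>

lemma chart_of_point:
  assumes N: "mo_field N" and \<xi>: "\<xi> \<in> Fob F N"
  obtains G M \<zeta> \<psi> where "is_subfunctor Mo F G" "noetherian_mo M"
    "nat_trans Mo (hom_functor Mo M) (F\<lparr>Fob := G\<rparr>) \<zeta>" "\<psi> \<in> mo_hom M N" "\<xi> = \<zeta> N \<psi>"
proof -
  interpret N: mo_fld N by (simp add: mo_fld_def N)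
  obtain \<G> where cov: "mo_open_cover F \<G>"
    and rep: "\<And>G. G \<in> \<G> \<Longrightarrow> \<exists>M. noetherian_mo M \<and> nat_iso Mo (hom_functor Mo M) (F\<lparr>Fob := G\<rparr>)"
    using noeth unfolding noetherian_mo_scheme_def by blast
  have "Fob F N = (\<Union>G\<in>\<G>. G N)"
    using cov[unfolded mo_open_cover_def, THEN conjunct2, rule_format, of "units_of N" N]
      N.units_comm_group N.is_mo N.mo_isomorphic_F1_units by simp
  then obtain G where G: "G \<in> \<G>" "\<xi> \<in> G N" using \<xi> by blast
  obtain M where M: "noetherian_mo M" "nat_iso Mo (hom_functor Mo M) (F\<lparr>Fob := G\<rparr>)"
    using rep[OF G(1)] by blast
  then obtain \<zeta> where \<zeta>: "nat_trans Mo (hom_functor Mo M) (F\<lparr>Fob := G\<rparr>) \<zeta>"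
    "\<And>x. x \<in> Ob Mo \<Longrightarrow> bij_betw (\<zeta> x) (Fob (hom_functor Mo M) x) (G x)"
    unfolding nat_iso_def by auto
  have "bij_betw (\<zeta> N) (mo_hom M N) (G N)"
    using \<zeta>(2)[of N] N.is_mo by (simp add: Mo_def hom_functor_def)
  then obtain \<psi> where "\<psi> \<in> mo_hom M N" "\<xi> = \<zeta> N \<psi>" using G(2) by (auto simp: bij_betw_def)
  moreover have "is_subfunctor Mo F G"
    using cov G by (simp add: mo_open_cover_def mo_open_subfunctor_def)
  ultimately show ?thesis using that M \<zeta> by blast
qed

lemma finite_Fob_two_elements:
  assumes N: "mo_field N" "Units N = {\<one>\<^bsub>N\<^esub>}"
  shows "finite (Fob F N)"
proof -
  interpret N: mo_fld N by (simp add: mo_fld_def N)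
  obtain \<G> where fin: "finite \<G>" and cov: "mo_open_cover F \<G>"
    and rep: "\<And>G. G \<in> \<G> \<Longrightarrow> \<exists>M. noetherian_mo M \<and> nat_iso Mo (hom_functor Mo M) (F\<lparr>Fob := G\<rparr>)"
    using noeth unfolding noetherian_mo_scheme_def by blast
  have eq: "Fob F N = (\<Union>G\<in>\<G>. G N)"
    using cov[unfolded mo_open_cover_def, THEN conjunct2, rule_format, of "units_of N" N]
      N.units_comm_group N.is_mo N.mo_isomorphic_F1_units by simp
  have "finite (G N)" if G: "G \<in> \<G>" for G
  proof -
    obtain M where M: "noetherian_mo M" "nat_iso Mo (hom_functor Mo M) (F\<lparr>Fob := G\<rparr>)"
      using rep[OF G] by blast
    then obtain \<zeta> where "\<And>x. x \<in> Ob Mo \<Longrightarrow> bij_betw (\<zeta> x) (Fob (hom_functor Mo M) x) (G x)"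
      unfolding nat_iso_def by auto
    then have "bij_betw (\<zeta> N) (mo_hom M N) (G N)"
      using N.is_mo by (simp add: Mo_def hom_functor_def)
    moreover have "carrier N = insert (azero N) (Units N)"
      by (simp add: N.Units_eq insert_absorb)
    then have "carrier N = {\<one>\<^bsub>N\<^esub>, azero N}" by (simp add: N(2) insert_commute)
    then have "finite (mo_hom M N)"
      by (intro finite_mo_hom_two_elements[OF M(1) N.is_mo])
    ultimately show ?thesis using bij_betw_finite by blast
  qed
  then show ?thesis using eq fin by simp
qed

lemma nat_iso_gmor:
  obtains \<eta> where "nat_trans Mo F (points_functor X) \<eta>"
    "\<And>N. is_mo N \<Longrightarrow> bij_betw (\<eta> N) (Fob F N) (gmor (Spec N) X)"
  using real unfolding geometric_realization_def nat_iso_def by (auto simp: Mo_def points_functor_def)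

lemma Fob_bij_homs:
  assumes N: "mo_field N"
  shows "\<exists>\<phi>. bij_betw \<phi> (Fob F N) (SIGMA x:points X. hom (units_of (stalk X x)) (units_of N) \<inter>
    extensional (carrier (units_of (stalk X x))))"
proof -
  interpret spec_points X N by (rule spec_points[OF N])
  obtain \<eta> where "\<And>N. is_mo N \<Longrightarrow> bij_betw (\<eta> N) (Fob F N) (gmor (Spec N) X)"
    using nat_iso_gmor by blast
  then have "bij_betw (\<eta> N) (Fob F N) (gmor (Spec N) X)" using is_mo by blast
  then show ?thesis using bij_betw_trans[OF _ bij_betw_inv_into[OF bij_betw_\<Psi>]] by blast
qed

lemma finite_points: "finite (points X)"
proof -
  obtain N :: "'a mo" where N: "is_mo N" "mo_isomorphic N (F1n 1)"
    using F1n_copy[OF inf, of 1] by auto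
  have H: "comm_group (integer_mod_group 1)" by (rule abelian_integer_mod_group)
  note F1 = mo_isomorphic_F1[OF N(1) H N(2)[unfolded F1n_def]]
  have mf: "mo_field N" by (rule F1(1))
  interpret spec_points X N by (rule spec_points[OF mf])
  obtain \<theta> where "bij_betw \<theta> (carrier (integer_mod_group 1)) (Units N)" using F1(2) by blast
  then have "card (Units N) = 1"
    using bij_betw_same_card by (fastforce simp: carrier_integer_mod_group)
  then obtain u where "Units N = {u}" by (auto simp: card_1_singleton_iff)
  then have U: "Units N = {\<one>\<^bsub>N\<^esub>}" using Units_one_closed by (metis singletonD)
  obtain \<phi> where \<phi>: "bij_betw \<phi> (Fob F N) (SIGMA x:points X. homs x)"
    using Fob_bij_homs[OF mf] by blast
  have fin: "finite (SIGMA x:points X. homs x)"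
    using bij_betw_finite[OF \<phi>] finite_Fob_two_elements[OF mf U] by simp
  have "points X \<subseteq> fst ` (SIGMA x:points X. homs x)"
  proof
    fix x assume x: "x \<in> points X"
    interpret S: comm_monoid "stalk X x" using X.stalk_is_mo[OF x] by (simp add: is_mo_def)
    interpret SU: comm_group "units_of (stalk X x)" by (rule S.units_comm_group)
    \<comment> \<open>The trivial homomorphism: no set \<open>homs x\<close> is empty, so every
      point of \<open>X\<close> is seen.\<close>
    have "restrict (\<lambda>_. \<one>\<^bsub>N\<^esub>) (carrier (units_of (stalk X x))) \<in> homs x"
      by (auto simp: units_of_carrier units_of_mult intro!: homI)
    then show "x \<in> fst ` (SIGMA x:points X. homs x)" using x by force
  qed
  then show ?thesis using fin by (meson finite_imageI finite_subset)
qed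

text \<open>
  Let \<open>N\<close> be a copy of \<open>\<F>\<^sub>1[\<O>\<^sub>x\<^sup>\<times>]\<close>. The tautological \<open>N\<close>-point at \<open>x\<close> lies in a chart, hence comes from
  a homomorphism from a Noetherian monoid to \<open>N\<close>, and so from a point over the subfield generated by
  its image. By naturality this subfield is all of \<open>N\<close>.
\<close>

lemma stalk_units_finitely_generated:
  assumes x: "x \<in> points X"
  shows "\<exists>B. finite B \<and> B \<subseteq> carrier (units_of (stalk X x)) \<and>
    generate (units_of (stalk X x)) B = carrier (units_of (stalk X x))"
proof -
  interpret X: geom_space X by (rule geom_space)
  interpret S: comm_monoid "stalk X x" using X.stalk_is_mo[OF x] by (simp add: is_mo_def)
  let ?U = "units_of (stalk X x)"
  interpret U: comm_group ?U by (rule S.units_comm_group)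
  have z: "azero (stalk X x) \<in> carrier (stalk X x)" "azero (stalk X x) \<notin> Units (stalk X x)"
    using X.stalk_is_mo[OF x] geometric_mo_scheme_stalk(1)[OF scheme x] by (auto simp: is_mo_def)
  obtain c :: "_ \<Rightarrow> 'a \<times> 'a" where c: "inj_on c (carrier (stalk X x))"
    using geometric_mo_scheme_stalk(2)[OF scheme x] by blast
  have "\<exists>d :: 'a \<times> 'a \<Rightarrow> 'a. inj d"
    using card_of_Times_same_infinite[OF inf] ordIso_iff_ordLeq card_of_ordLeq[of "UNIV \<times> UNIV :: ('a \<times> 'a) set" "UNIV :: 'a set"]
    by auto
  then obtain d :: "'a \<times> 'a \<Rightarrow> 'a" where d: "inj d" by blast
  \<comment> \<open>The added zero of \<open>F1 ?U\<close> is encoded by the zero of the stalk. It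
    collides with no unit since it is not a unit itself.\<close>
  define e where "e = (\<lambda>m. d (c (case m of None \<Rightarrow> azero (stalk X x) | Some A \<Rightarrow> A)))"
  have "inj_on e (carrier (F1 ?U))"
  proof (rule inj_onI)
    fix m n assume mn: "m \<in> carrier (F1 ?U)" "n \<in> carrier (F1 ?U)" "e m = e n"
    let ?v = "\<lambda>m. case m of None \<Rightarrow> azero (stalk X x) | Some A \<Rightarrow> A"
    have "c (?v m) = c (?v n)" using mn(3) d by (simp add: e_def inj_eq)
    moreover have "?v m \<in> carrier (stalk X x)" "?v n \<in> carrier (stalk X x)"
      using mn z by (auto simp: F1_def units_of_carrier)
    ultimately have "?v m = ?v n" using c by (simp add: inj_on_eq_iff)
    then show "m = n" using mn z(2) by (auto simp: F1_def units_of_carrier)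
  qed
  from is_mo_copy[OF is_mo_F1[OF U.comm_group_axioms] this]
  obtain N :: "'a mo" where N: "is_mo N" "mo_isomorphic N (F1 ?U)" by blast
  have mf: "mo_field N" by (rule mo_isomorphic_F1(1)[OF N(1) U.comm_group_axioms N(2)])
  obtain \<theta> where \<theta>: "\<theta> \<in> hom ?U (units_of N)" "bij_betw \<theta> (carrier ?U) (Units N)"
    using mo_isomorphic_F1(2)[OF N(1) U.comm_group_axioms N(2)] by blast
  interpret N: spec_points X N by (rule spec_points[OF mf])
  interpret NU: comm_group "units_of N" by (rule N.units_comm_group)
  \<comment> \<open>Under the identification of \<open>N\<close> with F_1[U_x] this is the identity
    of U_x. What matters below is that its image is all of \<open>Units N\<close>.\<close>
  define h where "h = restrict \<theta> (carrier ?U)"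
  have h: "h \<in> N.homs x"
    using \<theta>(1) by (auto simp: h_def hom_def)
  obtain \<eta> where \<eta>: "nat_trans Mo F (points_functor X) \<eta>"
    and \<eta>b: "\<And>N. is_mo N \<Longrightarrow> bij_betw (\<eta> N) (Fob F N) (gmor (Spec N) X)"
    using nat_iso_gmor by blast
  have "N.\<Psi> x h \<in> \<eta> N ` Fob F N"
    using \<eta>b[OF N(1)] N.\<Psi>_in_gmor[OF x h] by (simp add: bij_betw_def)
  then obtain \<xi> where \<xi>: "\<xi> \<in> Fob F N" "\<eta> N \<xi> = N.\<Psi> x h" by (metis imageE)
  obtain G M \<zeta> \<psi> where G: "is_subfunctor Mo F G" and M: "noetherian_mo M"
    and \<zeta>: "nat_trans Mo (hom_functor Mo M) (F\<lparr>Fob := G\<rparr>) \<zeta>" and \<psi>: "\<psi> \<in> mo_hom M N" "\<xi> = \<zeta> N \<psi>"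
    using chart_of_point[OF mf \<xi>(1)] by metis
  have mo: "is_mo M" using M by (simp add: noetherian_mo_def)
  interpret M: comm_monoid M using mo by (simp add: is_mo_def)
  define B where "B = \<psi> ` carrier M - {azero N}"
  \<comment> \<open>The subgroup generated by the nonzero values of \<open>\<psi>\<close>. Its
    finite generation is not yet known at this stage; it comes last, from the chain condition on
    \<open>M\<close>.\<close>
  define K where "K = generate (units_of N) B"
  have \<psi>c: "\<psi> a \<in> carrier N" if "a \<in> carrier M" for a using \<psi>(1) that by (auto simp: mo_hom_def hom_def)
  have BU: "B \<subseteq> Units N" using \<psi>c N.Units_eq by (auto simp: B_def)
  have K: "subgroup K (units_of N)"
    unfolding K_def by (rule NU.generate_is_subgroup) (use BU in \<open>simp add: units_of_carrier\<close>)
  define N' where "N' = N\<lparr>carrier := insert (azero N) K\<rparr>"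
  note sub = N.mo_field_subgroup[OF K, folded N'_def]
  interpret N': spec_points X N' by (rule spec_points[OF sub(1)])
  define i where "i = restrict (\<lambda>a. a) (insert (azero N) K)"
  have i: "i \<in> mo_hom N' N" using sub(3) by (simp add: i_def)
  have "\<psi> a \<in> carrier N'" if "a \<in> carrier M" for a
    using generate.incl[of "\<psi> a" B "units_of N"] that by (auto simp: N'_def K_def B_def)
  then have \<psi>': "\<psi> \<in> mo_hom M N'"
    using \<psi>(1) by (auto simp: mo_hom_def hom_def N'_def)
  \<comment> \<open>The homomorphism \<open>\<psi>\<close> factors through \<open>N'\<close>, so
    naturality of \<open>\<zeta>\<close> presents \<open>\<xi>\<close> as the image of an
    \<open>N'\<close>-point.\<close>
  have "compose (carrier M) i \<psi> = \<psi>"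
  proof (rule extensionalityI[of _ "carrier M"])
    fix a assume "a \<in> carrier M"
    moreover from this have "\<psi> a \<in> carrier N'" using \<psi>' by (auto simp: mo_hom_def hom_def)
    ultimately show "compose (carrier M) i \<psi> a = \<psi> a" by (simp add: compose_def i_def N'_def)
  qed (use \<psi>(1) in \<open>auto simp: mo_hom_def\<close>)
  moreover have "\<zeta> N (Fmor (hom_functor Mo M) N' N i \<psi>) = Fmor (F\<lparr>Fob := G\<rparr>) N' N i (\<zeta> N' \<psi>)"
    using \<zeta> N(1) N'.is_mo i \<psi>' unfolding nat_trans_def by (simp add: Mo_def hom_functor_def)
  ultimately have \<xi>': "\<xi> = Fmor F N' N i (\<zeta> N' \<psi>)"
    by (simp add: \<psi>(2) Mo_def hom_functor_def)
  have "\<zeta> N' \<psi> \<in> G N'"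
    using \<zeta> N'.is_mo \<psi>' unfolding nat_trans_def by (auto simp: Mo_def hom_functor_def)
  then have mem: "\<zeta> N' \<psi> \<in> Fob F N'"
    using G N'.is_mo by (auto simp: is_subfunctor_def Mo_def)
  then have "\<eta> N' (\<zeta> N' \<psi>) \<in> gmor (Spec N') X"
    using \<eta>b[OF N'.is_mo] by (auto simp: bij_betw_def)
  then obtain y k where y: "y \<in> points X" "k \<in> N'.homs y" "\<eta> N' (\<zeta> N' \<psi>) = N'.\<Psi> y k"
    using N'.gmor_eq_\<Psi> by blast
  have "\<eta> N \<xi> = Fmor (points_functor X) N' N i (\<eta> N' (\<zeta> N' \<psi>))"
    using \<eta> N(1) N'.is_mo i mem unfolding nat_trans_def \<xi>' by (simp add: Mo_def)
  also have "\<dots> = gcomp (Spec N) (Spec N') X (N'.\<Psi> y k) (Spec_map N' N i)"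
    by (simp add: points_functor_def y)
  also have "\<dots> = N.\<Psi> y (restrict (\<lambda>A. i (k A)) (Units (stalk X y)))"
    by (rule N'.gcomp_Spec_map[OF _ i y(1,2)]) unfold_locales
  finally have eq: "N.\<Psi> x h = N.\<Psi> y (restrict (\<lambda>A. i (k A)) (Units (stalk X y)))"
    using \<xi>(2) by simp
  have ik: "i (k A) = k A \<and> k A \<in> K" if "A \<in> Units (stalk X y)" for A
  proof -
    have "k A \<in> Units N'" using y(2) that by (auto simp: hom_def units_of_carrier)
    then show ?thesis using sub(2) by (simp add: i_def)
  qed
  have "restrict (\<lambda>A. i (k A)) (Units (stalk X y)) \<in> N.homs y"
  proof -
    interpret Sy: comm_monoid "stalk X y" using X.stalk_is_mo[OF y(1)] by (simp add: is_mo_def)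
    have KU: "K \<subseteq> Units N" using subgroup.subset[OF K] by (simp add: units_of_carrier)
    have "k (A \<otimes>\<^bsub>stalk X y\<^esub> A') = k A \<otimes>\<^bsub>N\<^esub> k A'" if "A \<in> Units (stalk X y)" "A' \<in> Units (stalk X y)" for A A'
      using y(2) that by (auto simp: hom_def units_of_carrier units_of_mult N'_def)
    moreover have "restrict (\<lambda>A. i (k A)) (Units (stalk X y)) = restrict k (Units (stalk X y))"
      by (rule restrict_ext) (simp add: ik)
    moreover have "k A \<in> Units N" if "A \<in> Units (stalk X y)" for A using ik[OF that] KU by auto
    ultimately show ?thesis
      by (auto simp: units_of_carrier units_of_mult intro!: homI)
  qed
  from N.\<Psi>_inject[OF x h y(1) this eq]
  have xy: "x = y" "h = restrict (\<lambda>A. i (k A)) (Units (stalk X y))" by auto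
  \<comment> \<open>By uniqueness of the pair describing a morphism, \<open>h\<close> equals
    \<open>k\<close> followed by the inclusion, so its values lie in \<open>K\<close>; but
    \<open>h\<close> is onto \<open>Units N\<close>.\<close>
  have UK: "Units N \<subseteq> K"
  proof
    fix u assume "u \<in> Units N"
    then obtain A where A: "A \<in> Units (stalk X x)" "u = \<theta> A"
      using \<theta>(2) by (auto simp: bij_betw_def units_of_carrier)
    then have "u = h A" by (simp add: h_def units_of_carrier)
    then show "u \<in> K" using A(1) ik xy by simp
  qed
  \<comment> \<open>Elements of the subgroup generated by values of \<open>\<psi>\<close> are
    quotients of two such values, because values of \<open>\<psi>\<close> are closed under products
    and contain 1.\<close>
  have gen: "\<exists>a\<in>carrier M. \<exists>b\<in>carrier M. \<psi> b \<in> Units N \<and> \<psi> a = u \<otimes>\<^bsub>N\<^esub> \<psi> b" if "u \<in> Units N" for u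
  proof -
    have \<psi>1: "\<psi> \<one>\<^bsub>M\<^esub> = \<one>\<^bsub>N\<^esub>" using \<psi>(1) by (simp add: mo_hom_def)
    have \<psi>m: "\<psi> (a \<otimes>\<^bsub>M\<^esub> b) = \<psi> a \<otimes>\<^bsub>N\<^esub> \<psi> b" if "a \<in> carrier M" "b \<in> carrier M" for a b
      using \<psi>(1) that by (auto simp: mo_hom_def hom_def)
    have "u \<in> generate (units_of N) B" using UK that by (auto simp: K_def)
    then have "u \<in> Units N \<and> (\<exists>a\<in>carrier M. \<exists>b\<in>carrier M. \<psi> b \<in> Units N \<and> \<psi> a = u \<otimes>\<^bsub>N\<^esub> \<psi> b)"
    proof (induction rule: generate.induct)
      case one
      then show ?case
        by (auto simp: units_of_one \<psi>1 intro!: bexI[of _ "\<one>\<^bsub>M\<^esub>"])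
    next
      case (incl v)
      then obtain a where a: "a \<in> carrier M" "v = \<psi> a" "v \<in> Units N" using BU by (auto simp: B_def)
      then have "\<psi> \<one>\<^bsub>M\<^esub> \<in> Units N" "\<psi> a = v \<otimes>\<^bsub>N\<^esub> \<psi> \<one>\<^bsub>M\<^esub>"
        by (simp_all add: \<psi>1 \<psi>c)
      then show ?case using a(1,3) M.one_closed by blast
    next
      case (inv v)
      then obtain a where a: "a \<in> carrier M" "v = \<psi> a" "v \<in> Units N" using BU by (auto simp: B_def)
      then have "\<psi> \<one>\<^bsub>M\<^esub> = inv\<^bsub>N\<^esub> v \<otimes>\<^bsub>N\<^esub> \<psi> a" by (simp add: \<psi>1)
      then show ?case using a N.units_of_inv[OF a(3)] by (metis M.one_closed N.Units_inv_Units)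
    next
      case (eng v w)
      then obtain a b a' b' where ab: "v \<in> Units N" "w \<in> Units N"
        "a \<in> carrier M" "b \<in> carrier M" "\<psi> b \<in> Units N" "\<psi> a = v \<otimes>\<^bsub>N\<^esub> \<psi> b"
        "a' \<in> carrier M" "b' \<in> carrier M" "\<psi> b' \<in> Units N" "\<psi> a' = w \<otimes>\<^bsub>N\<^esub> \<psi> b'" by blast
      have "\<psi> (a \<otimes>\<^bsub>M\<^esub> a') = (v \<otimes>\<^bsub>N\<^esub> w) \<otimes>\<^bsub>N\<^esub> \<psi> (b \<otimes>\<^bsub>M\<^esub> b')"
        using ab by (simp add: \<psi>m N.m_ac N.Units_closed)
      moreover have "\<psi> (b \<otimes>\<^bsub>M\<^esub> b') \<in> Units N" using ab by (simp add: \<psi>m)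
      ultimately show ?case
        using ab unfolding units_of_mult by (metis M.m_closed N.Units_m_closed)
    qed
    then show ?thesis ..
  qed
  obtain C where C: "finite C" "C \<subseteq> Units N" "generate (units_of N) C = Units N"
    using noetherian_mo_finitely_generated_units[OF M N(1) \<psi>(1) gen] by blast
  let ?i = "inv_into (carrier ?U) \<theta>"
  have "generate ?U (?i ` C) = carrier ?U"
    by (rule U.generate_bij_hom[OF NU.is_group \<theta>(1)]) (use \<theta>(2) C in \<open>simp_all add: units_of_carrier\<close>)
  moreover have "?i ` C \<subseteq> carrier ?U"
    using bij_betw_inv_into[OF \<theta>(2)] C(2) by (auto simp: bij_betw_def)
  ultimately show ?thesis using C(1) by blast
qed

theorem card_Fob:
  assumes tf: "torsion_free_space X" and N: "mo_field N" and fin: "finite (Units N)"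
  shows "finite (Fob F N)"
    and "card (Fob F N) = (\<Sum>x\<in>points X. card (Units N) ^ local_dim X x)"
proof -
  interpret spec_points X N by (rule spec_points[OF N])
  obtain \<phi> where \<phi>: "bij_betw \<phi> (Fob F N) (SIGMA x:points X. homs x)"
    using Fob_bij_homs[OF N] by blast
  have H: "finite (homs x)" "card (homs x) = card (Units N) ^ local_dim X x" if x: "x \<in> points X" for x
  proof -
    interpret S: comm_monoid "stalk X x" using X.stalk_is_mo[OF x] by (simp add: is_mo_def)
    obtain B where B: "finite B" "B \<subseteq> carrier (units_of (stalk X x))"
      "generate (units_of (stalk X x)) B = carrier (units_of (stalk X x))"
      using stalk_units_finitely_generated[OF x] by blast
    have "torsion_free (units_of (stalk X x))" using tf x by (simp add: torsion_free_space_def)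
    note * = card_hom_torsion_free[OF S.units_comm_group units_comm_group this B]
    show "finite (homs x)" "card (homs x) = card (Units N) ^ local_dim X x"
      using * fin by (simp_all add: units_of_carrier local_dim_def)
  qed
  have "finite (SIGMA x:points X. homs x)" using finite_points H by (intro finite_SigmaI) auto
  then show "finite (Fob F N)" using bij_betw_finite[OF \<phi>] by simp
  have "card (Fob F N) = (\<Sum>x\<in>points X. card (homs x))"
    unfolding bij_betw_same_card[OF \<phi>] using finite_points H by (intro card_SigmaI) auto
  then show "card (Fob F N) = (\<Sum>x\<in>points X. card (Units N) ^ local_dim X x)"
    using H by simp
qed

end

section \<open>Kurokawa powers and the zeta function\<close>

definition lin :: "complex \<Rightarrow> ratfun" where
  "lin a = to_fract [:-a, 1:]"

lemma lin_nonzero [simp]: "lin a \<noteq> 0"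
  by (simp add: lin_def)

text \<open>Allows any representation as a fraction, reduced or not, which makes products and
  inverses immediate. Agreement with \<open>rat_order\<close>, which reads the reduced fraction,
  follows by cross-multiplication and additivity of the order.\<close>

definition has_rat_order :: "ratfun \<Rightarrow> complex \<Rightarrow> int \<Rightarrow> bool" where
  "has_rat_order f a k \<longleftrightarrow> (\<exists>p q. p \<noteq> 0 \<and> q \<noteq> 0 \<and> f = to_fract p / to_fract q \<and>
     k = int (Polynomial.order a p) - int (Polynomial.order a q))"

lemma has_rat_order_imp:
  assumes "has_rat_order f a k"
  shows "rat_order f a = k"
proof -
  obtain p q where pq: "p \<noteq> 0" "q \<noteq> 0" "f = to_fract p / to_fract q"
    "k = int (Polynomial.order a p) - int (Polynomial.order a q)"
    using assms unfolding has_rat_order_def by blast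
  define u v where "u = fst (quot_of_fract f)" and "v = snd (quot_of_fract f)"
  have f: "f = to_fract u / to_fract v"
    by (metis Fract_conv_to_fract Fract_quot_of_fract u_def v_def)
  have v0: "v \<noteq> 0" by (simp add: v_def)
  have u0: "u \<noteq> 0" using f pq by auto
  have "to_fract (u * q) = to_fract (p * v)"
    using f pq v0 by (simp add: frac_eq_eq)
  then have "u * q = p * v" by (simp only: to_fract_eq_iff)
  then have "Polynomial.order a u + Polynomial.order a q = Polynomial.order a p + Polynomial.order a v"
    using u0 v0 pq by (metis no_zero_divisors order_mult)
  then show ?thesis
    using pq(4) by (simp add: rat_order_def u_def[symmetric] v_def[symmetric])
qed

lemma has_rat_order_1: "has_rat_order 1 a 0"
  unfolding has_rat_order_def by (intro exI[of _ 1]) auto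

lemma has_rat_order_mult:
  assumes "has_rat_order f a k" "has_rat_order g a l"
  shows "has_rat_order (f * g) a (k + l)"
proof -
  obtain p q where 1: "p \<noteq> 0" "q \<noteq> 0" "f = to_fract p / to_fract q"
    "k = int (Polynomial.order a p) - int (Polynomial.order a q)"
    using assms(1) unfolding has_rat_order_def by blast
  obtain r s where 2: "r \<noteq> 0" "s \<noteq> 0" "g = to_fract r / to_fract s"
    "l = int (Polynomial.order a r) - int (Polynomial.order a s)"
    using assms(2) unfolding has_rat_order_def by blast
  show ?thesis
    unfolding has_rat_order_def
    by (rule exI[of _ "p * r"], rule exI[of _ "q * s"]) (use 1 2 in \<open>auto simp: order_mult\<close>)
qed

lemma has_rat_order_inverse:
  assumes "has_rat_order f a k"
  shows "has_rat_order (inverse f) a (- k)"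
proof -
  obtain p q where "p \<noteq> 0" "q \<noteq> 0" "f = to_fract p / to_fract q"
    "k = int (Polynomial.order a p) - int (Polynomial.order a q)"
    using assms(1) unfolding has_rat_order_def by blast
  then show ?thesis
    unfolding has_rat_order_def by (intro exI[of _ q] exI[of _ p]) auto
qed

lemma has_rat_order_power:
  assumes "has_rat_order f a k"
  shows "has_rat_order (f ^ n) a (int n * k)"
  by (induction n) (auto simp: has_rat_order_1 algebra_simps intro!: has_rat_order_mult assms)

lemma has_rat_order_powi:
  assumes "has_rat_order f a k"
  shows "has_rat_order (f powi n) a (n * k)"
proof (cases "n \<ge> 0")
  case True
  then show ?thesis
    using has_rat_order_power[OF assms, of "nat n"] by (simp add: power_int_def)
next
  case False
  then show ?thesis
    using has_rat_order_power[OF has_rat_order_inverse[OF assms], of "nat (- n)"]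
    by (simp add: power_int_def)
qed

lemma has_rat_order_prod:
  assumes "\<And>x. x \<in> S \<Longrightarrow> has_rat_order (f x) a (k x)"
  shows "has_rat_order (\<Prod>x\<in>S. f x) a (\<Sum>x\<in>S. k x)"
  using assms by (induction S rule: infinite_finite_induct)
    (auto simp: has_rat_order_1 intro!: has_rat_order_mult)

lemma has_rat_order_lin: "has_rat_order (lin a) z (if z = a then 1 else 0)"
proof -
  have "Polynomial.order z [:-a, 1:] = (if z = a then 1 else 0)"
    using order_power_n_n[of a 1] by (auto intro!: order_0I)
  then show ?thesis
    unfolding has_rat_order_def lin_def by (intro exI[of _ "[:-a, 1:]"] exI[of _ 1]) auto
qed

lemma rat_order_prod_lin:
  assumes "finite S"
  shows "rat_order (\<Prod>a\<in>S. lin a powi m a) z = (if z \<in> S then m z else 0)"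
proof -
  have "has_rat_order (\<Prod>a\<in>S. lin a powi m a) z (\<Sum>a\<in>S. m a * (if z = a then 1 else 0))"
    by (intro has_rat_order_prod has_rat_order_powi has_rat_order_lin)
  also have "(\<Sum>a\<in>S. m a * (if z = a then 1 else 0)) = (if z \<in> S then m z else 0)"
    using assms by (simp add: if_distrib cong: if_cong)
  finally show ?thesis by (rule has_rat_order_imp)
qed

text \<open>\<open>kurokawa\<close> runs over zeros and poles only. If some exponents vanish, these
  are fewer points than \<open>S\<close> and \<open>T\<close>, but the missing factors have exponent
  0 and contribute 1.\<close>

lemma kurokawa_prod_lin:
  assumes "finite S" "finite T"
  shows "kurokawa (\<Prod>a\<in>S. lin a powi m a) (\<Prod>b\<in>T. lin b powi n b) =
    (\<Prod>a\<in>S. \<Prod>b\<in>T. lin (a + b) powi (m a * n b))"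
proof -
  define f g where "f = (\<Prod>a\<in>S. lin a powi m a)" and "g = (\<Prod>b\<in>T. lin b powi n b)"
  have f: "rat_order f z = (if z \<in> S then m z else 0)" for z
    unfolding f_def by (rule rat_order_prod_lin[OF assms(1)])
  have g: "rat_order g z = (if z \<in> T then n z else 0)" for z
    unfolding g_def by (rule rat_order_prod_lin[OF assms(2)])
  have "kurokawa f g = (\<Prod>a\<in>rat_support f. \<Prod>b\<in>rat_support g. lin (a + b) powi (m a * n b))"
    unfolding kurokawa_def lin_def
    by (intro prod.cong refl) (auto simp: f g rat_support_def split: if_splits)
  also have "\<dots> = (\<Prod>a\<in>rat_support f. \<Prod>b\<in>T. lin (a + b) powi (m a * n b))"
    by (intro prod.cong refl prod.mono_neutral_left assms)
      (auto simp: g rat_support_def split: if_splits)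
  also have "\<dots> = (\<Prod>a\<in>S. \<Prod>b\<in>T. lin (a + b) powi (m a * n b))"
    by (intro prod.mono_neutral_left assms)
      (auto simp: f rat_support_def split: if_splits)
  finally show ?thesis by (simp only: f_def g_def)
qed

text \<open>The coefficient of \<open>y\<^sup>k\<close> in \<open>(y - 1)\<^sup>n\<close>.\<close>

definition sbinom :: "nat \<Rightarrow> nat \<Rightarrow> int" where
  "sbinom n k = (-1) ^ (n + k) * int (n choose k)"

lemma sbinom_Suc_Suc: "sbinom (Suc n) (Suc k) = sbinom n k - sbinom n (Suc k)"
  by (simp add: sbinom_def algebra_simps)

lemma sbinom_Suc_0: "sbinom (Suc n) 0 = - sbinom n 0"
  by (simp add: sbinom_def)

lemma sbinom_eq_0: "k > n \<Longrightarrow> sbinom n k = 0"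
  by (simp add: sbinom_def)

lemma sbinom_sum: "(\<Sum>k\<le>n. of_int (sbinom n k) * y ^ k) = (y - 1 :: 'a :: comm_ring_1) ^ n"
proof -
  have "(y + (-1)) ^ n = (\<Sum>k\<le>n. of_nat (n choose k) * y ^ k * (-1) ^ (n - k))"
    by (rule binomial_ring)
  also have "\<dots> = (\<Sum>k\<le>n. of_int (sbinom n k) * y ^ k)"
  proof (intro sum.cong refl)
    fix k assume "k \<in> {..n}"
    then have "(-1) ^ (n - k) = ((-1) ^ (n + k) :: 'a)"
      by (metis atMost_iff minus_one_power_iff even_diff_nat even_add not_le)
    then show "of_nat (n choose k) * y ^ k * (-1) ^ (n - k) = of_int (sbinom n k) * y ^ k"
      by (simp add: sbinom_def algebra_simps)
  qed
  finally show ?thesis by simp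
qed

lemma rat_s_eq_lin: "rat_s = lin 0"
  by (simp add: rat_s_def lin_def)

text \<open>The shape of the product is the one required by
  \<open>kurokawa_prod_lin\<close>.\<close>

lemma one_minus_inverse_rat_s: "1 - 1 / rat_s = (\<Prod>b\<in>{0, 1}. lin b powi (if b = 0 then -1 else 1))"
proof -
  have "lin 0 - 1 = lin 1"
    unfolding lin_def
    by (simp add: to_fract_1[symmetric] to_fract_diff[symmetric] one_pCons del: to_fract_1 to_fract_diff)
  then have "1 - 1 / rat_s = lin 1 / lin 0"
    by (metis diff_divide_distrib divide_self_if lin_nonzero rat_s_eq_lin)
  then show ?thesis by (simp add: power_int_minus field_simps)
qed

text \<open>Tensoring with (s - 1)/s turns a factor (s - k)^m into (s - k)^(-m) (s - k - 1)^m. On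
  the exponents, read as coefficients of a polynomial in y, this is multiplication by y - 1, so the
  n-th power carries the coefficients of (y - 1)^n. The convention for n = 0 fits: the value s has
  the single exponent 1 at k = 0.\<close>

lemma kurokawa_power_one_minus_inverse_s:
  "kurokawa_power (1 - 1 / rat_s) n = (\<Prod>k\<le>n. lin (of_nat k) powi sbinom n k)"
proof (induction "1 - 1 / rat_s :: ratfun" n rule: kurokawa_power.induct)
  case 1
  then show ?case by (simp add: rat_s_eq_lin sbinom_def)
next
  case 2
  have "{..Suc 0} = {0, 1}" by auto
  then show ?case
    unfolding kurokawa_power.simps one_minus_inverse_rat_s
    by (simp add: sbinom_def)
next
  case (3 n)
  define m where "m = Suc n"
  \<comment> \<open>\<open>kurokawa_prod_lin\<close> expects exponents indexed by the complex roots,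
    so the natural number is recovered from its image.\<close>
  define e where "e a = sbinom m (THE k. of_nat k = a)" for a :: complex
  have e: "e (of_nat k) = sbinom m k" for k by (simp add: e_def)
  have "(\<Prod>k\<le>m. lin (of_nat k) powi sbinom m k) = (\<Prod>a\<in>of_nat ` {..m}. lin a powi e a)"
    by (subst prod.reindex) (auto simp: e inj_on_def)
  then have "kurokawa_power (1 - 1 / rat_s) (Suc m) =
      kurokawa (\<Prod>a\<in>of_nat ` {..m}. lin a powi e a) (\<Prod>b\<in>{0, 1}. lin b powi (if b = 0 then -1 else 1))"
    using 3 by (simp add: m_def flip: one_minus_inverse_rat_s)
  also have "\<dots> = (\<Prod>a\<in>of_nat ` {..m}. \<Prod>b\<in>{0, 1}. lin (a + b) powi (e a * (if b = 0 then -1 else 1)))"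
    by (rule kurokawa_prod_lin) auto
  also have "\<dots> = (\<Prod>k\<le>m. lin (of_nat k) powi (- sbinom m k) * lin (of_nat (Suc k)) powi sbinom m k)"
    by (subst prod.reindex) (auto simp: e inj_on_def add.commute)
  also have "\<dots> = (\<Prod>k\<le>m. lin (of_nat k) powi (- sbinom m k)) *
      (\<Prod>k\<le>m. lin (of_nat (Suc k)) powi sbinom m k)"
    by (rule prod.distrib)
  \<comment> \<open>The added top factor has exponent 0. With it, splitting off k = 0 leaves a
    product over the same range as the other one, and the two can be merged by the Pascal rule
    \<open>sbinom_Suc_Suc\<close>.\<close>
  also have "(\<Prod>k\<le>m. lin (of_nat k) powi (- sbinom m k)) =
      (\<Prod>k\<le>Suc m. lin (of_nat k) powi (- sbinom m k))"
    by (simp add: sbinom_eq_0)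
  also have "\<dots> = lin 0 powi (- sbinom m 0) * (\<Prod>k\<le>m. lin (of_nat (Suc k)) powi (- sbinom m (Suc k)))"
    by (subst prod.atMost_Suc_shift) simp
  also have "\<dots> * (\<Prod>k\<le>m. lin (of_nat (Suc k)) powi sbinom m k) =
      lin 0 powi (- sbinom m 0) *
      (\<Prod>k\<le>m. lin (of_nat (Suc k)) powi (- sbinom m (Suc k)) * lin (of_nat (Suc k)) powi sbinom m k)"
    by (simp add: prod.distrib mult.assoc)
  also have "\<dots> = lin 0 powi sbinom (Suc m) 0 *
      (\<Prod>k\<le>m. lin (of_nat (Suc k)) powi sbinom (Suc m) (Suc k))"
    by (simp add: sbinom_Suc_Suc sbinom_Suc_0 flip: power_int_add)
  also have "\<dots> = (\<Prod>k\<le>Suc m. lin (of_nat k) powi sbinom (Suc m) k)"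
    by (subst prod.atMost_Suc_shift) simp
  finally show ?case by (simp add: m_def)
qed

section \<open>Values of rational functions and the limit q -> 1\<close>

text \<open>Any representing fraction is allowed. The numerator must not vanish either, so that
  inverses and negative powers can be taken.\<close>

definition has_rat_value :: "ratfun \<Rightarrow> complex \<Rightarrow> complex \<Rightarrow> bool" where
  "has_rat_value f z v \<longleftrightarrow> (\<exists>p q. poly p z \<noteq> 0 \<and> poly q z \<noteq> 0 \<and> f = to_fract p / to_fract q \<and>
     v = poly p z / poly q z)"

lemma has_rat_value_imp:
  assumes "has_rat_value f z v"
  shows "rat_eval f z = v"
proof -
  obtain p q where pq: "poly p z \<noteq> 0" "poly q z \<noteq> 0" "f = to_fract p / to_fract q"
    "v = poly p z / poly q z"
    using assms unfolding has_rat_value_def by blast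
  define a b where "a = fst (quot_of_fract f)" and "b = snd (quot_of_fract f)"
  have f: "f = to_fract a / to_fract b"
    by (metis Fract_conv_to_fract Fract_quot_of_fract a_def b_def)
  have b0: "b \<noteq> 0" by (simp add: b_def)
  have q0: "q \<noteq> 0" using pq by auto
  have "to_fract (a * q) = to_fract (p * b)"
    using f pq b0 q0 by (simp add: frac_eq_eq)
  then have eq: "a * q = p * b" by (simp only: to_fract_eq_iff)
  have "coprime a b" unfolding a_def b_def by (rule coprime_quot_of_fract)
  moreover have "b dvd a * q" by (simp add: eq)
  \<comment> \<open>The reduced denominator divides every other denominator, hence it does not
    vanish at \<open>z\<close>.\<close>
  ultimately have "b dvd q"
    by (simp add: coprime_commute coprime_dvd_mult_right_iff)
  then have bz: "poly b z \<noteq> 0" using pq(2) by auto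
  have "poly a z * poly q z = poly p z * poly b z"
    using eq by (metis poly_mult)
  then have "poly a z / poly b z = v"
    using bz pq by (simp add: frac_eq_eq)
  then show ?thesis by (simp add: rat_eval_def a_def b_def)
qed

lemma has_rat_value_1: "has_rat_value 1 z 1"
  unfolding has_rat_value_def by (intro exI[of _ 1]) auto

lemma has_rat_value_mult:
  assumes "has_rat_value f z v" "has_rat_value g z w"
  shows "has_rat_value (f * g) z (v * w)"
proof -
  obtain p q where 1: "poly p z \<noteq> 0" "poly q z \<noteq> 0" "f = to_fract p / to_fract q"
    "v = poly p z / poly q z"
    using assms(1) unfolding has_rat_value_def by blast
  obtain r s where 2: "poly r z \<noteq> 0" "poly s z \<noteq> 0" "g = to_fract r / to_fract s"
    "w = poly r z / poly s z"
    using assms(2) unfolding has_rat_value_def by blast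
  show ?thesis
    unfolding has_rat_value_def
    by (rule exI[of _ "p * r"], rule exI[of _ "q * s"]) (use 1 2 in auto)
qed

lemma has_rat_value_inverse:
  assumes "has_rat_value f z v"
  shows "has_rat_value (inverse f) z (inverse v)"
proof -
  obtain p q where "poly p z \<noteq> 0" "poly q z \<noteq> 0" "f = to_fract p / to_fract q"
    "v = poly p z / poly q z"
    using assms(1) unfolding has_rat_value_def by blast
  then show ?thesis
    unfolding has_rat_value_def by (intro exI[of _ q] exI[of _ p]) auto
qed

lemma has_rat_value_power:
  assumes "has_rat_value f z v"
  shows "has_rat_value (f ^ n) z (v ^ n)"
  by (induction n) (auto simp: has_rat_value_1 intro!: has_rat_value_mult assms)

lemma has_rat_value_powi:
  assumes "has_rat_value f z v"
  shows "has_rat_value (f powi n) z (v powi n)"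
  unfolding power_int_def
  by (auto intro!: has_rat_value_power has_rat_value_inverse assms)

lemma has_rat_value_prod:
  assumes "\<And>x. x \<in> S \<Longrightarrow> has_rat_value (f x) z (v x)"
  shows "has_rat_value (\<Prod>x\<in>S. f x) z (\<Prod>x\<in>S. v x)"
  using assms by (induction S rule: infinite_finite_induct)
    (auto simp: has_rat_value_1 intro!: has_rat_value_mult)

lemma has_rat_value_lin:
  assumes "z \<noteq> a"
  shows "has_rat_value (lin a) z (z - a)"
  unfolding has_rat_value_def lin_def
  by (intro exI[of _ "[:-a, 1:]"] exI[of _ 1]) (use assms in auto)

lemma sums_minus_ln_one_minus:
  fixes x :: real
  assumes "\<bar>x\<bar> < 1"
  shows "(\<lambda>r. x ^ Suc r / real (Suc r)) sums - ln (1 - x)"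
proof -
  have "(\<lambda>n. - (x ^ n) / of_nat n) sums ln (1 - x)"
    using ln_series'[of "- x"] assms by simp
  then have "(\<lambda>n. x ^ n / of_nat n) sums - ln (1 - x)"
    using sums_minus by fastforce
  \<comment> \<open>The term of index 0 is a division by 0 and hence 0, so the shift of the index
    loses nothing.\<close>
  then show ?thesis
    by (subst sums_Suc_iff) simp
qed

lemma poly_at_sum_powers:
  assumes "N = (\<Sum>x\<in>S. [:-1, 1:] ^ d x)"
  shows "poly_at N y = (\<Sum>x\<in>S. \<Sum>k\<le>d x. of_int (sbinom (d x) k) * y ^ k)"
proof -
  have mult: "map_poly real_of_int (p * q) = map_poly real_of_int p * map_poly real_of_int q" for p q
    by (intro poly_eqI) (simp add: coeff_map_poly coeff_mult)
  have pw: "map_poly real_of_int (p ^ n) = map_poly real_of_int p ^ n" for p n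
    by (induction n) (simp_all add: mult)
  have "map_poly real_of_int N = (\<Sum>x\<in>S. map_poly real_of_int ([:-1, 1:] ^ d x))"
    unfolding assms by (intro poly_eqI) (simp add: coeff_map_poly coeff_sum)
  then show ?thesis
    by (simp add: poly_at_def pw poly_sum map_poly_pCons sbinom_sum)
qed

lemma poly_sum_powers:
  assumes "N = (\<Sum>x\<in>S. [:-1, 1:] ^ d x)"
  shows "poly N y = (\<Sum>x\<in>S. (y - 1 :: int) ^ d x)"
  unfolding assms by (simp add: poly_sum)

lemma power_int_sum:
  fixes a :: "'a :: field"
  assumes "a \<noteq> 0"
  shows "a powi (\<Sum>x\<in>S. f x) = (\<Prod>x\<in>S. a powi f x)"
  by (induction S rule: infinite_finite_induct) (simp_all add: power_int_add assms)

lemma exp_of_int_mult_ln: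
  fixes a :: real
  assumes "a > 0"
  shows "exp (of_int n * ln a) = a powi n"
  using assms powr_real_of_int'[of a n] by (simp add: powr_def)

text \<open>The expression is the difference quotient at 1 of the function -q^(-c), whose derivative
  there is c.\<close>

lemma tendsto_one_minus_powr:
  "((\<lambda>q. (1 - q powr (- c)) / (q - 1)) \<longlongrightarrow> c) (at_right (1 :: real))"
proof -
  have "((\<lambda>q::real. - (q powr (- c))) has_real_derivative c) (at 1)"
    by (auto intro!: derivative_eq_intros)
  then have "((\<lambda>q. (- (q powr (- c)) - - (1 powr (- c))) / (q - 1)) \<longlongrightarrow> c) (at 1)"
    by (simp only: has_field_derivative_iff)
  then have "((\<lambda>q. (1 - q powr (- c)) / (q - 1)) \<longlongrightarrow> c) (at 1)"
    by simp
  then show ?thesis by (rule filterlim_mono) (auto intro: at_le)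
qed

text \<open>Expanding N into signed powers indexed by pairs (x, k) turns the exponent of Z into a
  combination of logarithm series, so Z is the product of the factors (1 - q^(k-s))^(-e). The
  exponents e add up to N(1); hence (q - 1)^N(1) supplies one factor (q - 1)^e for each pair, and
  each quotient (1 - q^(k-s))/(q - 1) tends to s - k.\<close>

theorem is_zeta_function_sum_powers:
  assumes N: "N = (\<Sum>x\<in>S. [:-1, 1:] ^ d x)" and fin: "finite S"
  shows "is_zeta_function N (\<Prod>x\<in>S. 1 / kurokawa_power (1 - 1 / rat_s) (d x))"
  unfolding is_zeta_function_def
proof (intro exI allI impI conjI)
  \<comment> \<open>An upper bound for all k that occur. For s beyond it the powers q^(k-s) are less
    than 1, so the series converge, and s avoids all zeros and poles of the product.\<close>
  define D where "D = (\<Sum>x\<in>S. d x)"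
  have D: "d x \<le> D" if "x \<in> S" for x
    unfolding D_def using fin that by (simp add: member_le_sum)
  define A where "A = Sigma S (\<lambda>x. {..d x})"
  define e where "e = (\<lambda>(x, k). sbinom (d x) k)"
  have finA: "finite A" using fin by (simp add: A_def)
  fix s assume s: "real D < s"
  have sk: "real k < s" if "(x, k) \<in> A" for x k
    using that s D[of x] by (auto simp: A_def)
  have small: "0 < q powr (real k - s)" "q powr (real k - s) < 1" if "q > 1" "(x, k) \<in> A" for q x k
    using that sk[of x k] powr_less_mono[of "real k - s" 0 q] by auto
  have sums: "Z_term N q (q powr - s) sums (\<Sum>(x, k)\<in>A. of_int (e (x, k)) * - ln (1 - q powr (real k - s)))"
    if q: "q > 1" for q
  proof -
    have "Z_term N q (q powr - s) r =
        (\<Sum>(x, k)\<in>A. of_int (e (x, k)) * ((q powr (real k - s)) ^ Suc r / real (Suc r)))" for r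
    proof -
      have "(q ^ Suc r) ^ k * (q powr - s) ^ Suc r = (q powr (real k - s)) ^ Suc r" for k
      proof -
        have "q powr (real k - s) = q ^ k * q powr - s"
          using q by (simp add: powr_diff powr_realpow powr_minus field_simps)
        then show ?thesis
          by (simp only: power_mult_distrib power_mult[symmetric] mult.commute)
      qed
      then have t: "of_int c * (q ^ Suc r) ^ k * (q powr - s) ^ Suc r / real (Suc r) =
          of_int c * ((q powr (real k - s)) ^ Suc r / real (Suc r))" for c k
        by (metis mult.assoc times_divide_eq_right)
      show ?thesis
        unfolding Z_term_def poly_at_sum_powers[OF N] sum_distrib_right sum_divide_distrib A_def e_def t
        by (simp add: sum.Sigma fin split_def del: power_Suc of_nat_Suc)
    qed
    moreover have "(\<lambda>r. \<Sum>(x, k)\<in>A. of_int (e (x, k)) * ((q powr (real k - s)) ^ Suc r / real (Suc r)))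
      sums (\<Sum>(x, k)\<in>A. of_int (e (x, k)) * - ln (1 - q powr (real k - s)))"
      unfolding split_def
      by (intro sums_sum sums_mult sums_minus_ln_one_minus) (use small[OF q] in auto)
    ultimately show ?thesis by presburger
  qed
  show "summable (Z_term N q (q powr - s))" if "q > 1" for q
    using sums[OF that] by (rule sums_summable)
  \<comment> \<open>Evaluation of the expansion at y = 1. It allows the normalizing power of q - 1
    to be distributed over the pairs.\<close>
  have N1: "poly N 1 = (\<Sum>p\<in>A. e p)"
    unfolding poly_sum_powers[OF N] sbinom_sum[symmetric] A_def e_def
    by (simp add: sum.Sigma fin split_def)
  have val: "Z_fun N q (q powr - s) * (q - 1) powi poly N 1 =
      (\<Prod>(x, k)\<in>A. ((1 - q powr (- (s - real k))) / (q - 1)) powi - e (x, k))" if q: "q > 1" for q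
  proof -
    have "Z_fun N q (q powr - s) = exp (\<Sum>(x, k)\<in>A. of_int (- e (x, k)) * ln (1 - q powr (real k - s)))"
      unfolding Z_fun_def sums_unique[OF sums[OF q], symmetric] by (simp add: split_def)
    also have "\<dots> = (\<Prod>(x, k)\<in>A. exp (of_int (- e (x, k)) * ln (1 - q powr (real k - s))))"
      unfolding split_def by (rule exp_sum[OF finA])
    also have "\<dots> = (\<Prod>(x, k)\<in>A. (1 - q powr (real k - s)) powi - e (x, k))"
      by (intro prod.cong refl) (use small[OF q] in \<open>auto simp: exp_of_int_mult_ln simp del: of_int_minus\<close>)
    finally have "Z_fun N q (q powr - s) * (q - 1) powi poly N 1 =
        (\<Prod>(x, k)\<in>A. (1 - q powr (real k - s)) powi - e (x, k)) * (\<Prod>(x, k)\<in>A. (q - 1) powi e (x, k))"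
      using q by (simp add: N1 power_int_sum split_def)
    also have "\<dots> = (\<Prod>(x, k)\<in>A. ((1 - q powr (- (s - real k))) / (q - 1)) powi - e (x, k))"
      by (simp add: split_def prod.distrib[symmetric] power_int_divide_distrib power_int_minus field_simps)
    finally show ?thesis .
  qed
  define L where "L = (\<Prod>(x, k)\<in>A. (s - real k) powi - e (x, k))"
  have "((\<lambda>q. \<Prod>p\<in>A. ((1 - q powr (- (s - real (snd p)))) / (q - 1)) powi - e p)
      \<longlongrightarrow> (\<Prod>p\<in>A. (s - real (snd p)) powi - e p)) (at_right 1)"
    by (intro tendsto_prod tendsto_power_int tendsto_one_minus_powr) (use sk in fastforce)
  \<comment> \<open>The product formula \<open>val\<close> is available only for q > 1, which is why
    the limit is taken from the right.\<close>
  then have "((\<lambda>q. Z_fun N q (q powr - s) * (q - 1) powi poly N 1) \<longlongrightarrow> L) (at_right 1)"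
    unfolding L_def split_def prod.collapse
    by (rule Lim_transform_eventually)
      (auto simp: val split_def eventually_at_right_less intro: eventually_mono[OF eventually_at_right_less])
  then have lim: "((\<lambda>q. complex_of_real (Z_fun N q (q powr - s) * (q - 1) powi poly N 1))
      \<longlongrightarrow> complex_of_real L) (at_right 1)"
    by (rule tendsto_of_real)
  have "has_rat_value (\<Prod>x\<in>S. 1 / kurokawa_power (1 - 1 / rat_s) (d x)) (complex_of_real s)
      (\<Prod>x\<in>S. inverse (\<Prod>k\<le>d x. (of_real s - of_nat k) powi sbinom (d x) k))"
    unfolding kurokawa_power_one_minus_inverse_s
    unfolding divide_inverse mult_1_left
  proof (intro has_rat_value_prod has_rat_value_inverse has_rat_value_powi has_rat_value_lin)
    fix x k assume "x \<in> S" "k \<in> {..d x}"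
    then have "real k < s" using sk[of x k] by (simp add: A_def)
    then show "complex_of_real s \<noteq> of_nat k"
      by (metis of_real_eq_iff of_real_of_nat_eq less_irrefl)
  qed
  moreover have "(\<Prod>x\<in>S. inverse (\<Prod>k\<le>d x. (of_real s - of_nat k) powi sbinom (d x) k)) = complex_of_real L"
  proof -
    have inv: "inverse (\<Prod>k\<le>n. f k powi m k) = (\<Prod>k\<le>n. f k powi - m k)" for n m and f :: "nat \<Rightarrow> complex"
      by (induction n) (simp_all add: power_int_minus)
    have "complex_of_real L = (\<Prod>(x, k)\<in>A. (of_real s - of_nat k) powi - sbinom (d x) k)"
      by (simp add: L_def e_def split_def)
    also have "\<dots> = (\<Prod>x\<in>S. \<Prod>k\<le>d x. (of_real s - of_nat k) powi - sbinom (d x) k)"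
      unfolding A_def by (rule prod.Sigma[symmetric]) (use fin in auto)
    finally show ?thesis by (simp only: inv)
  qed
  ultimately have "rat_eval (\<Prod>x\<in>S. 1 / kurokawa_power (1 - 1 / rat_s) (d x)) (complex_of_real s) =
      complex_of_real L"
    by (simp only: has_rat_value_imp)
  with lim show "((\<lambda>q. complex_of_real (Z_fun N q (q powr - s) * (q - 1) powi poly N 1))
      \<longlongrightarrow> rat_eval (\<Prod>x\<in>S. 1 / kurokawa_power (1 - 1 / rat_s) (d x)) (complex_of_real s)) (at_right 1)"
    by (simp only:)
qed

section \<open>Assembly of the counting polynomial\<close>

text \<open>The shift turns each y - 1 into y, leaving a sum of monomials; this gives the
  nonnegativity of the coefficients.\<close>

lemma pcompose_sum_powers:
  fixes d :: "'x \<Rightarrow> nat"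
  shows "pcompose (\<Sum>x\<in>S. [:-1, 1:] ^ d x) [:1, 1:] = (\<Sum>x\<in>S. monom (1 :: int) (d x))"
proof -
  have "pcompose ([:-1, 1:] ^ n) [:1, 1:] = monom (1 :: int) n" for n
  proof (induction n)
    case (Suc n)
    have "pcompose [:-1, 1:] [:1, 1:] = [:0, 1 :: int:]" by (simp add: pcompose_pCons)
    then show ?case by (simp only: power_Suc pcompose_mult Suc) (simp add: monom_Suc)
  qed (simp add: pcompose_1 one_pCons monom_0)
  then show ?thesis by (simp add: pcompose_sum)
qed

theorem theorem4p10:
  fixes \<X> :: "('a, 'b) mr_functor" and X :: "('p, 's) gspace"
  assumes "infinite (UNIV :: 'a set)"
    and "noetherian_F1_scheme \<X>"
    and "geometric_realization (mo_part \<X>) X"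
    and "torsion_free_space X"
  shows "\<exists>N :: int poly.
     (\<forall>k. Polynomial.coeff (pcompose N [:1, 1:]) k \<ge> 0) \<and>
     (\<forall>n\<ge>1. \<forall>M. is_mo M \<and> mo_isomorphic M (F1n n) \<longrightarrow>
        finite (Fob (mo_part \<X>) M) \<and>
        int (card (Fob (mo_part \<X>) M)) = poly N (int n + 1)) \<and>
     (\<forall>K. field K \<and> finite (carrier K) \<longrightarrow>
        finite (Fob (ring_part \<X>) K) \<and>
        int (card (Fob (ring_part \<X>) K)) = poly N (int (card (carrier K)))) \<and>
     finite (points X) \<and>
     is_zeta_function N
       (\<Prod>x\<in>points X. 1 / kurokawa_power (1 - 1 / rat_s) (local_dim X x))"
proof -
  interpret realization "mo_part \<X>" X
    using assms(1-3) by unfold_locales (simp_all add: noetherian_F1_scheme_def)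
  define N :: "int poly" where "N = (\<Sum>x\<in>points X. [:-1, 1:] ^ local_dim X x)"
  \<comment> \<open>The common source of both counts: \<open>F1n n\<close> has n units, and a field
    with q elements has q - 1, so the arguments of \<open>N\<close> become n + 1 and q.\<close>
  have count: "finite (Fob (mo_part \<X>) M) \<and> int (card (Fob (mo_part \<X>) M)) = poly N (int (card (Units M)) + 1)"
    if "mo_field M" "finite (Units M)" for M
    using card_Fob[OF assms(4) that] by (simp add: poly_sum_powers[OF N_def])
  have "Polynomial.coeff (pcompose N [:1, 1:]) k \<ge> 0" for k
    unfolding N_def pcompose_sum_powers by (auto simp: coeff_sum intro!: sum_nonneg)
  moreover have "finite (Fob (mo_part \<X>) M) \<and> int (card (Fob (mo_part \<X>) M)) = poly N (int n + 1)"
    if n: "n \<ge> 1" and M: "is_mo M" "mo_isomorphic M (F1n n)" for n and M :: "'a mo"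
  proof -
    note F1 = mo_isomorphic_F1[OF M(1) abelian_integer_mod_group M(2)[unfolded F1n_def]]
    obtain \<theta> where \<theta>: "bij_betw \<theta> (carrier (integer_mod_group n)) (Units M)" using F1(2) by blast
    have "carrier (integer_mod_group n) = {0..<int n}" using n by (simp add: carrier_integer_mod_group)
    then have "finite (Units M)" "card (Units M) = n"
      using bij_betw_finite[OF \<theta>] bij_betw_same_card[OF \<theta>] by simp_all
    then show ?thesis using count[OF F1(1)] by simp
  qed
  moreover have "finite (Fob (ring_part \<X>) K) \<and>
      int (card (Fob (ring_part \<X>) K)) = poly N (int (card (carrier K)))"
    if K: "field K" "finite (carrier K)" for K
  proof -
    interpret K: field K by (rule K(1))
    \<comment> \<open>At a field the \<open>\<int>\<close>-scheme has as many points as the monoid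
      functor has at the multiplicative monoid, to which \<open>count\<close> applies.\<close>
    have "bij_betw (ev \<X> K) (Fob (mo_part \<X>) (beta_star K)) (Fob (ring_part \<X>) K)"
      using assms(2) K(1) by (simp add: noetherian_F1_scheme_def F1_scheme_def)
    note bij = bij_betw_finite[OF this] bij_betw_same_card[OF this]
    have "finite (Units (beta_star K))" using K by (simp add: mo_field_beta_star)
    moreover have "int (card (Units (beta_star K))) + 1 = int (card (carrier K))"
      using K(2) by (simp add: mo_field_beta_star[OF K(1)] card_Diff_singleton card_gt_0_iff of_nat_diff
        Suc_le_eq) (use card_gt_0_iff[of "carrier K"] K(2) K.zero_closed in force)
    ultimately show ?thesis
      using count[OF mo_field_beta_star(1)[OF K(1)]] bij by simp
  qed
  moreover have "is_zeta_function N (\<Prod>x\<in>points X. 1 / kurokawa_power (1 - 1 / rat_s) (local_dim X x))"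
    by (rule is_zeta_function_sum_powers[OF N_def finite_points])
  ultimately show ?thesis using finite_points by blast
qed

end
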